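(* Suppose $\Omega^*\subset\mathbb{C}$ is a non-degenerate doubly connected domain satisfying at least one of the following conditions: (1) $\operatorname{Mod}_{\mathrm{aff}}\Omega^*>\operatorname{Mod}\Omega^*$; (2) $\Omega^*$ is a Teichmüller ring; (3) $\Omega^*$ is a double Teichmüller ring. Then there exists $\epsilon_0>0$ such that for every doubly connected domain $\Omega\subset\mathbb{C}$ with \[ \operatorname{Mod}\Omega^*<\operatorname{Mod}\Omega<\operatorname{Mod}\Omega^*+\epsilon_0 \] there exists a harmonic homeomorphism $h\colon\Omega\to\Omega^*$ (from $\Omega$ onto $\Omega^*$).
   Context: A domain $\Omega\subset\mathbb{C}$ is doubly connected if $\hat{\mathbb{C}}\setminus\Omega$ (complement in the Riemann sphere) has exactly two connected components; it is non-degenerate if both of these components contain more than one point, and degenerate otherwise. Every non-degenerate doubly connected domain is conformally equivalent to an annulus $\{z: r<|z|<R\}$ with $0<r<R<\infty$, where $R/r$ is uniquely determined; its conformal modulus is $\operatorname{Mod}\Omega=\log(R/r)$. If $\Omega$ is degenerate, set $\operatorname{Mod}\Omega=\infty$. An affine transformation of $\mathbb{C}$ is a map $z\mapsto az+b\bar z+c$ with $a,b,c\in\mathbb{C}$ and $|a|^2-|b|^2\neq 0$. The affine modulus of a doubly connected domain $\Omega$ is \[ \operatorname{Mod}_{\mathrm{aff}}\Omega=\sup\{\operatorname{Mod}\phi(\Omega):\ \phi \text{ is an affine transformation}\}. \] A Teichmüller ring is a domain $\mathcal{T}(s)=\mathbb{C}\setminus([-1,0]\cup[s,+\infty))$ with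 $s>0$. A double Teichmüller ring is a domain $\mathcal{F}(s,t)=\mathbb{C}\setminus((-\infty,-s]\cup[-1,1]\cup[t,+\infty))$ with $s,t>1$. A complex-valued function is harmonic if its real and imaginary parts are real-valued harmonic functions. A harmonic homeomorphism $h\colon\Omega\to\Omega^*$ is a homeomorphism of $\Omega$ onto $\Omega^*$ that is harmonic in $\Omega$. *)

theory Defs
  imports "HOL-Complex_Analysis.Complex_Analysis"
begin

section \<open>Doubly connected domains\<close>

text \<open>The Riemann sphere is the one-point compactification of the plane, on the type
  \<^typ>\<open>complex option\<close>: the finite point \<open>z\<close> is \<open>Some z\<close>, the point at infinity is \<open>None\<close>.\<close>

definition riemann_sphere :: "complex option topology" where
  "riemann_sphere = Alexandroff_compactification euclidean"

definition plane_domain :: "complex set \<Rightarrow> bool" where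
  "plane_domain S \<longleftrightarrow> open S \<and> connected S \<and> S \<noteq> {}"

definition sphere_complement_components :: "complex set \<Rightarrow> complex option set set" where
  "sphere_complement_components S =
     connected_components_of (subtopology riemann_sphere (topspace riemann_sphere - Some ` S))"

definition doubly_connected :: "complex set \<Rightarrow> bool" where
  "doubly_connected S \<longleftrightarrow> plane_domain S \<and> card (sphere_complement_components S) = 2"

definition nondegenerate :: "complex set \<Rightarrow> bool" where
  "nondegenerate S \<longleftrightarrow>
     doubly_connected S \<and>
     (\<forall>C\<in>sphere_complement_components S. \<exists>x\<in>C. \<exists>y\<in>C. x \<noteq> y)"


section \<open>Conformal and affine modulus\<close>

definition conformally_equivalent :: "complex set \<Rightarrow> complex set \<Rightarrow> bool" where
  "conformally_equivalent S T \<longleftrightarrow>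
     (\<exists>f. f holomorphic_on S \<and> bij_betw f S T)"

definition annulus :: "real \<Rightarrow> real \<Rightarrow> complex set" where
  "annulus r R = {z. r < cmod z \<and> cmod z < R}"

text \<open>Only meaningful on doubly connected domains, where the degenerate ones have modulus
  \<open>\<infinity>\<close>.\<close>

definition conformal_modulus :: "complex set \<Rightarrow> ereal" where
  "conformal_modulus S =
     (if nondegenerate S
      then ereal (THE m. \<exists>r R. 0 < r \<and> r < R \<and>
                    conformally_equivalent S (annulus r R) \<and> m = ln (R / r))
      else \<infinity>)"

definition affine_transformation :: "(complex \<Rightarrow> complex) \<Rightarrow> bool" where
  "affine_transformation \<phi> \<longleftrightarrow>
     (\<exists>a b c. (cmod a)\<^sup>2 - (cmod b)\<^sup>2 \<noteq> 0 \<and> \<phi> = (\<lambda>z. a * z + b * cnj z + c))"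

definition affine_modulus :: "complex set \<Rightarrow> ereal" where
  "affine_modulus S = (SUP \<phi>\<in>Collect affine_transformation. conformal_modulus (\<phi> ` S))"


section \<open>Teichmueller rings\<close>

definition teichmueller_ring :: "real \<Rightarrow> complex set" where
  "teichmueller_ring s = - (complex_of_real ` ({-1..0} \<union> {s..}))"

definition double_teichmueller_ring :: "real \<Rightarrow> real \<Rightarrow> complex set" where
  "double_teichmueller_ring s t = - (complex_of_real ` ({..-s} \<union> {-1..1} \<union> {t..}))"


section \<open>Harmonic homeomorphisms\<close>

text \<open>\<open>u\<close> is continuously differentiable on the open set \<open>S\<close>, with partial derivatives
  \<open>p\<close> (in the real direction) and \<open>q\<close> (in the imaginary direction).\<close>

definition C1_with_partials ::
  "(complex \<Rightarrow> real) \<Rightarrow> (complex \<Rightarrow> real) \<Rightarrow> (complex \<Rightarrow> real) \<Rightarrow> complex set \<Rightarrow> bool" where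
  "C1_with_partials u p q S \<longleftrightarrow>
     continuous_on S p \<and> continuous_on S q \<and>
     (\<forall>z\<in>S. (u has_derivative (\<lambda>h. p z * Re h + q z * Im h)) (at z))"

text \<open>Twice continuously differentiable solutions of Laplace's equation
  \<open>u\<^sub>x\<^sub>x + u\<^sub>y\<^sub>y = 0\<close>; intended for open \<open>S\<close>.\<close>

definition real_harmonic_on :: "(complex \<Rightarrow> real) \<Rightarrow> complex set \<Rightarrow> bool" where
  "real_harmonic_on u S \<longleftrightarrow>
     (\<exists>ux uy uxx uxy uyx uyy.
        C1_with_partials u ux uy S \<and>
        C1_with_partials ux uxx uxy S \<and>
        C1_with_partials uy uyx uyy S \<and>
        (\<forall>z\<in>S. uxx z + uyy z = 0))"

definition complex_harmonic_on :: "(complex \<Rightarrow> complex) \<Rightarrow> complex set \<Rightarrow> bool" where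
  "complex_harmonic_on h S \<longleftrightarrow>
     real_harmonic_on (\<lambda>z. Re (h z)) S \<and> real_harmonic_on (\<lambda>z. Im (h z)) S"

definition harmonic_homeomorphism ::
  "complex set \<Rightarrow> complex set \<Rightarrow> (complex \<Rightarrow> complex) \<Rightarrow> bool" where
  "harmonic_homeomorphism S T h \<longleftrightarrow>
     (\<exists>g. homeomorphism S T h g) \<and> complex_harmonic_on h S"

end

theory Submission
  imports Defs
begin

text \<open>It suffices to find, for every modulus slightly above that of \<open>\<Omega>'\<close>, a domain \<open>U\<close> of that
  modulus together with a bijection \<open>U \<rightarrow> \<Omega>'\<close> of the form \<open>P + cnj Q\<close> with \<open>P\<close>, \<open>Q\<close> holomorphic: a
  conformal map \<open>\<Omega> \<rightarrow> U\<close> then keeps this form. Such a \<open>U\<close> is found by the intermediate value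
  theorem in a one-parameter family starting at \<open>\<Omega>'\<close>. The modulus is continuous along the
  family because its members are related by quasiconformal maps with dilatation close to 1, and
  Groetzsch's length-area argument bounds the change of the modulus by the dilatation.

  If the affine modulus exceeds the modulus, the family consists of the affine images
  \<open>z + x \<mu> cnj z\<close> of \<open>\<Omega>'\<close>. The affine images of a Teichmueller ring are all similar to it, since
  its slits lie on a line; there the family arises instead by a nonlinear shear
  \<open>z + c Re k(z)\<close>, where \<open>k' = -J\<^sup>2\<close> and \<open>J\<close> is the inverse Joukowski map into the unit disc. As
  \<open>\<bar>k'\<bar> < 1\<close>, the shear maps every horizontal line monotonically onto itself and merely moves the
  tips of the slits; the modulus increases strictly by the case of equality in Groetzsch's
  inequality.

  Conformal maps onto annuli come from the exponential covering: if \<open>K\<close> is a continuum in the unit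
  disc containing 0, the preimage of its complement under \<open>exp\<close> is simply connected, and
  translation by \<open>2 \<pi> \<i>\<close> becomes a fixed point free automorphism of the half plane, which is a
  dilation or a translation. The latter would make \<open>K\<close> a point.\<close>

unbundle no fps_syntax

section \<open>Planar change of variables and the Groetzsch inequality\<close>

text \<open>Only real-affine maps and stretches of the real coordinate serve as quasiconformal maps.
  Both have continuous differentials, so dilatation is a pointwise condition and areas come from the
  smooth change of variables; this is why the stretches are built from a \<open>C1\<close> ramp.
  Orientation is never fixed: the length-area argument only needs that the image of a circle winds a
  nonzero integer number \<open>n\<close> of times, hence \<open>1 \<le> n\<^sup>2\<close>.
  Conjugation and inversions thus need no separate theory, and dilatation 1 already shows that the
  modulus is well defined. The gain for slit domains has a simple source. The shear pushes the ends
  of [-1, 1] outward by c/3 and moves every point of the outer rays by at most that much. Dividing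
  by 1 + c/3 restores the middle slit but pulls the outer tips inward, so the domain that is mapped
  onto the given one has its outer tips farther out. That a larger slit domain has strictly larger
  modulus is seen on annuli: the inclusion is homotopic to a homeomorphism, so it winds, and equal
  moduli would make it z -> c z or z -> c / z and hence onto.\<close>

text \<open>The determinant of a real-linear map of the plane.\<close>

definition jac :: "(complex \<Rightarrow> complex) \<Rightarrow> real" where
  "jac L = Im (cnj (L 1) * L \<i>)"

text \<open>The change of variables formula is stated on \<open>real^2\<close>, the complex analysis
  on \<open>complex\<close>; this pair of inverse maps carries integrals from one to the
  other.\<close>

definition complex_of_vec2 :: "real^2 \<Rightarrow> complex" where
  "complex_of_vec2 x = Complex (x$1) (x$2)"

definition vec2_of_complex :: "complex \<Rightarrow> real^2" where
  "vec2_of_complex z = (\<chi> i. if i = 1 then Re z else Im z)"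

lemma vec2_of_complex_nth [simp]:
  "vec2_of_complex z $ 1 = Re z" "vec2_of_complex z $ 2 = Im z"
  by (auto simp: vec2_of_complex_def)

lemma complex_of_vec2_sel [simp]:
  "Re (complex_of_vec2 x) = x$1" "Im (complex_of_vec2 x) = x$2"
  by (auto simp: complex_of_vec2_def)

lemma vec2_complex_inverse [simp]:
  "complex_of_vec2 (vec2_of_complex z) = z" "vec2_of_complex (complex_of_vec2 x) = x"
  by (auto simp: complex_eq_iff vec_eq_iff forall_2)

lemma bounded_linear_complex_of_vec2: "bounded_linear complex_of_vec2"
  by (intro linear_conv_bounded_linear[THEN iffD1] linearI) (auto simp: complex_eq_iff)

lemma bounded_linear_vec2_of_complex: "bounded_linear vec2_of_complex"
  by (intro linear_conv_bounded_linear[THEN iffD1] linearI) (auto simp: vec_eq_iff forall_2)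

lemma det_matrix_eq_jac:
  "det (matrix (\<lambda>x. vec2_of_complex (L (complex_of_vec2 x)))) = jac L"
proof -
  have "complex_of_vec2 (axis 1 1) = 1" "complex_of_vec2 (axis 2 1) = \<i>"
    by (auto simp: complex_eq_iff axis_def)
  then show ?thesis
    by (simp add: det_2 matrix_def jac_def)
qed

lemma planar_change_of_variables:
  fixes S :: "(real^2) set" and \<phi> :: "complex \<Rightarrow> complex" and f :: "complex \<Rightarrow> real"
  assumes S: "S \<in> sets lebesgue"
    and der: "\<And>x. x \<in> S \<Longrightarrow> (\<phi> has_derivative D (complex_of_vec2 x)) (at (complex_of_vec2 x))"
    and inj: "inj_on \<phi> (complex_of_vec2 ` S)"
    and int: "(\<lambda>x. \<bar>jac (D (complex_of_vec2 x))\<bar> * f (\<phi> (complex_of_vec2 x))) absolutely_integrable_on S"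
  shows "(\<lambda>y. f (complex_of_vec2 y)) absolutely_integrable_on vec2_of_complex ` \<phi> ` complex_of_vec2 ` S"
    and "integral (vec2_of_complex ` \<phi> ` complex_of_vec2 ` S) (\<lambda>y. f (complex_of_vec2 y)) =
         integral S (\<lambda>x. \<bar>jac (D (complex_of_vec2 x))\<bar> * f (\<phi> (complex_of_vec2 x)))"
proof -
  define g where "g = (\<lambda>x. vec2_of_complex (\<phi> (complex_of_vec2 x)))"
  define g' where "g' = (\<lambda>x v. vec2_of_complex (D (complex_of_vec2 x) (complex_of_vec2 v)))"
  have der_g: "(g has_derivative g' x) (at x within S)" if "x \<in> S" for x
  proof -
    have "(complex_of_vec2 has_derivative complex_of_vec2) (at x within S)"
      by (rule bounded_linear_imp_has_derivative[OF bounded_linear_complex_of_vec2])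
    from has_derivative_compose[OF this der[OF that]]
    show ?thesis unfolding g_def g'_def
      by (rule bounded_linear.has_derivative[OF bounded_linear_vec2_of_complex])
  qed
  have inj_g: "inj_on g S"
    using inj unfolding g_def inj_on_def by (metis imageI vec2_complex_inverse)
  have det: "det (matrix (g' x)) = jac (D (complex_of_vec2 x))" for x
    unfolding g'_def by (rule det_matrix_eq_jac)
  \<comment> \<open>The formula integrates vector-valued functions, so the real integrand enters
    with values in \<open>real^1\<close>.\<close>
  define F :: "real^2 \<Rightarrow> real^1" where "F = (\<lambda>y. vec (f (complex_of_vec2 y)))"
  have im: "g ` S = vec2_of_complex ` \<phi> ` complex_of_vec2 ` S"
    by (auto simp: g_def image_image)
  have Fg: "F (g x) = vec (f (\<phi> (complex_of_vec2 x)))" for x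
    by (simp add: F_def g_def)
  have *: "(\<lambda>x. \<bar>det (matrix (g' x))\<bar> *\<^sub>R F (g x)) absolutely_integrable_on S"
    using int by (simp add: absolutely_integrable_on_1_iff Fg det)
  from absolutely_integrable_change_of_variables[OF S der_g inj_g, of F] *
  have 1: "F absolutely_integrable_on g ` S" by simp
  from integral_change_of_variables[OF S der_g inj_g, of F] *
  have 2: "integral (g ` S) F = integral S (\<lambda>x. \<bar>det (matrix (g' x))\<bar> *\<^sub>R F (g x))" by blast
  show "(\<lambda>y. f (complex_of_vec2 y)) absolutely_integrable_on vec2_of_complex ` \<phi> ` complex_of_vec2 ` S"
    using 1 by (simp add: absolutely_integrable_on_1_iff im[symmetric] F_def)
  show "integral (vec2_of_complex ` \<phi> ` complex_of_vec2 ` S) (\<lambda>y. f (complex_of_vec2 y)) =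
         integral S (\<lambda>x. \<bar>jac (D (complex_of_vec2 x))\<bar> * f (\<phi> (complex_of_vec2 x)))"
    using 2 by (simp add: integral_on_1_eq im[symmetric] Fg det vec_eq_iff) (simp add: F_def)
qed

text \<open>Fubini's theorem on the product, transported by the measure-preserving identification of
  \<open>real^2\<close> with pairs of reals.\<close>

lemma integral_vec2_iterated:
  fixes f :: "real^2 \<Rightarrow> real"
  assumes f: "continuous_on (cbox a b) f"
  shows "integral (cbox a b) f =
         integral {a$1..b$1} (\<lambda>s. integral {a$2..b$2} (\<lambda>t. f (vec2_of_complex (Complex s t))))"
proof -
  define g :: "real^2 \<Rightarrow> real \<times> real" where "g = (\<lambda>x. (x$1, x$2))"
  define h :: "real \<times> real \<Rightarrow> real^2" where "h = (\<lambda>p. vec2_of_complex (Complex (fst p) (snd p)))"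
  have hg: "h (g x) = x" for x by (simp add: h_def g_def vec_eq_iff forall_2)
  have gh: "g (h x) = x" for x by (simp add: h_def g_def)
  have gc: "g ` cbox u v = cbox (u$1, u$2) (v$1, v$2)" for u v
  proof -
    have "\<exists>x\<in>cbox u v. g x = (p, q)" if "u$1 \<le> p" "p \<le> v$1" "u$2 \<le> q" "q \<le> v$2" for p q
      using that by (intro bexI[of _ "h (p,q)"] gh) (auto simp: mem_box_cart h_def forall_2)
    then show ?thesis by (force simp: g_def cbox_Pair_eq mem_box_cart forall_2 image_iff)
  qed
  have hc: "h ` cbox u v = cbox (h u) (h v)" for u v
  proof -
    have "h ` cbox (p$1, p$2) (q$1, q$2) = cbox p q" for p q
      unfolding gc[symmetric] by (simp add: image_image hg)
    from this[of "h u" "h v"] show ?thesis by (simp add: h_def)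
  qed
  have contfh: "continuous_on (cbox (a$1, a$2) (b$1, b$2)) (f \<circ> h)"
  proof (rule continuous_on_compose)
    show "continuous_on (cbox (a$1, a$2) (b$1, b$2)) h" unfolding h_def
      by (intro bounded_linear.continuous_on[OF bounded_linear_vec2_of_complex] continuous_intros)
    show "continuous_on (h ` cbox (a$1, a$2) (b$1, b$2)) f"
      unfolding gc[symmetric] image_image hg using f by simp
  qed
  have "((f \<circ> h) has_integral integral (cbox (a$1, a$2) (b$1, b$2)) (f \<circ> h)) (cbox (a$1, a$2) (b$1, b$2))"
    by (intro integrable_integral integrable_continuous contfh)
  then have "((\<lambda>x. (f \<circ> h) (g x)) has_integral (1/1) *\<^sub>R integral (cbox (a$1, a$2) (b$1, b$2)) (f \<circ> h)) (h ` cbox (a$1, a$2) (b$1, b$2))"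
  proof (rule has_integral_twiddle[of 1 h g, rotated -1])
    show "continuous (at x) g" for x
      unfolding g_def by (intro continuous_intros)
    show "\<exists>w z. g ` cbox u v = cbox w z" for u v using gc by blast
    show "\<exists>w z. h ` cbox u v = cbox w z" for u v using hc by blast
    show "measure lborel (g ` cbox u v) = 1 * measure lborel (cbox u v)" for u v
    proof (cases "cbox u v = {}")
      case False
      then have "u$1 \<le> v$1" "u$2 \<le> v$2"
        by (auto simp: interval_ne_empty_cart forall_2)
      then show ?thesis
        unfolding gc by (simp add: content_cbox_cart[OF False] content_Pair UNIV_2 prod.insert)
    next
      case True
      then show ?thesis by simp
    qed
  qed (simp_all add: hg gh)
  then have "integral (cbox a b) f = integral (cbox (a$1, a$2) (b$1, b$2)) (f \<circ> h)"
    by (simp add: hg gc[symmetric] image_image integral_unique)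
  also have "\<dots> = integral {a$1..b$1} (\<lambda>s. integral {a$2..b$2} (\<lambda>t. f (h (s, t))))"
    using integral_prod_continuous[OF contfh] by simp
  finally show ?thesis by (simp add: h_def)
qed

text \<open>The differential is explicit data, continuous in the point. The absolute value of the
  Jacobian admits orientation-reversing maps; injectivity is always stated separately.\<close>

definition quasiconformal_on ::
  "real \<Rightarrow> complex set \<Rightarrow> (complex \<Rightarrow> complex) \<Rightarrow> (complex \<Rightarrow> complex \<Rightarrow> complex) \<Rightarrow> bool" where
  "quasiconformal_on K S F D \<longleftrightarrow>
     (\<forall>z\<in>S. (F has_derivative D z) (at z) \<and> (\<forall>v. (cmod (D z v))\<^sup>2 \<le> K * \<bar>jac (D z)\<bar> * (cmod v)\<^sup>2)) \<and>
     (\<forall>v. continuous_on S (\<lambda>z. D z v))"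

lemma linear_complex_expand:
  assumes "linear (L :: complex \<Rightarrow> complex)"
  shows "L z = Re z *\<^sub>R L 1 + Im z *\<^sub>R L \<i>"
proof -
  have "z = Re z *\<^sub>R 1 + Im z *\<^sub>R \<i>" by (simp add: complex_eq_iff)
  then show ?thesis using linear_add[OF assms] linear_scale[OF assms] by metis
qed

lemma jac_mult_right:
  assumes "linear L"
  shows "jac (\<lambda>v. L (c * v)) = (cmod c)\<^sup>2 * jac L"
proof -
  show ?thesis
    unfolding jac_def cmod_power2
    by (subst (1 2) linear_complex_expand[OF assms]) (simp add: algebra_simps power2_eq_square)
qed

lemma exp_strip_inj:
  assumes "exp z = exp w" "0 < Im z" "Im z < 2*pi" "0 < Im w" "Im w < 2*pi"
  shows "z = w"
proof -
  from assms(1) obtain n :: int where n: "z = w + (of_int (2 * n) * pi) * \<i>"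
    using exp_eq by blast
  then have "Im z = Im w + 2 * n * pi" by simp
  then have "\<bar>2 * real_of_int n * pi\<bar> < 2 * pi" using assms by linarith
  then have "\<bar>real_of_int n\<bar> < 1" by (simp add: abs_mult)
  then have "n = 0" by linarith
  then show ?thesis using n by simp
qed

lemma jac_mult: "jac (\<lambda>v. c * v) = (cmod c)\<^sup>2"
  using jac_mult_right[of "\<lambda>v. v" c] by (simp add: jac_def linear_id[unfolded id_def])

lemma continuous_on_complex_of_vec2 [continuous_intros]:
  "continuous_on S f \<Longrightarrow> continuous_on S (\<lambda>x. complex_of_vec2 (f x))"
  by (rule bounded_linear.continuous_on[OF bounded_linear_complex_of_vec2])

text \<open>In the coordinate log z the density becomes 1 and the annulus a rectangle with sides ln
  R - ln r and 2 pi.\<close>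

lemma annulus_log_area:
  assumes "0 < r" "r < R"
  shows "(\<lambda>y. 1 / (cmod (complex_of_vec2 y))\<^sup>2) absolutely_integrable_on vec2_of_complex ` annulus r R"
    and "integral (vec2_of_complex ` annulus r R) (\<lambda>y. 1 / (cmod (complex_of_vec2 y))\<^sup>2) =
         2 * pi * (ln R - ln r)"
proof -
  define a where "a = vec2_of_complex (Complex (ln r) 0)"
  define b where "b = vec2_of_complex (Complex (ln R) (2*pi))"
  define S where "S = box a b"
  have memS: "x \<in> S \<longleftrightarrow> ln r < x$1 \<and> x$1 < ln R \<and> 0 < x$2 \<and> x$2 < 2*pi" for x
    by (auto simp: S_def a_def b_def mem_box_cart forall_2)
  define T where "T = vec2_of_complex ` exp ` complex_of_vec2 ` S"
  have one: "\<bar>jac ((*) (exp (complex_of_vec2 x)))\<bar> * (1 / (cmod (exp (complex_of_vec2 x)))\<^sup>2) = 1" for x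
    by (simp add: jac_mult)
  have "(\<lambda>x. 1::real) absolutely_integrable_on cbox a b"
    by (intro absolutely_integrable_continuous continuous_intros)
  then have ai: "(\<lambda>x. 1::real) absolutely_integrable_on S"
    unfolding S_def using box_subset_cbox by (auto intro: set_integrable_subset)
  note cov = planar_change_of_variables[where S=S and \<phi>=exp and D="\<lambda>z. (*) (exp z)"
      and f="\<lambda>w. 1 / (cmod w)\<^sup>2", unfolded one, folded T_def]
  have 1: "S \<in> sets lebesgue" by (simp add: S_def)
  have 2: "(exp has_derivative (*) (exp z)) (at z)" for z :: complex
    using DERIV_exp[of z] by (simp add: has_field_derivative_def)
  have 3: "inj_on exp (complex_of_vec2 ` S)"
    by (auto intro!: inj_onI exp_strip_inj simp: memS)
  have T1: "(\<lambda>y. 1 / (cmod (complex_of_vec2 y))\<^sup>2) absolutely_integrable_on T"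
    by (rule cov(1)[OF 1 2 3 ai])
  have "measure lborel (cbox a b) = (ln R - ln r) * (2*pi)"
  proof -
    have "ln r < ln R" using assms by simp
    then have "cbox a b \<noteq> {}" by (auto simp: interval_ne_empty_cart forall_2 a_def b_def)
    then show ?thesis by (simp add: content_cbox_cart UNIV_2 prod.insert) (simp add: a_def b_def)
  qed
  then have T2: "integral T (\<lambda>y. 1 / (cmod (complex_of_vec2 y))\<^sup>2) = 2 * pi * (ln R - ln r)"
    using cov(2)[OF 1 2 3 ai] by (simp add: S_def integral_open_interval)
  have "T \<subseteq> vec2_of_complex ` annulus r R"
  proof -
    have "exp (complex_of_vec2 x) \<in> annulus r R" if "x \<in> S" for x
      using that assms by (auto simp: memS annulus_def) (metis exp_less_cancel_iff exp_ln order_less_trans)+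
    then show ?thesis by (auto simp: T_def)
  qed
  \<comment> \<open>The open rectangle covers all arguments strictly between 0 and 2 pi, so only a
    piece of the real axis is missed.\<close>
  moreover have "vec2_of_complex ` annulus r R - T \<subseteq> {y. y $ 2 = 0}"
  proof clarify
    fix z assume z: "z \<in> annulus r R" "vec2_of_complex z \<notin> T"
    show "vec2_of_complex z $ 2 = 0"
    proof (rule ccontr)
      assume n: "vec2_of_complex z $ 2 \<noteq> 0"
      then have z0: "z \<noteq> 0" by auto
      define x where "x = vec2_of_complex (Complex (ln (cmod z)) (Arg2pi z))"
      have "Arg2pi z \<noteq> 0" using n by (auto simp: Arg2pi_eq_0 complex_is_Real_iff)
      then have "0 < Arg2pi z" using Arg2pi_ge_0[of z] by linarith
      then have "x \<in> S" using z assms z0 Arg2pi_lt_2pi[of z]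
        by (auto simp: memS x_def annulus_def)
      moreover have "exp (complex_of_vec2 x) = z"
      proof -
        have "exp (complex_of_vec2 x) = of_real (cmod z) * exp (\<i> * of_real (Arg2pi z))"
          using z0 by (simp add: x_def Complex_eq exp_add exp_of_real)
        then show ?thesis using Arg2pi_eq[of z] by simp
      qed
      ultimately show False using z(2) by (auto simp: T_def image_iff)
    qed
  qed
  then have neg: "negligible (vec2_of_complex ` annulus r R - T)"
    using negligible_standard_hyperplane_cart negligible_subset by blast
  ultimately have n1: "negligible {x \<in> T - vec2_of_complex ` annulus r R. f x \<noteq> 0}"
    and n2: "negligible {x \<in> vec2_of_complex ` annulus r R - T. f x \<noteq> 0}" for f :: "real^2 \<Rightarrow> real"
    by (auto intro: negligible_subset)
  show "(\<lambda>y. 1 / (cmod (complex_of_vec2 y))\<^sup>2) absolutely_integrable_on vec2_of_complex ` annulus r R"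
    using absolutely_integrable_spike_set_eq[OF n1 n2] T1 by blast
  show "integral (vec2_of_complex ` annulus r R) (\<lambda>y. 1 / (cmod (complex_of_vec2 y))\<^sup>2) = 2 * pi * (ln R - ln r)"
    using T2 integral_spike_set[OF n1 n2] by simp
qed

text \<open>The integrand is the angular derivative of log F along the circle, whose total increase
  is 2 pi \<i> times the winding number. Differentiability along the circle is enough; F need not be
  holomorphic.\<close>

lemma circle_log_derivative_integral:
  assumes der: "\<And>z. cmod z = \<rho> \<Longrightarrow> (F has_derivative D z) (at z)"
    and cont: "\<And>v. continuous_on (sphere 0 \<rho>) (\<lambda>z. D z v)"
    and nz: "\<And>z. cmod z = \<rho> \<Longrightarrow> F z \<noteq> 0" and "0 < \<rho>"
  defines "e \<equiv> \<lambda>\<theta>. exp (Complex (ln \<rho>) \<theta>)"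
  shows "((\<lambda>\<theta>. D (e \<theta>) (\<i> * e \<theta>) / F (e \<theta>)) has_integral
           2 * of_real pi * \<i> * winding_number (F \<circ> circlepath 0 \<rho>) 0) {0..2*pi}"
proof -
  define \<gamma> where "\<gamma> = F \<circ> circlepath 0 \<rho>"
  define \<gamma>' where "\<gamma>' = (\<lambda>t. D (e (2*pi*t)) ((2*pi)*\<i> * e (2*pi*t)))"
  have e: "e (2*pi*t) = circlepath 0 \<rho> t" for t
    using \<open>0 < \<rho>\<close> by (simp add: e_def circlepath Complex_eq exp_add exp_of_real algebra_simps)
  have ne: "cmod (circlepath 0 \<rho> t) = \<rho>" for t
    using \<open>0 < \<rho>\<close> by (simp add: circlepath norm_mult)
  have lin: "linear (D z)" if "cmod z = \<rho>" for z
    using der[OF that] has_derivative_linear by blast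
  have vd: "(\<gamma> has_vector_derivative \<gamma>' t) (at t)" for t
  proof -
    have 1: "(circlepath 0 \<rho> has_vector_derivative (2*pi)*\<i> * e (2*pi*t)) (at t)"
      unfolding e using has_vector_derivative_circlepath[of 0 \<rho> t UNIV] by (simp add: circlepath mult_ac)
    have "(F \<circ> circlepath 0 \<rho> has_derivative (D (circlepath 0 \<rho> t) \<circ> (\<lambda>x. x *\<^sub>R ((2*pi)*\<i> * e (2*pi*t))))) (at t)"
      using 1 unfolding has_vector_derivative_def
      by (intro diff_chain_at der ne) auto
    then show ?thesis
      unfolding has_vector_derivative_def \<gamma>_def \<gamma>'_def o_def e
      by (simp add: linear_scale[OF lin[OF ne]])
  qed
  have cD: "continuous_on {0..1} \<gamma>'"
  proof -
    have *: "D z v = Re v *\<^sub>R D z 1 + Im v *\<^sub>R D z \<i>" if "cmod z = \<rho>" for z v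
      by (rule linear_complex_expand[OF lin[OF that]])
    have c: "continuous_on {0..1} (\<lambda>t. D (circlepath 0 \<rho> t) v)" for v
      using ne by (intro continuous_on_compose2[OF cont]) (auto intro: continuous_on_path)
    show ?thesis unfolding \<gamma>'_def e
      by (subst *[OF ne]) (intro continuous_intros c continuous_on_path path_circlepath order_refl)
  qed
  have "\<gamma> C1_differentiable_on {0..1}"
    unfolding C1_differentiable_on_def using vd cD by blast
  then have vp: "valid_path \<gamma>"
    by (simp add: valid_path_def C1_differentiable_imp_piecewise)
  have nz\<gamma>: "\<gamma> t \<noteq> 0" for t using nz ne by (simp add: \<gamma>_def)
  have "((\<lambda>w. 1/(w - 0)) has_contour_integral (2*pi*\<i>*winding_number \<gamma> 0)) \<gamma>"
    using nz\<gamma> by (intro has_contour_integral_winding_number vp) (metis imageE path_image_def)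
  then have "((\<lambda>t. 1 / \<gamma> t * \<gamma>' t) has_integral 2*pi*\<i>*winding_number \<gamma> 0) {0..1}"
    unfolding has_contour_integral by (simp add: vector_derivative_at[OF vd] has_integral_localized_vector_derivative)
  then have "((\<lambda>t. (2*pi) *\<^sub>R (D (e (2*pi*t)) (\<i> * e (2*pi*t)) / F (e (2*pi*t)))) has_integral 2*pi*\<i>*winding_number \<gamma> 0) {0..1}"
  proof (rule has_integral_eq[rotated])
    fix t :: real
    have "(2*pi)*\<i> * e (2*pi*t) = (2*pi) *\<^sub>R (\<i> * e (2*pi*t))" by (simp add: scaleR_conv_of_real)
    then show "1 / \<gamma> t * \<gamma>' t = (2*pi) *\<^sub>R (D (e (2*pi*t)) (\<i> * e (2*pi*t)) / F (e (2*pi*t)))"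
      unfolding \<gamma>'_def \<gamma>_def e using linear_scale[OF lin[OF ne]] by simp
  qed
  then have I: "((\<lambda>t. D (e (2*pi*t)) (\<i> * e (2*pi*t)) / F (e (2*pi*t))) has_integral \<i>*winding_number \<gamma> 0) {0..1}"
    using has_integral_cmul[of _ "2*pi*\<i>*winding_number \<gamma> 0" "{0..1}" "1/(2*pi)"]
    by (force simp: scaleR_conv_of_real)
  \<comment> \<open>Rescaling from the unit interval of \<open>circlepath\<close> to angles in
    [0, 2 pi].\<close>
  have "((\<lambda>x. D (e (2*pi*((1/(2*pi)) *\<^sub>R x + 0))) (\<i> * e (2*pi*((1/(2*pi)) *\<^sub>R x + 0))) / F (e (2*pi*((1/(2*pi)) *\<^sub>R x + 0)))) has_integral
     (1 / (\<bar>1/(2*pi)\<bar> ^ DIM(real))) *\<^sub>R (\<i>*winding_number \<gamma> 0)) ((\<lambda>x. (1 / (1/(2*pi))) *\<^sub>R x + -((1 / (1/(2*pi))) *\<^sub>R 0)) ` cbox 0 1)"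
    by (rule has_integral_affinity) (use I in auto)
  moreover have "(\<lambda>x. (1 / (1/(2*pi))) *\<^sub>R x + -((1 / (1/(2*pi))) *\<^sub>R 0)) ` cbox 0 1 = {0..2*pi}"
    by (simp add: image_mult_atLeastAtMost)
  ultimately show ?thesis
    by (simp add: \<gamma>_def scaleR_conv_of_real mult_ac)
qed

text \<open>\<open>h\<close> is the angular derivative of \<open>log F\<close>, whose mean over a circle is \<open>\<i> n\<close>. Expanding
  \<open>\<bar>h\<bar>\<^sup>2\<close> around this mean replaces the Cauchy-Schwarz inequality and keeps the error term that
  decides the case of equality.\<close>

lemma groetzsch_inequality:
  assumes r: "0 < r" "r < R" and r': "0 < r'" "r' < R'" and "0 < K"
    and qc: "quasiconformal_on K (annulus r R) F D"
    and inj: "inj_on F (annulus r R)" and im: "F ` annulus r R \<subseteq> annulus r' R'"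
    and wn: "\<And>\<rho>. r < \<rho> \<Longrightarrow> \<rho> < R \<Longrightarrow> winding_number (F \<circ> circlepath 0 \<rho>) 0 = of_real n"
    and ab: "ln r < a" "a \<le> b" "b < ln R"
  defines "h \<equiv> \<lambda>z. D (exp z) (\<i> * exp z) / F (exp z)"
  shows "integral {a..b} (\<lambda>s. integral {0..2*pi} (\<lambda>\<theta>. (cmod (h (Complex s \<theta>) - \<i> * of_real n))\<^sup>2))
           + 2 * pi * n\<^sup>2 * (b - a) \<le> K * (2 * pi * (ln R' - ln r'))"
proof -
  define A where "A = vec2_of_complex (Complex a 0)"
  define B where "B = vec2_of_complex (Complex b (2*pi))"
  have der: "(F has_derivative D z) (at z)" and qcz: "(cmod (D z v))\<^sup>2 \<le> K * \<bar>jac (D z)\<bar> * (cmod v)\<^sup>2"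
    and cont: "continuous_on (annulus r R) (\<lambda>z. D z v)" if "z \<in> annulus r R" for z v
    using that qc by (auto simp: quasiconformal_on_def)
  have lin: "linear (D z)" if "z \<in> annulus r R" for z
    using der[OF that] has_derivative_linear by blast
  have Dexp: "D z v = Re v *\<^sub>R D z 1 + Im v *\<^sub>R D z \<i>" if "z \<in> annulus r R" for z v
    by (rule linear_complex_expand[OF lin[OF that]])
  have nz: "F z \<noteq> 0" if "z \<in> annulus r R" for z
    using that im r' by (force simp: annulus_def)
  have mem_iff: "x \<in> cbox A B \<longleftrightarrow> a \<le> x$1 \<and> x$1 \<le> b \<and> 0 \<le> x$2 \<and> x$2 \<le> 2*pi" for x
    by (auto simp: A_def B_def mem_box_cart forall_2)
  have exp_mem: "exp z \<in> annulus r R" if "a \<le> Re z" "Re z \<le> b" for z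
  proof -
    have "exp (ln r) < exp (Re z)" "exp (Re z) < exp (ln R)" using that ab by simp_all
    then show ?thesis using r by (simp add: annulus_def)
  qed
  have em: "exp (complex_of_vec2 x) \<in> annulus r R" if "x \<in> cbox A B" for x
    using that by (intro exp_mem) (auto simp: mem_iff)
  have contF: "continuous_on (annulus r R) F"
    using der by (meson continuous_at_imp_continuous_on has_derivative_continuous)
  have contE: "continuous_on (cbox A B) (\<lambda>x. exp (complex_of_vec2 x))"
    by (intro continuous_intros)
  have contDE: "continuous_on (cbox A B) (\<lambda>x. D (exp (complex_of_vec2 x)) v)" for v
    by (rule continuous_on_compose2[OF _ contE]) (use em qc in \<open>auto simp: quasiconformal_on_def\<close>)
  have contFE: "continuous_on (cbox A B) (\<lambda>x. F (exp (complex_of_vec2 x)))"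
    by (rule continuous_on_compose2[OF contF contE]) (use em in auto)
  \<comment> \<open>The differential of F o exp. In this coordinate circles are vertical segments
    and the annulus is a rectangle.\<close>
  define D' where "D' = (\<lambda>z v. D (exp z) (exp z * v))"
  \<comment> \<open>The direction \<open>exp z * v\<close> moves with the point, so continuity comes
    from expanding the linear map along 1 and \<i>.\<close>
  have D'v: "continuous_on (cbox A B) (\<lambda>x. D' (complex_of_vec2 x) v)" for v
  proof (rule continuous_on_eq)
    show "continuous_on (cbox A B) (\<lambda>x. Re (exp (complex_of_vec2 x) * v) *\<^sub>R D (exp (complex_of_vec2 x)) 1
        + Im (exp (complex_of_vec2 x) * v) *\<^sub>R D (exp (complex_of_vec2 x)) \<i>)"
      by (intro continuous_intros contDE contE)
    show "\<And>x. x \<in> cbox A B \<Longrightarrow> Re (exp (complex_of_vec2 x) * v) *\<^sub>R D (exp (complex_of_vec2 x)) 1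
        + Im (exp (complex_of_vec2 x) * v) *\<^sub>R D (exp (complex_of_vec2 x)) \<i> = D' (complex_of_vec2 x) v"
      unfolding D'_def by (rule Dexp[OF em, symmetric])
  qed
  have nzE: "F (exp (complex_of_vec2 x)) \<noteq> 0" if "x \<in> cbox A B" for x using nz em that by blast
  define \<Phi> where "\<Phi> = (\<lambda>x. \<bar>jac (D' (complex_of_vec2 x))\<bar> * (1 / (cmod (F (exp (complex_of_vec2 x))))\<^sup>2))"
  have cont\<Phi>: "continuous_on (cbox A B) \<Phi>"
    unfolding \<Phi>_def jac_def by (intro continuous_intros D'v contFE) (use nzE in auto)
  have conth: "continuous_on (cbox A B) (\<lambda>x. h (complex_of_vec2 x))"
  proof -
    have "continuous_on (cbox A B) (\<lambda>x. D' (complex_of_vec2 x) \<i> / F (exp (complex_of_vec2 x)))"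
      by (intro continuous_intros D'v contFE) (use nzE in auto)
    then show ?thesis by (simp add: h_def D'_def mult.commute)
  qed
  \<comment> \<open>Length is bounded by area: \<open>h\<close> is the derivative of log (F o exp)
    in direction \<i>, and \<open>\<Phi>\<close> is the area density of the same map.\<close>
  have h\<Phi>: "(cmod (h (complex_of_vec2 x)))\<^sup>2 \<le> K * \<Phi> x" if x: "x \<in> cbox A B" for x
  proof -
    define e where "e = exp (complex_of_vec2 x)"
    have e: "e \<in> annulus r R" using em x by (simp add: e_def)
    have "jac (D' (complex_of_vec2 x)) = (cmod e)\<^sup>2 * jac (D e)"
      unfolding D'_def e_def[symmetric] by (rule jac_mult_right[OF lin[OF e]])
    moreover have "(cmod (D e (\<i> * e)))\<^sup>2 \<le> K * \<bar>jac (D e)\<bar> * (cmod (\<i> * e))\<^sup>2" by (rule qcz[OF e])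
    ultimately show ?thesis
      unfolding h_def \<Phi>_def e_def[symmetric]
      by (simp add: norm_divide power_divide abs_mult norm_mult divide_right_mono mult_ac)
  qed
  have int\<Phi>: "\<Phi> absolutely_integrable_on cbox A B"
    by (intro absolutely_integrable_continuous cont\<Phi>)
  \<comment> \<open>The closed rectangle contains both angles 0 and 2 pi, where exp is not
    injective; the change of variables therefore runs over the open one, which has the same
    integral.\<close>
  define S where "S = box A B"
  have memS: "x \<in> S \<longleftrightarrow> a < x$1 \<and> x$1 < b \<and> 0 < x$2 \<and> x$2 < 2*pi" for x
    by (auto simp: S_def A_def B_def mem_box_cart forall_2)
  have ScB: "S \<subseteq> cbox A B" by (simp add: S_def box_subset_cbox)
  have int\<Phi>S: "\<Phi> absolutely_integrable_on S"
    by (rule set_integrable_subset[OF int\<Phi> _ ScB]) (simp add: S_def)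
  define T where "T = vec2_of_complex ` (\<lambda>z. F (exp z)) ` complex_of_vec2 ` S"
  note cov = planar_change_of_variables[where S=S and \<phi>="\<lambda>z. F (exp z)" and D=D'
      and f="\<lambda>w. 1 / (cmod w)\<^sup>2", folded \<Phi>_def T_def]
  have c1: "S \<in> sets lebesgue" by (simp add: S_def)
  have c2: "((\<lambda>z. F (exp z)) has_derivative D' (complex_of_vec2 x)) (at (complex_of_vec2 x))" if "x \<in> S" for x
  proof -
    have "(exp has_derivative (*) (exp (complex_of_vec2 x))) (at (complex_of_vec2 x))"
      using DERIV_exp by (simp add: has_field_derivative_def)
    from has_derivative_compose[OF this der] show ?thesis
      using em ScB that by (auto simp: D'_def)
  qed
  have c3: "inj_on (\<lambda>z. F (exp z)) (complex_of_vec2 ` S)"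
  proof (clarsimp simp: inj_on_def)
    fix x y assume xy: "x \<in> S" "y \<in> S" "F (exp (complex_of_vec2 x)) = F (exp (complex_of_vec2 y))"
    then have "exp (complex_of_vec2 x) = exp (complex_of_vec2 y)"
      using inj em ScB by (meson inj_onD subsetD)
    then show "complex_of_vec2 x = complex_of_vec2 y"
      by (rule exp_strip_inj) (use xy memS in auto)
  qed
  have TT: "T \<subseteq> vec2_of_complex ` annulus r' R'"
    using em ScB im by (fastforce simp: T_def)
  have "integral (cbox A B) \<Phi> = integral S \<Phi>" by (simp add: S_def integral_open_interval)
  also have "\<dots> = integral T (\<lambda>y. 1 / (cmod (complex_of_vec2 y))\<^sup>2)"
    using cov(2)[OF c1 c2 c3 int\<Phi>S] by simp
  also have "\<dots> \<le> integral (vec2_of_complex ` annulus r' R') (\<lambda>y. 1 / (cmod (complex_of_vec2 y))\<^sup>2)"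
    using cov(1)[OF c1 c2 c3 int\<Phi>S] annulus_log_area(1)[OF r'] TT
    by (intro integral_subset_le) (auto dest: set_lebesgue_integral_eq_integral(1))
  finally have area: "integral (cbox A B) \<Phi> \<le> 2 * pi * (ln R' - ln r')"
    using annulus_log_area(2)[OF r'] by simp
  define g where "g = (\<lambda>s \<theta>. (cmod (h (Complex s \<theta>) - \<i> * of_real n))\<^sup>2)"
  have conth': "continuous_on {0..2*pi} (\<lambda>\<theta>. h (Complex s \<theta>))" if "a \<le> s" "s \<le> b" for s
  proof -
    have "continuous_on {0..2*pi} (\<lambda>\<theta>. h (complex_of_vec2 (vec2_of_complex (Complex s \<theta>))))"
      by (rule continuous_on_compose2[OF conth])
        (use that in \<open>auto intro!: continuous_intros bounded_linear.continuous_on[OF bounded_linear_vec2_of_complex] simp: mem_iff\<close>)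
    then show ?thesis by simp
  qed
  \<comment> \<open>From |h - \<i> n|^2 = |h|^2 - 2 n Im h + n^2, where the mean of Im h over the
    circle is n.\<close>
  have circ: "integral {0..2*pi} (\<lambda>\<theta>. (cmod (h (Complex s \<theta>)))\<^sup>2) = integral {0..2*pi} (g s) + 2*pi*n\<^sup>2"
    if s: "a \<le> s" "s \<le> b" for s
  proof -
    define \<rho> where "\<rho> = exp s"
    have "exp (ln r) < \<rho>" "\<rho> < exp (ln R)" using s ab by (simp_all add: \<rho>_def)
    then have \<rho>: "r < \<rho>" "\<rho> < R" "ln \<rho> = s" using r by (simp_all add: \<rho>_def)
    have sph: "z \<in> annulus r R" if "cmod z = \<rho>" for z using that \<rho> by (simp add: annulus_def)
    have "((\<lambda>\<theta>. h (Complex s \<theta>)) has_integral 2 * of_real pi * \<i> * of_real n) {0..2*pi}"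
      unfolding h_def \<rho>(3)[symmetric] wn[OF \<rho>(1,2), symmetric]
    proof (rule circle_log_derivative_integral)
      show "continuous_on (sphere 0 \<rho>) (\<lambda>z. D z v)" for v
        using qc sph by (auto simp: quasiconformal_on_def intro: continuous_on_subset)
    qed (use der sph nz \<rho> r in auto)
    then have "((\<lambda>\<theta>. Im (h (Complex s \<theta>))) has_integral 2 * pi * n) {0..2*pi}"
      by (drule_tac has_integral_Im) simp
    then have 1: "((\<lambda>\<theta>. 2 * n * Im (h (Complex s \<theta>))) has_integral 2 * n * (2 * pi * n)) {0..2*pi}"
      by (rule has_integral_mult_right)
    have 2: "((\<lambda>\<theta>. n\<^sup>2) has_integral 2 * pi * n\<^sup>2) {0..2*pi}"
      using has_integral_const_real[of "n\<^sup>2" 0 "2*pi"] by simp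
    have 3: "(g s has_integral integral {0..2*pi} (g s)) {0..2*pi}"
      unfolding g_def
      by (intro integrable_integral integrable_continuous_real continuous_intros conth' s)
    have "((\<lambda>\<theta>. (g s \<theta> + 2 * n * Im (h (Complex s \<theta>))) - n\<^sup>2) has_integral (integral {0..2*pi} (g s) + 2 * n * (2 * pi * n)) - 2 * pi * n\<^sup>2) {0..2*pi}"
      by (intro has_integral_diff has_integral_add 1 2 3)
    moreover have "(g s \<theta> + 2 * n * Im (h (Complex s \<theta>))) - n\<^sup>2 = (cmod (h (Complex s \<theta>)))\<^sup>2" for \<theta>
      unfolding g_def cmod_power2 by (simp add: power2_eq_square algebra_simps)
    ultimately show ?thesis by (simp add: integral_unique power2_eq_square)
  qed
  have "integral (cbox A B) (\<lambda>x. (cmod (h (complex_of_vec2 x)))\<^sup>2)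
      = integral {a..b} (\<lambda>s. integral {0..2*pi} (\<lambda>\<theta>. (cmod (h (Complex s \<theta>)))\<^sup>2))"
    by (subst integral_vec2_iterated) (auto simp: A_def[symmetric] B_def[symmetric] intro!: continuous_intros conth, simp add: A_def B_def)
  also have "\<dots> = integral {a..b} (\<lambda>s. integral {0..2*pi} (g s) + 2*pi*n\<^sup>2)"
    by (intro integral_cong circ) auto
  also have "\<dots> = integral {a..b} (\<lambda>s. integral {0..2*pi} (g s)) + 2*pi*n\<^sup>2 * (b - a)"
  proof -
    have "(\<lambda>s. integral {0..2*pi} (g s)) integrable_on {a..b}"
    proof -
      have "continuous_on (cbox (a,0) (b,2*pi)) (\<lambda>p. (g (fst p) (snd p)))"
      proof -
        have "continuous_on (cbox (a,0) (b,2*pi)) (\<lambda>p. h (complex_of_vec2 (vec2_of_complex (Complex (fst p) (snd p)))))"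
          by (rule continuous_on_compose2[OF conth])
            (auto intro!: continuous_intros bounded_linear.continuous_on[OF bounded_linear_vec2_of_complex] simp: mem_iff cbox_Pair_eq)
        then show ?thesis unfolding g_def by (intro continuous_intros) simp
      qed
      from integral_integrable_2dim[OF this] show ?thesis by simp
    qed
    then show ?thesis
      using ab by (subst integral_add) (auto simp: algebra_simps)
  qed
  finally have e1: "integral (cbox A B) (\<lambda>x. (cmod (h (complex_of_vec2 x)))\<^sup>2) =
    integral {a..b} (\<lambda>s. integral {0..2*pi} (g s)) + 2*pi*n\<^sup>2 * (b - a)" .
  have "integral (cbox A B) (\<lambda>x. (cmod (h (complex_of_vec2 x)))\<^sup>2) \<le> integral (cbox A B) (\<lambda>x. K * \<Phi> x)"
    by (intro integral_le integrable_continuous continuous_intros conth cont\<Phi> h\<Phi>)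
  also have "\<dots> = K * integral (cbox A B) \<Phi>" by simp
  also have "\<dots> \<le> K * (2 * pi * (ln R' - ln r'))" using area \<open>0 < K\<close> by simp
  finally show ?thesis using e1 by (simp add: g_def)
qed

section \<open>Winding numbers on annuli and the equality case\<close>

lemma exp_not_constant: "\<not> (exp :: complex \<Rightarrow> complex) constant_on UNIV"
proof
  assume "(exp :: complex \<Rightarrow> complex) constant_on UNIV"
  then have "exp (0::complex) = exp (of_real 1)" by (metis constant_on_def UNIV_I)
  then show False unfolding exp_of_real by (metis exp_eq_one_iff exp_zero of_real_eq_1_iff zero_neq_one)
qed

lemma open_exp_image:
  assumes "open (W :: complex set)"
  shows "open (exp ` W)"
  by (rule open_mapping_thm[of exp UNIV]) (use assms exp_not_constant in \<open>auto intro: holomorphic_intros\<close>)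

lemma open_annulus: "open (annulus r R)"
proof -
  have "annulus r R = cmod -` {r<..<R}" by (auto simp: annulus_def)
  then show ?thesis by (simp add: open_vimage continuous_on_norm_id)
qed

lemma annulus_eq_exp_strip:
  assumes "0 < r" "r < R"
  shows "annulus r R = exp ` {z. ln r < Re z \<and> Re z < ln R}"
proof -
  have "exp z \<in> annulus r R" if "ln r < Re z" "Re z < ln R" for z
    using that assms by (simp add: annulus_def) (metis exp_less_cancel_iff exp_ln order_less_trans)
  moreover have "\<exists>w. ln r < Re w \<and> Re w < ln R \<and> z = exp w" if "z \<in> annulus r R" for z
  proof -
    have "z \<noteq> 0" using that assms by (auto simp: annulus_def)
    then show ?thesis
      using that assms by (intro exI[of _ "Ln z"]) (auto simp: annulus_def)
  qed
  ultimately show ?thesis by blast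
qed

lemma convex_vertical_strip: "convex {z. a < Re z \<and> Re z < b}"
  using convex_Int[OF convex_halfspace_Re_gt convex_halfspace_Re_lt] by (simp add: Collect_conj_eq)

lemma open_vertical_strip: "open {z. a < Re z \<and> Re z < b}"
  by (auto intro!: open_Collect_conj open_Collect_less continuous_intros)

lemma connected_annulus:
  assumes "0 < r" "r < R"
  shows "connected (annulus r R)"
  unfolding annulus_eq_exp_strip[OF assms]
  by (intro connected_continuous_image continuous_intros convex_connected convex_vertical_strip)

lemma circlepath_mem_annulus:
  "0 < \<rho> \<Longrightarrow> r < \<rho> \<Longrightarrow> \<rho> < R \<Longrightarrow> circlepath 0 \<rho> t \<in> annulus r R"
  by (simp add: annulus_def circlepath norm_mult)

text \<open>The linear homotopy between two concentric circles passes through circles of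
  intermediate radius and so stays in the annulus.\<close>

lemma winding_number_circles_eq:
  assumes "0 < r" and contF: "continuous_on (annulus r R) F" and nz: "\<And>z. z \<in> annulus r R \<Longrightarrow> F z \<noteq> 0"
    and \<rho>: "r < \<rho>" "\<rho> < R" and \<sigma>: "r < \<sigma>" "\<sigma> < R"
  shows "winding_number (F \<circ> circlepath 0 \<rho>) 0 = winding_number (F \<circ> circlepath 0 \<sigma>) 0"
proof -
  have "homotopic_loops (annulus r R) (circlepath 0 \<rho>) (circlepath 0 \<sigma>)"
  proof (rule homotopic_loops_linear)
    fix t :: real
    have "w \<in> annulus r R" if w: "w \<in> closed_segment (circlepath 0 \<rho> t) (circlepath 0 \<sigma> t)" for w
    proof -
      obtain u where u: "0 \<le> u" "u \<le> 1" "w = (1 - u) *\<^sub>R circlepath 0 \<rho> t + u *\<^sub>R circlepath 0 \<sigma> t"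
        using w by (auto simp: in_segment)
      define \<tau> where "\<tau> = (1 - u) * \<rho> + u * \<sigma>"
      have "w = circlepath 0 \<tau> t"
        unfolding u \<tau>_def by (simp add: circlepath scaleR_conv_of_real algebra_simps)
      moreover have "\<tau> \<in> {r<..<R}"
        unfolding \<tau>_def using convexD[of "{r<..<R}" \<rho> \<sigma> "1 - u" u] \<rho> \<sigma> u by simp
      ultimately show ?thesis using \<open>0 < r\<close> by (auto intro!: circlepath_mem_annulus)
    qed
    then show "closed_segment (circlepath 0 \<rho> t) (circlepath 0 \<sigma> t) \<subseteq> annulus r R" by blast
  qed auto
  then have "homotopic_loops (-{0}) (F \<circ> circlepath 0 \<rho>) (F \<circ> circlepath 0 \<sigma>)"
    by (rule homotopic_loops_continuous_image[OF _ contF]) (use nz in auto)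
  then show ?thesis by (rule winding_number_homotopic_loops)
qed

lemma circle_winding_number_int:
  assumes "0 < r" and contF: "continuous_on (annulus r R) F" and nz: "\<And>z. z \<in> annulus r R \<Longrightarrow> F z \<noteq> 0"
    and \<rho>: "r < \<rho>" "\<rho> < R"
  shows "winding_number (F \<circ> circlepath 0 \<rho>) 0 \<in> \<int>"
proof (rule integer_winding_number)
  have m: "circlepath 0 \<rho> t \<in> annulus r R" for t using circlepath_mem_annulus assms by auto
  show "path (F \<circ> circlepath 0 \<rho>)"
    by (intro path_continuous_image continuous_on_subset[OF contF]) (use m in \<open>auto simp: path_image_def\<close>)
  show "pathfinish (F \<circ> circlepath 0 \<rho>) = pathstart (F \<circ> circlepath 0 \<rho>)"
    by (simp add: pathfinish_compose pathstart_compose)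
  show "0 \<notin> path_image (F \<circ> circlepath 0 \<rho>)" using nz m by (auto simp: path_image_def)
qed

text \<open>On the strip above the annulus F o exp has a logarithm G. Its increment under
  translation by 2 pi \<i> is a constant multiple of 2 pi \<i>, namely by the winding number; as
  this is 0, G is periodic and descends.\<close>

lemma continuous_log_on_annulus:
  assumes r: "0 < r" "r < R" and contF: "continuous_on (annulus r R) F" and nz: "\<And>z. z \<in> annulus r R \<Longrightarrow> F z \<noteq> 0"
    and \<rho>: "r < \<rho>" "\<rho> < R" and wn0: "winding_number (F \<circ> circlepath 0 \<rho>) 0 = 0"
  obtains L where "continuous_on (annulus r R) L" "\<And>z. z \<in> annulus r R \<Longrightarrow> F z = exp (L z)"
proof -
  define S where "S = {z. ln r < Re z \<and> Re z < ln R}"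
  note A = annulus_eq_exp_strip[OF r, folded S_def]
  have S: "convex S" "open S" by (simp_all add: S_def convex_vertical_strip open_vertical_strip)
  have contFE: "continuous_on S (\<lambda>z. F (exp z))"
    by (rule continuous_on_compose2[OF contF _ ]) (intro continuous_intros, simp add: A)
  obtain G where G: "continuous_on S G" "\<And>z. z \<in> S \<Longrightarrow> F (exp z) = exp (G z)"
    by (rule continuous_logarithm_on_contractible[OF contFE convex_imp_contractible[OF S(1)]])
      (use nz A in auto)
  define P where "P = (\<lambda>z. G (z + 2 * pi * \<i>) - G z)"
  have trS: "z + 2 * pi * \<i> \<in> S" if "z \<in> S" for z using that by (simp add: S_def)
  have "continuous_on S (\<lambda>z. G (z + 2 * pi * \<i>))"
    by (rule continuous_on_compose2[OF G(1)]) (use trS in \<open>auto intro: continuous_intros\<close>)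
  then have contP: "continuous_on S P"
    unfolding P_def by (intro continuous_on_diff G(1))
  have expP: "exp (P z) = 1" if "z \<in> S" for z
  proof -
    have "exp (z + 2 * pi * \<i>) = exp z" by (simp add: exp_add)
    then have "exp (G (z + 2 * pi * \<i>)) = exp (G z)" using G(2) that trS by metis
    then show ?thesis by (simp add: P_def exp_diff)
  qed
  \<comment> \<open>A continuous function on a connected set with values in the discrete set of
    multiples of 2 pi \<i>.\<close>
  have "P constant_on S"
  proof (rule continuous_discrete_range_constant[OF convex_connected[OF S(1)] contP])
    fix x assume x: "x \<in> S"
    have "2 * pi \<le> cmod (P y - P x)" if y: "y \<in> S" "P y \<noteq> P x" for y
    proof (rule ccontr)
      assume "\<not> ?thesis"
      then have "\<bar>Im (P y) - Im (P x)\<bar> < 2 * pi" using abs_Im_le_cmod[of "P y - P x"] by simp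
      then have "P y = P x" by (rule exp_complex_eqI) (use expP x y in auto)
      then show False using y by simp
    qed
    then show "\<exists>e>0. \<forall>y. y \<in> S \<and> P y \<noteq> P x \<longrightarrow> e \<le> cmod (P y - P x)"
      by (intro exI[of _ "2*pi"]) auto
  qed
  then obtain c where c: "\<And>z. z \<in> S \<Longrightarrow> P z = c" by (auto simp: constant_on_def)
  have lnS: "of_real (ln \<rho>) + 2*pi*\<i>*t \<in> S" for t :: real
    using \<rho> r by (simp add: S_def)
  have "c = 0"
  proof -
    define p where "p = (\<lambda>t::real. G (of_real (ln \<rho>) + 2*pi*\<i>*t))"
    have "path p" unfolding p_def path_def
      by (rule continuous_on_compose2[OF G(1)]) (use lnS in \<open>auto intro!: continuous_intros\<close>)
    have ep: "exp (p t) = F (circlepath 0 \<rho> t)" for t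
    proof -
      have "exp (of_real (ln \<rho>) + 2*pi*\<i>*t) = circlepath 0 \<rho> t"
        using \<rho> r by (simp add: circlepath exp_add exp_of_real)
      with G(2)[OF lnS[of t]] show ?thesis unfolding p_def by (simp only:)
    qed
    then have "exp \<circ> p = F \<circ> circlepath 0 \<rho>" by auto
    with winding_number_compose_exp[OF \<open>path p\<close>] wn0 have "pathfinish p = pathstart p" by simp
    then have "P (of_real (ln \<rho>)) = 0" by (simp add: P_def p_def pathfinish_def pathstart_def)
    then show ?thesis using c lnS[of 0] by simp
  qed
  have per: "G z = G w" if zw: "z \<in> S" "exp z = exp w" for z w
  proof -
    have st: "G (u + 2*pi*\<i>) = G u" if "u \<in> S" for u using c[OF that] \<open>c = 0\<close> by (simp add: P_def)
    have nat: "G (u + of_nat n * (2*pi*\<i>)) = G u" if "u \<in> S" for u n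
    proof (induction n)
      case (Suc n)
      have "u + of_nat n * (2*pi*\<i>) \<in> S" using that by (simp add: S_def)
      from st[OF this] Suc show ?case by (simp add: algebra_simps)
    qed simp
    obtain n :: int where n: "z = w + (of_int (2 * n) * pi) * \<i>" using zw(2) exp_eq by blast
    then have wS: "w \<in> S" using zw by (simp add: S_def)
    show ?thesis
    proof (cases "n \<ge> 0")
      case True
      then have "z = w + of_nat (nat n) * (2*pi*\<i>)" using n by simp
      then show ?thesis using nat[OF wS] by simp
    next
      case False
      then have "w = z + of_nat (nat (-n)) * (2*pi*\<i>)" using n by simp
      then show ?thesis using nat[OF zw(1)] by simp
    qed
  qed
  \<comment> \<open>The jump of \<open>Ln\<close> is invisible because G is periodic. Continuity is
    checked on preimages of open sets, using that exp is open.\<close>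
  define L where "L = (\<lambda>z. G (Ln z))"
  have LE: "L (exp z) = G z" if "z \<in> S" for z
    unfolding L_def by (rule per[symmetric]) (use that in auto)
  show thesis
  proof
    show "F z = exp (L z)" if "z \<in> annulus r R" for z
      using that LE G(2) unfolding A by auto
    show "continuous_on (annulus r R) L"
      unfolding continuous_on_open_vimage[OF open_annulus]
    proof (intro allI impI)
      fix U :: "complex set" assume "open U"
      have "open (G -` U \<inter> S)" using G(1) S(2) \<open>open U\<close> continuous_on_open_vimage by blast
      then have "open (exp ` (G -` U \<inter> S))" by (rule open_exp_image)
      moreover have "exp ` (G -` U \<inter> S) = L -` U \<inter> annulus r R"
        unfolding A using LE by auto
      ultimately show "open (L -` U \<inter> annulus r R)" by simp
    qed
  qed
qed

text \<open>With winding number 0, F would have a logarithm L, and L o G would be a logarithm of the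
  identity on the target annulus; but a circle there winds once around 0.\<close>

lemma homeomorphism_annuli_winding_nonzero:
  assumes r: "0 < r" "r < R" and r': "0 < r'" "r' < R'"
    and hom: "homeomorphism (annulus r R) (annulus r' R') F G"
    and \<rho>: "r < \<rho>" "\<rho> < R"
  shows "winding_number (F \<circ> circlepath 0 \<rho>) 0 \<noteq> 0"
proof
  assume 0: "winding_number (F \<circ> circlepath 0 \<rho>) 0 = 0"
  have nz: "F z \<noteq> 0" if "z \<in> annulus r R" for z
    using hom that r' by (force simp: homeomorphism_def annulus_def)
  obtain L where L: "continuous_on (annulus r R) L" "\<And>z. z \<in> annulus r R \<Longrightarrow> F z = exp (L z)"
    using continuous_log_on_annulus[OF r homeomorphism_cont1[OF hom] nz \<rho> 0] by blast
  obtain \<sigma> where \<sigma>: "r' < \<sigma>" "\<sigma> < R'" using r' dense by blast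
  have m: "circlepath 0 \<sigma> t \<in> annulus r' R'" for t using \<sigma> r' by (intro circlepath_mem_annulus) auto
  define p where "p = L \<circ> G \<circ> circlepath 0 \<sigma>"
  have "path p" unfolding p_def
    by (intro path_continuous_image path_circlepath continuous_on_compose continuous_on_subset[OF L(1)]
        continuous_on_subset[OF homeomorphism_cont2[OF hom]])
      (use m hom in \<open>auto simp: path_image_def homeomorphism_def\<close>)
  moreover have "exp \<circ> p = circlepath 0 \<sigma>"
  proof
    fix t
    have "G (circlepath 0 \<sigma> t) \<in> annulus r R" using m hom by (auto simp: homeomorphism_def)
    from L(2)[OF this] show "(exp \<circ> p) t = circlepath 0 \<sigma> t"
      using hom m by (simp add: p_def homeomorphism_def)
  qed
  moreover have "pathfinish p = pathstart p"
    by (simp add: p_def pathfinish_compose pathstart_compose)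
  ultimately have "winding_number (circlepath 0 \<sigma>) 0 = 0"
    using winding_number_compose_exp[of p] by simp
  then show False using winding_number_circlepath_centre[of \<sigma> 0] \<sigma> r' by simp
qed

text \<open>Length-area estimates are made on compact subannuli, since nothing is known about the
  maps at the boundary; this passes to the full annulus.\<close>

lemma real_le_of_subinterval_bound:
  fixes p q :: real
  assumes "p < q" and "\<And>a b. p < a \<Longrightarrow> a \<le> b \<Longrightarrow> b < q \<Longrightarrow> b - a \<le> C"
  shows "q - p \<le> C"
proof (rule field_le_epsilon)
  fix e :: real assume "0 < e"
  define d where "d = min (e/2) ((q - p)/2)"
  have "d > 0" using assms(1) \<open>0 < e\<close> by (simp add: d_def)
  moreover have "d \<le> e/2" "d \<le> (q-p)/2" unfolding d_def by (rule min.cobounded1, rule min.cobounded2)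
  ultimately have "(q - d) - (p + d) \<le> C" by (intro assms(2)) (auto simp: field_simps)
  then show "q - p \<le> C + e" using \<open>d \<le> e/2\<close> by (simp add: field_simps)
qed

text \<open>A nonintegrable function has integral 0 by convention, so integrability need not be
  checked where only the sign matters.\<close>

lemma integral_nonneg_any:
  fixes f :: "'a::euclidean_space \<Rightarrow> real"
  assumes "\<And>x. x \<in> S \<Longrightarrow> 0 \<le> f x"
  shows "0 \<le> integral S f"
  using assms by (cases "f integrable_on S") (auto intro: integral_nonneg simp: not_integrable_integral)

lemma nonzero_int_square_ge_1:
  fixes n :: real
  assumes "n \<in> \<int>" "n \<noteq> 0"
  shows "1 \<le> n\<^sup>2"
proof -
  have "1 \<le> \<bar>n\<bar>\<^sup>2" using Ints_nonzero_abs_ge1[OF assms] by (rule one_le_power)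
  then show ?thesis by simp
qed

lemma circle_winding_number_real:
  assumes "0 < r" and contF: "continuous_on (annulus r R) F" and nz: "\<And>z. z \<in> annulus r R \<Longrightarrow> F z \<noteq> 0"
    and \<sigma>: "r < \<sigma>" "\<sigma> < R"
  obtains n :: real where "n \<in> \<int>"
    "\<And>\<rho>. r < \<rho> \<Longrightarrow> \<rho> < R \<Longrightarrow> winding_number (F \<circ> circlepath 0 \<rho>) 0 = of_real n"
proof -
  obtain k where "winding_number (F \<circ> circlepath 0 \<sigma>) 0 = of_int k"
    using circle_winding_number_int[OF assms] by (auto elim: Ints_cases)
  then show thesis
    using winding_number_circles_eq[OF assms(1-3) _ _ \<sigma>] by (intro that[of "of_int k"]) auto
qed

lemma quasiconformal_on_imp_continuous_on:
  "quasiconformal_on K S F D \<Longrightarrow> continuous_on S F"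
  by (meson continuous_at_imp_continuous_on has_derivative_continuous quasiconformal_on_def)

text \<open>The error term in the Groetzsch inequality is dropped, and
  \<open>1 \<le> n\<^sup>2\<close> because a homeomorphism of annuli winds.\<close>

lemma quasiconformal_annuli_modulus_le:
  assumes r: "0 < r" "r < R" and r': "0 < r'" "r' < R'" and "0 < K"
    and qc: "quasiconformal_on K (annulus r R) F D"
    and hom: "homeomorphism (annulus r R) (annulus r' R') F G"
  shows "ln R - ln r \<le> K * (ln R' - ln r')"
proof -
  have nz: "F z \<noteq> 0" if "z \<in> annulus r R" for z
    using hom that r' by (force simp: homeomorphism_def annulus_def)
  obtain \<sigma> where \<sigma>: "r < \<sigma>" "\<sigma> < R" using r dense by blast
  obtain n :: real where n: "n \<in> \<int>" "\<And>\<rho>. r < \<rho> \<Longrightarrow> \<rho> < R \<Longrightarrow> winding_number (F \<circ> circlepath 0 \<rho>) 0 = of_real n"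
    using circle_winding_number_real[OF r(1) homeomorphism_cont1[OF hom] nz \<sigma>] by blast
  have "n \<noteq> 0" using homeomorphism_annuli_winding_nonzero[OF r r' hom \<sigma>] n(2)[OF \<sigma>] by auto
  then have n1: "1 \<le> n\<^sup>2" using nonzero_int_square_ge_1 n by blast
  have inj: "inj_on F (annulus r R)" using hom by (metis homeomorphism_def inj_on_inverseI)
  have im: "F ` annulus r R \<subseteq> annulus r' R'" using hom by (simp add: homeomorphism_def)
  show ?thesis
  proof (rule real_le_of_subinterval_bound)
    fix a b assume ab: "ln r < a" "a \<le> b" "b < ln R"
    let ?I = "integral {a..b} (\<lambda>s. integral {0..2*pi} (\<lambda>\<theta>. (cmod ((\<lambda>z. D (exp z) (\<i> * exp z) / F (exp z)) (Complex s \<theta>) - \<i> * of_real n))\<^sup>2))"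
    have "?I + 2 * pi * n\<^sup>2 * (b - a) \<le> K * (2 * pi * (ln R' - ln r'))"
      by (rule groetzsch_inequality[OF r r' \<open>0 < K\<close> qc inj im n(2) ab])
    moreover have "0 \<le> ?I"
      by (intro integral_nonneg_any) auto
    moreover have "2 * pi * 1 * (b - a) \<le> 2 * pi * n\<^sup>2 * (b - a)"
      using n1 ab by (intro mult_right_mono mult_left_mono) auto
    ultimately have "2 * pi * 1 * (b - a) \<le> K * (2 * pi * (ln R' - ln r'))" by linarith
    then have "2 * pi * (b - a) \<le> 2 * pi * (K * (ln R' - ln r'))" by (simp only: mult_1_right mult.left_commute[of K])
    then show "b - a \<le> K * (ln R' - ln r')" by (rule mult_left_le_imp_le) simp
  qed (use r in simp)
qed

lemma holomorphic_imp_quasiconformal: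
  assumes "f holomorphic_on S" "open S"
  shows "quasiconformal_on 1 S f (\<lambda>z v. deriv f z * v)"
  unfolding quasiconformal_on_def
proof (intro conjI ballI allI)
  fix z v assume "z \<in> S"
  then show "(f has_derivative (*) (deriv f z)) (at z)"
    using assms holomorphic_derivI has_field_derivative_imp_has_derivative by blast
  show "(cmod (deriv f z * v))\<^sup>2 \<le> 1 * \<bar>jac ((*) (deriv f z))\<bar> * (cmod v)\<^sup>2"
    by (simp add: jac_mult norm_mult power_mult_distrib)
next
  fix v show "continuous_on S (\<lambda>z. deriv f z * v)"
    using assms by (intro continuous_intros holomorphic_on_imp_continuous_on holomorphic_deriv)
qed

lemma annulus_subset_equal_modulus:
  assumes p: "0 < p" "p < q" and r: "0 < r" "r < R" and sub: "annulus p q \<subseteq> annulus r R"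
    and le: "ln R - ln r \<le> ln q - ln p"
  shows "annulus p q = annulus r R"
proof -
  have "x \<in> {r<..<R}" if "x \<in> {p<..<q}" for x
  proof -
    have "complex_of_real x \<in> annulus p q" using that p by (simp add: annulus_def)
    then have "complex_of_real x \<in> annulus r R" using sub by blast
    then show ?thesis using that p by (simp add: annulus_def)
  qed
  then have "{p<..<q} \<subseteq> {r<..<R}" by blast
  then have 1: "r \<le> p" "q \<le> R" using p by (auto simp: greaterThanLessThan_subseteq_greaterThanLessThan)
  have "ln r \<le> ln p" "ln q \<le> ln R" using 1 p r by simp_all
  then have "ln r = ln p" "ln q = ln R" using le by linarith+
  then show ?thesis using p r by simp
qed

text \<open>There is no room for the error term in the Groetzsch inequality, so it vanishes: z F' =
  n F and F = c z^n. Comparing moduli leaves n = 1 or n = -1, and then the image is an annulus too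
  large to be a proper part of the target.\<close>

lemma holomorphic_annuli_equal_modulus_onto:
  assumes r: "0 < r" "r < R" and r': "0 < r'" "r' < R'"
    and hol: "F holomorphic_on annulus r R" and inj: "inj_on F (annulus r R)"
    and im: "F ` annulus r R \<subseteq> annulus r' R'"
    and \<sigma>: "r < \<sigma>" "\<sigma> < R" and wn: "winding_number (F \<circ> circlepath 0 \<sigma>) 0 \<noteq> 0"
    and le: "ln R' - ln r' \<le> ln R - ln r"
  shows "F ` annulus r R = annulus r' R'"
proof -
  define A where "A = annulus r R"
  have oA: "open A" and cA: "connected A" by (simp_all add: A_def open_annulus connected_annulus r)
  have nz: "F z \<noteq> 0" if "z \<in> annulus r R" for z
    using im that r' by (force simp: annulus_def)
  have contF: "continuous_on (annulus r R) F" using hol by (rule holomorphic_on_imp_continuous_on)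
  obtain n :: real where n: "n \<in> \<int>" "\<And>\<rho>. r < \<rho> \<Longrightarrow> \<rho> < R \<Longrightarrow> winding_number (F \<circ> circlepath 0 \<rho>) 0 = of_real n"
    using circle_winding_number_real[OF r(1) contF nz \<sigma>] by blast
  have "n \<noteq> 0" using wn n(2)[OF \<sigma>] by auto
  then have n1: "1 \<le> n\<^sup>2" using nonzero_int_square_ge_1 n by blast
  define h where "h = (\<lambda>z. deriv F (exp z) * (\<i> * exp z) / F (exp z))"
  define g where "g = (\<lambda>s \<theta>. (cmod (h (Complex s \<theta>) - \<i> * of_real n))\<^sup>2)"
  define J where "J = (\<lambda>s. integral {0..2*pi} (g s))"
  have ineq: "integral {a..b} J + 2 * pi * n\<^sup>2 * (b - a) \<le> 2 * pi * (ln R' - ln r')"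
    if ab: "ln r < a" "a \<le> b" "b < ln R" for a b
    using groetzsch_inequality[OF r r' zero_less_one holomorphic_imp_quasiconformal[OF hol open_annulus] inj im n(2) ab]
    by (simp add: J_def g_def h_def)
  have conth: "continuous_on {z. ln r < Re z \<and> Re z < ln R} h"
    unfolding h_def
    by (intro continuous_intros continuous_on_compose2[OF contF]
        continuous_on_compose2[OF holomorphic_on_imp_continuous_on[OF holomorphic_deriv[OF hol open_annulus]]])
      (use nz in \<open>auto simp: annulus_eq_exp_strip[OF r]\<close>)
  have contg: "continuous_on ({ln r<..<ln R} \<times> UNIV) (\<lambda>(s, \<theta>). g s \<theta>)"
  proof -
    have "continuous_on ({ln r<..<ln R} \<times> UNIV) (\<lambda>p. h (Complex (fst p) (snd p)))"
      by (rule continuous_on_compose2[OF conth]) (auto intro!: continuous_intros)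
    then show ?thesis unfolding g_def case_prod_unfold by (intro continuous_intros)
  qed
  have contJ: "continuous_on {ln r<..<ln R} J"
    unfolding J_def using integral_continuous_on_param[of "{ln r<..<ln R}" 0 "2*pi" g] contg
    by (force intro: continuous_on_subset)
  have J0: "0 \<le> J s" for s unfolding J_def g_def by (intro integral_nonneg_any) auto
  have intJ: "J integrable_on {a..b}" if "ln r < a" "b < ln R" for a b
    by (intro integrable_continuous_real continuous_on_subset[OF contJ]) (use that in auto)
  \<comment> \<open>As the interval grows to the full one, the main term
    \<open>2 * pi * n\<^sup>2 * (b - a)\<close> exhausts the right side, because
    \<open>1 \<le> n\<^sup>2\<close> and the target has no larger modulus. Nothing is left for the
    error over a fixed subinterval.\<close>
  have Jzero: "integral {a0..b0} J = 0" if ab0: "ln r < a0" "a0 \<le> b0" "b0 < ln R" for a0 b0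
  proof -
    define I where "I = integral {a0..b0} J"
    have n2: "0 < 2 * pi * n\<^sup>2" using \<open>n \<noteq> 0\<close> by simp
    have bound: "b - a \<le> (2 * pi * (ln R' - ln r') - I) / (2 * pi * n\<^sup>2)"
      if ab: "ln r < a" "a \<le> a0" "b0 \<le> b" "b < ln R" for a b
    proof -
      have "I \<le> integral {a..b} J" unfolding I_def
        by (intro integral_subset_le intJ) (use ab ab0 J0 in auto)
      moreover have "integral {a..b} J + 2 * pi * n\<^sup>2 * (b - a) \<le> 2 * pi * (ln R' - ln r')"
        by (rule ineq) (use ab ab0 in auto)
      ultimately have "2 * pi * n\<^sup>2 * (b - a) \<le> 2 * pi * (ln R' - ln r') - I" by linarith
      then show ?thesis using n2 by (simp only: pos_le_divide_eq mult.commute)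
    qed
    have "ln R - ln r \<le> (2 * pi * (ln R' - ln r') - I) / (2 * pi * n\<^sup>2)"
    proof (rule real_le_of_subinterval_bound)
      fix a b assume ab: "ln r < a" "a \<le> b" "b < ln R"
      have "b - a \<le> max b b0 - min a a0" by linarith
      also have "\<dots> \<le> (2 * pi * (ln R' - ln r') - I) / (2 * pi * n\<^sup>2)"
        by (rule bound) (use ab ab0 in auto)
      finally show "b - a \<le> (2 * pi * (ln R' - ln r') - I) / (2 * pi * n\<^sup>2)" .
    qed (use r in simp)
    then have "(2 * pi * n\<^sup>2) * (ln R - ln r) \<le> 2 * pi * (ln R' - ln r') - I"
      using n2 by (simp only: pos_le_divide_eq mult.commute)
    moreover have "(2 * pi * n\<^sup>2) * (ln R' - ln r') \<le> (2 * pi * n\<^sup>2) * (ln R - ln r)"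
      by (rule mult_left_mono[OF le]) simp
    moreover have "(2 * pi * 1) * (ln R' - ln r') \<le> (2 * pi * n\<^sup>2) * (ln R' - ln r')"
      using n1 r' by (intro mult_right_mono mult_left_mono) auto
    ultimately have "(2 * pi * 1) * (ln R' - ln r') \<le> 2 * pi * (ln R' - ln r') - I"
      by (meson order_trans)
    then have "I \<le> 0" by simp
    moreover have "0 \<le> I" unfolding I_def by (intro integral_nonneg_any J0)
    ultimately show ?thesis by (simp add: I_def)
  qed
  have h_eq: "h z = \<i> * of_real n" if z: "ln r < Re z" "Re z < ln R" "0 \<le> Im z" "Im z \<le> 2*pi" for z
  proof -
    obtain a where a: "ln r < a" "a < Re z" using z dense by blast
    have "integral {a..Re z} J = 0" by (rule Jzero) (use a z in auto)
    moreover have "continuous_on {a..Re z} J" by (rule continuous_on_subset[OF contJ]) (use a z in auto)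
    ultimately have "J (Re z) = 0" using integral_eq_0_iff[of a "Re z" J] a J0 by auto
    moreover have "continuous_on {0..2*pi} (g (Re z))"
    proof -
      have "continuous_on {0..2*pi} (\<lambda>\<theta>. (\<lambda>(s, \<theta>). g s \<theta>) (Re z, \<theta>))"
        by (rule continuous_on_compose2[OF contg]) (use z in \<open>auto intro!: continuous_intros\<close>)
      then show ?thesis by simp
    qed
    ultimately have "\<forall>\<theta>\<in>{0..2*pi}. g (Re z) \<theta> = 0"
      using integral_eq_0_iff[of 0 "2*pi" "g (Re z)"] by (auto simp: J_def g_def)
    then have "g (Re z) (Im z) = 0" using z by auto
    then show ?thesis by (simp add: g_def)
  qed
  \<comment> \<open>The constancy of \<open>h\<close> over a full turn of angles says that the
    logarithmic derivative of F is n / z.\<close>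
  have ode: "deriv F z * z = of_real n * F z" if "z \<in> A" for z
  proof -
    have z: "r < cmod z" "cmod z < R" "z \<noteq> 0" using that r by (auto simp: A_def annulus_def)
    define w where "w = Complex (ln (cmod z)) (Arg2pi z)"
    have "exp w = of_real (cmod z) * exp (\<i> * of_real (Arg2pi z))"
      using z by (simp add: w_def Complex_eq exp_add exp_of_real)
    then have ew: "exp w = z" using Arg2pi_eq[of z] by simp
    have "h w = \<i> * of_real n"
      using z r Arg2pi_ge_0[of z] Arg2pi_lt_2pi[of z] by (intro h_eq) (auto simp: w_def)
    then show ?thesis using nz[of z] that by (simp add: h_def ew field_simps A_def)
  qed
  obtain k where k: "n = of_int k" using n by (auto elim: Ints_cases)
  define Q where "Q = (\<lambda>z. F z * z powi (-k))"
  have Q': "(Q has_field_derivative 0) (at z)" if z: "z \<in> A" for z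
  proof -
    have z0: "z \<noteq> 0" using z r by (auto simp: A_def annulus_def)
    have "(Q has_field_derivative deriv F z * z powi (-k) + (of_int (-k) * z powi (-k - 1) * 1) * F z) (at z)"
      unfolding Q_def using z z0 hol oA
      by (intro DERIV_mult DERIV_power_int DERIV_ident) (auto simp: A_def intro: holomorphic_derivI)
    moreover have "z powi (-k) = z powi (-k - 1) * z"
      using z0 power_int_add_1[of z "-k-1"] by simp
    then have "deriv F z * z powi (-k) + (of_int (-k) * z powi (-k - 1) * 1) * F z = z powi (-k-1) * (deriv F z * z - of_int k * F z)"
      by (simp add: algebra_simps)
    then have "deriv F z * z powi (-k) + (of_int (-k) * z powi (-k - 1) * 1) * F z = 0"
      using ode[OF z] k by simp
    ultimately show ?thesis by simp
  qed
  obtain c where c: "\<And>z. z \<in> A \<Longrightarrow> Q z = c"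
    using DERIV_zero_connected_constant[OF cA oA finite.emptyI, of Q] Q'
    by (metis DERIV_continuous continuous_at_imp_continuous_on Diff_empty)
  have Fk: "F z = c * z powi k" if "z \<in> A" for z
  proof -
    have "z \<noteq> 0" using that r by (auto simp: A_def annulus_def)
    then show ?thesis using c[OF that] by (simp add: Q_def power_int_minus field_simps)
  qed
  \<comment> \<open>The inequality is used once more, now without error term, to bound the degree
    from above.\<close>
  have "n\<^sup>2 * (ln R - ln r) \<le> ln R' - ln r'"
  proof -
    have n2: "0 < 2 * pi * n\<^sup>2" using \<open>n \<noteq> 0\<close> by simp
    have "ln R - ln r \<le> (2 * pi * (ln R' - ln r')) / (2 * pi * n\<^sup>2)"
    proof (rule real_le_of_subinterval_bound)
      fix a b assume ab: "ln r < a" "a \<le> b" "b < ln R"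
      have "2 * pi * n\<^sup>2 * (b - a) \<le> 2 * pi * (ln R' - ln r')"
        using ineq[OF ab] Jzero[OF ab] by simp
      then show "b - a \<le> (2 * pi * (ln R' - ln r')) / (2 * pi * n\<^sup>2)"
        using n2 by (simp only: pos_le_divide_eq mult.commute)
    qed (use r in simp)
    then have "(2 * pi) * (n\<^sup>2 * (ln R - ln r)) \<le> (2 * pi) * (ln R' - ln r')"
      using n2 by (simp only: pos_le_divide_eq mult_ac)
    then show ?thesis by (rule mult_left_le_imp_le) simp
  qed
  then have "n\<^sup>2 * (ln R - ln r) \<le> 1 * (ln R - ln r)" using le by simp
  then have "n\<^sup>2 \<le> 1" using r mult_le_cancel_right_pos[of "ln R - ln r"] by simp
  then have "k = 1 \<or> k = -1" using n1 unfolding k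
    by (smt (verit) abs_square_le_1 of_int_le_1_iff of_int_abs power2_eq_1_iff of_int_1 of_int_eq_iff of_int_minus)
  then consider "\<And>z. z \<in> A \<Longrightarrow> F z = c * z" | "\<And>z. z \<in> A \<Longrightarrow> F z = c / z"
    using Fk by (force simp: power_int_minus divide_inverse)
  \<comment> \<open>In either case the image is an annulus with the modulus of the source. It lies
    in the target, whose modulus is no larger, and so fills it.\<close>
  then show ?thesis
  proof cases
    case 1
    obtain z0 where z0: "z0 \<in> A" using circlepath_mem_annulus[of \<sigma> r R 0] r \<sigma> by (auto simp: A_def)
    then have "c \<noteq> 0" using 1[OF z0] nz[of z0] by (auto simp: A_def)
    have im1: "annulus (cmod c * r) (cmod c * R) \<subseteq> F ` A"
    proof
      fix w assume w: "w \<in> annulus (cmod c * r) (cmod c * R)"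
      then have "w / c \<in> A" using \<open>c \<noteq> 0\<close> by (simp add: A_def annulus_def norm_divide field_simps)
      moreover have "F (w / c) = w" using 1[OF \<open>w / c \<in> A\<close>] \<open>c \<noteq> 0\<close> by simp
      ultimately show "w \<in> F ` A" by (metis imageI)
    qed
    show ?thesis
      using annulus_subset_equal_modulus[of "cmod c * r" "cmod c * R" r' R'] im1 im \<open>c \<noteq> 0\<close> r r' le
      by (auto simp: A_def ln_mult)
  next
    case 2
    obtain z0 where z0: "z0 \<in> A" using circlepath_mem_annulus[of \<sigma> r R 0] r \<sigma> by (auto simp: A_def)
    then have "c \<noteq> 0" using 2[OF z0] nz[of z0] by (auto simp: A_def)
    have im1: "annulus (cmod c / R) (cmod c / r) \<subseteq> F ` A"
    proof
      fix w assume w: "w \<in> annulus (cmod c / R) (cmod c / r)"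
      then have "w \<noteq> 0" using \<open>c \<noteq> 0\<close> r by (auto simp: annulus_def field_simps)
      then have "c / w \<in> A" using w \<open>c \<noteq> 0\<close> r by (simp add: A_def annulus_def norm_divide field_simps)
      moreover have "F (c / w) = w" using 2[OF \<open>c / w \<in> A\<close>] \<open>c \<noteq> 0\<close> \<open>w \<noteq> 0\<close> by simp
      ultimately show "w \<in> F ` A" by (metis imageI)
    qed
    show ?thesis
      using annulus_subset_equal_modulus[of "cmod c / R" "cmod c / r" r' R'] im1 im \<open>c \<noteq> 0\<close> r r' le
      by (auto simp: A_def ln_div frac_less2)
  qed
qed

section \<open>Complements in the Riemann sphere\<close>

text \<open>The extension fixes infinity, whose neighbourhoods are the complements of compact sets;
  a homeomorphism of the plane preserves these.\<close>

lemma openin_sphere_map_option: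
  assumes hom: "homeomorphism UNIV UNIV \<Phi> \<Psi>" and V: "openin riemann_sphere V"
  shows "openin riemann_sphere (map_option \<Phi> ` V)"
proof -
  have cont: "continuous_on S \<Phi>" for S
    using homeomorphism_cont1[OF hom] continuous_on_subset by blast
  have bij: "bij \<Phi>" using hom by (metis bij_betw_imageI homeomorphism_def inj_on_inverseI)
  have op: "open (\<Phi> ` U)" if "open U" for U
    using invariance_of_domain[OF cont that] bij by (meson bij_is_inj inj_on_subset subset_UNIV)
  from V consider U where "open U" "V = Some ` U" | C where "compact C" "V = insert None (Some ` (- C))"
    by (auto simp: riemann_sphere_def openin_Alexandroff_compactification Compl_eq_Diff_UNIV)
  then show ?thesis
  proof cases
    case 1
    then have "map_option \<Phi> ` V = Some ` (\<Phi> ` U)" by (simp add: image_image)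
    then show ?thesis using op[OF 1(1)] by (simp add: riemann_sphere_def)
  next
    case 2
    have "map_option \<Phi> ` V = insert None (Some ` (- (\<Phi> ` C)))"
      using 2 bij by (simp add: image_image bij_image_Compl_eq[symmetric])
    moreover have "compact (\<Phi> ` C)" by (rule compact_continuous_image[OF cont 2(1)])
    ultimately show ?thesis
      by (auto simp: riemann_sphere_def openin_Alexandroff_compactification Compl_eq_Diff_UNIV compact_imp_closed
          intro!: exI[of _ "\<Phi> ` C"])
  qed
qed

lemma topspace_riemann_sphere: "topspace riemann_sphere = UNIV"
  by (auto simp: riemann_sphere_def) (metis option.exhaust rangeI)

lemma homeomorphic_map_sphere_map_option:
  assumes hom: "homeomorphism UNIV UNIV \<Phi> \<Psi>"
  shows "homeomorphic_map riemann_sphere riemann_sphere (map_option \<Phi>)"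
proof (rule bijective_open_imp_homeomorphic_map)
  have hom': "homeomorphism UNIV UNIV \<Psi> \<Phi>" using hom homeomorphism_sym by blast
  have inv: "\<Psi> (\<Phi> x) = x" "\<Phi> (\<Psi> x) = x" for x using hom by (auto simp: homeomorphism_def)
  have 1: "map_option \<Psi> (map_option \<Phi> x) = x" "map_option \<Phi> (map_option \<Psi> x) = x" for x
    by (simp_all add: option.map_comp o_def inv option.map_ident)
  show "inj_on (map_option \<Phi>) (topspace riemann_sphere)" by (metis 1(1) inj_on_inverseI)
  show "map_option \<Phi> ` topspace riemann_sphere = topspace riemann_sphere"
    unfolding topspace_riemann_sphere by (metis 1(2) surjI)
  show "open_map riemann_sphere riemann_sphere (map_option \<Phi>)"
    using openin_sphere_map_option[OF hom] by (simp add: open_map_def)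
  show "continuous_map riemann_sphere riemann_sphere (map_option \<Phi>)"
  proof (unfold continuous_map topspace_riemann_sphere, intro conjI allI impI)
    fix U assume "openin riemann_sphere U"
    then have "openin riemann_sphere (map_option \<Psi> ` U)" by (rule openin_sphere_map_option[OF hom'])
    moreover have "map_option \<Psi> ` U = {x \<in> UNIV. map_option \<Phi> x \<in> U}"
      using 1 by (auto simp: image_iff) (metis 1)
    ultimately show "openin riemann_sphere {x \<in> UNIV. map_option \<Phi> x \<in> U}" by simp
  qed simp
qed

lemma sphere_complement_components_image:
  assumes hom: "homeomorphism UNIV UNIV \<Phi> \<Psi>"
  shows "sphere_complement_components (\<Phi> ` S) = image (map_option \<Phi>) ` sphere_complement_components S"
proof -
  have bij: "bij \<Phi>" using hom by (metis bij_betw_imageI homeomorphism_def inj_on_inverseI)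
  have "map_option \<Phi> ` (UNIV - Some ` S) = UNIV - Some ` \<Phi> ` S"
  proof -
    have "bij (map_option \<Phi>)"
      using homeomorphic_map_sphere_map_option[OF hom]
      by (metis bij_def homeomorphic_map_def homeomorphic_imp_surjective_map topspace_riemann_sphere)
    then show ?thesis
      by (metis (no_types, lifting) Compl_eq_Diff_UNIV bij_image_Compl_eq image_image image_cong option.map(2))
  qed
  then have "homeomorphic_map (subtopology riemann_sphere (topspace riemann_sphere - Some ` S))
       (subtopology riemann_sphere (topspace riemann_sphere - Some ` \<Phi> ` S)) (map_option \<Phi>)"
    by (intro homeomorphic_map_subtopologies homeomorphic_map_sphere_map_option[OF hom])
      (simp add: topspace_riemann_sphere)
  from homeomorphic_map_connected_components_of[OF this] show ?thesis
    by (simp add: sphere_complement_components_def)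
qed

lemma doubly_connected_image:
  assumes hom: "homeomorphism UNIV UNIV \<Phi> \<Psi>" and S: "doubly_connected S"
  shows "doubly_connected (\<Phi> ` S)"
proof -
  have cont: "continuous_on S \<Phi>"
    using homeomorphism_cont1[OF hom] continuous_on_subset by blast
  have inj: "inj \<Phi>" using hom by (metis homeomorphism_def inj_on_inverseI)
  have "plane_domain (\<Phi> ` S)"
    using S invariance_of_domain[OF cont] inj_on_subset[OF inj] connected_continuous_image[OF cont]
    by (auto simp: doubly_connected_def plane_domain_def)
  moreover have "inj (image (map_option \<Phi>))"
    using option.inj_map[OF inj] by (auto intro!: injI simp: inj_image_eq_iff)
  then have "card (sphere_complement_components (\<Phi> ` S)) = 2"
    unfolding sphere_complement_components_image[OF hom]
    using S by (metis card_image doubly_connected_def inj_on_subset subset_UNIV)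
  ultimately show ?thesis by (simp add: doubly_connected_def)
qed

lemma nondegenerate_image:
  assumes hom: "homeomorphism UNIV UNIV \<Phi> \<Psi>" and S: "nondegenerate S"
  shows "nondegenerate (\<Phi> ` S)"
proof -
  have inj: "inj (map_option \<Phi>)" using hom by (metis homeomorphism_def inj_on_inverseI option.inj_map)
  have "\<exists>x\<in>map_option \<Phi> ` C. \<exists>y\<in>map_option \<Phi> ` C. x \<noteq> y" if C: "C \<in> sphere_complement_components S" for C
  proof -
    obtain x y where "x \<in> C" "y \<in> C" "x \<noteq> y" using S C unfolding nondegenerate_def by blast
    then show ?thesis using inj by (metis imageI injD)
  qed
  then show ?thesis
    using S doubly_connected_image[OF hom] unfolding nondegenerate_def sphere_complement_components_image[OF hom]
    by blast
qed

lemma connectedin_sphere_Some: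
  assumes "connectedin riemann_sphere (Some ` K)"
  shows "connected K"
  unfolding connected_def
proof clarify
  fix A B assume AB: "open A" "open B" "K \<subseteq> A \<union> B" "A \<inter> B \<inter> K = {}" "A \<inter> K \<noteq> {}" "B \<inter> K \<noteq> {}"
  have "openin riemann_sphere (Some ` A)" "openin riemann_sphere (Some ` B)"
    using AB by (simp_all add: riemann_sphere_def)
  moreover have "Some ` K \<subseteq> Some ` A \<union> Some ` B" "Some ` A \<inter> Some ` B \<inter> Some ` K = {}"
     "Some ` A \<inter> Some ` K \<noteq> {}" "Some ` B \<inter> Some ` K \<noteq> {}" using AB by blast+
  ultimately show False using assms unfolding connectedin by blast
qed

text \<open>\<open>K\<close> is the complementary component that misses infinity. Once it is filled
  in, the remaining complement is a single component of the sphere containing infinity, so the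
  filled domain is simply connected.\<close>

lemma nondegenerate_imp_filled:
  assumes "nondegenerate \<Omega>"
  obtains K where "compact K" "connected K" "K \<inter> \<Omega> = {}" "\<exists>x\<in>K. \<exists>y\<in>K. x \<noteq> y"
    "open (\<Omega> \<union> K)" "simply_connected (\<Omega> \<union> K)" "\<Omega> \<union> K \<noteq> UNIV"
proof -
  define X where "X = subtopology riemann_sphere (- Some ` \<Omega>)"
  have comps: "sphere_complement_components \<Omega> = connected_components_of X"
    by (simp add: sphere_complement_components_def X_def topspace_riemann_sphere Compl_eq_Diff_UNIV)
  have tX: "topspace X = - Some ` \<Omega>" by (simp add: X_def topspace_riemann_sphere)
  have \<Omega>: "open \<Omega>" "connected \<Omega>" "\<Omega> \<noteq> {}" and card: "card (connected_components_of X) = 2"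
    and two: "\<And>C. C \<in> connected_components_of X \<Longrightarrow> \<exists>x\<in>C. \<exists>y\<in>C. x \<noteq> y"
    using assms by (auto simp: nondegenerate_def doubly_connected_def plane_domain_def comps)
  have Un: "\<Union> (connected_components_of X) = - Some ` \<Omega>"
    using Union_connected_components_of[of X] tX by simp
  then have "None \<in> \<Union> (connected_components_of X)" by auto
  then obtain C2 where C2: "C2 \<in> connected_components_of X" "None \<in> C2" by (elim UnionE)
  obtain C1 where C1: "C1 \<noteq> C2" "connected_components_of X = {C1, C2}"
  proof -
    obtain A B where "connected_components_of X = {A, B}" "A \<noteq> B" using card by (auto simp: card_2_iff)
    then show ?thesis using that[of A] that[of B] C2(1) by auto
  qed
  have disj: "C1 \<inter> C2 = {}"
    using pairwise_disjoint_connected_components_of[of X] C1 by (simp add: pairwise_def disjnt_def)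
  define K where "K = {z. Some z \<in> C1}"
  have C1K: "C1 = Some ` K"
  proof -
    have "None \<notin> C1" using disj C2 by blast
    then show ?thesis by (auto simp: K_def image_iff) (metis not_None_eq)
  qed
  have C2K: "C2 = UNIV - Some ` (\<Omega> \<union> K)"
    using Un C1 disj by (auto simp: C1K)
  have K\<Omega>: "K \<inter> \<Omega> = {}" using Un C1 C1K by blast
  have "closedin riemann_sphere (- Some ` \<Omega>)"
  proof -
    have "openin riemann_sphere (Some ` \<Omega>)" using \<Omega> by (simp add: riemann_sphere_def)
    then show ?thesis by (metis Compl_eq_Diff_UNIV closedin_diff closedin_topspace topspace_riemann_sphere)
  qed
  then have clo: "closedin riemann_sphere C" if "C \<in> connected_components_of X" for C
    using closedin_connected_components_of[OF that] closedin_trans_full unfolding X_def by blast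
  have conn: "connectedin riemann_sphere C" if "C \<in> connected_components_of X" for C
    using connectedin_connected_components_of[OF that] unfolding X_def connectedin_subtopology by blast
  have compK: "compact K"
    using clo[of C1] C1 by (auto simp: C1K riemann_sphere_def)
  have connK: "connected K" using conn[of C1] C1 connectedin_sphere_Some by (simp add: C1K)
  have opU: "open (\<Omega> \<union> K)"
  proof -
    have "openin riemann_sphere (UNIV - C2)"
      using clo[OF C2(1)] by (metis openin_diff openin_topspace topspace_riemann_sphere)
    moreover have "UNIV - C2 = Some ` (\<Omega> \<union> K)" by (auto simp: C2K)
    ultimately show ?thesis by (metis riemann_sphere_def openin_Alexandroff_compactification_image_Some open_openin)
  qed
  have twoK: "\<exists>x\<in>K. \<exists>y\<in>K. x \<noteq> y" using two[of C1] C1 by (auto simp: C1K)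
  have ne: "\<Omega> \<union> K \<noteq> UNIV"
  proof
    assume "\<Omega> \<union> K = UNIV"
    then have "C2 = {None}" using C2K C2(2) by (auto simp: image_iff)
    then show False using two[OF C2(1)] by auto
  qed
  have connU: "connected (\<Omega> \<union> K)"
  proof -
    \<comment> \<open>Otherwise K would be open as well as compact, impossible in the plane.\<close>
    have "closure \<Omega> \<inter> K \<noteq> {}"
    proof
      assume "closure \<Omega> \<inter> K = {}"
      then have "K = (\<Omega> \<union> K) - closure \<Omega>" using closure_subset[of \<Omega>] by blast
      then have "open K" using opU by (metis open_Diff closed_closure)
      then have "K = {} \<or> K = UNIV" using compK clopen compact_imp_closed by blast
      then show False using twoK ne by auto
    qed
    then obtain x where x: "x \<in> closure \<Omega>" "x \<in> K" by blast
    have "connected (insert x \<Omega>)"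
      using \<Omega>(2) by (rule connected_intermediate_closure) (use x closure_subset in auto)
    then have "connected (insert x \<Omega> \<union> K)" by (rule connected_Un) (use connK x in auto)
    moreover have "insert x \<Omega> \<union> K = \<Omega> \<union> K" using x by auto
    ultimately show ?thesis by simp
  qed
  \<comment> \<open>A compact component of a closed set has compact relatively clopen neighbourhoods
    (Sura-Bura). Such an M would split \<open>C2\<close> into M and a part containing
    infinity.\<close>
  have unb: "\<not> bounded C" if C: "C \<in> components (- (\<Omega> \<union> K))" for C
  proof
    assume "bounded C"
    have cl: "closed (- (\<Omega> \<union> K))" using opU by blast
    then have "compact C" using C \<open>bounded C\<close> closed_components compact_eq_bounded_closed by blast
    from Sura_Bura_clopen_subset[OF closed_imp_locally_compact[OF cl] C this open_UNIV subset_UNIV]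
    obtain M where M: "openin (top_of_set (- (\<Omega> \<union> K))) M" "compact M" "C \<subseteq> M" by metis
    then obtain W where W: "open W" "M = - (\<Omega> \<union> K) \<inter> W" by (auto simp: openin_open)
    have "C \<noteq> {}" using C in_components_nonempty by blast
    have "openin riemann_sphere (Some ` W)" using W by (simp add: riemann_sphere_def)
    moreover have "openin riemann_sphere (UNIV - Some ` M)"
    proof -
      have "closedin riemann_sphere (Some ` M)" using M(2) by (simp add: riemann_sphere_def compact_imp_closed)
      then show ?thesis by (metis openin_diff openin_topspace topspace_riemann_sphere)
    qed
    moreover have "C2 \<subseteq> Some ` W \<union> (UNIV - Some ` M)" using W C2K by auto
    moreover have "Some ` W \<inter> (UNIV - Some ` M) \<inter> C2 = {}" using W C2K by auto
    moreover have "Some ` W \<inter> C2 \<noteq> {}"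
    proof -
      obtain x where "x \<in> C" using \<open>C \<noteq> {}\<close> by blast
      then have "x \<in> W" "x \<notin> \<Omega> \<union> K" using M(3) W(2) by auto
      then have "Some x \<in> Some ` W \<inter> C2" by (auto simp: C2K)
      then show ?thesis by blast
    qed
    moreover have "(UNIV - Some ` M) \<inter> C2 \<noteq> {}" using C2(2) by auto
    ultimately show False using conn[OF C2(1)] unfolding connectedin by blast
  qed
  show thesis
    using that compK connK K\<Omega> twoK opU ne connU unb simply_connected_eq_unbounded_complement_components[OF opU] by blast
qed

section \<open>Conformal classification of doubly connected domains\<close>

text \<open>A Moebius map moves the zero of T to 0. Schwarz's lemma then bounds both the resulting
  map R and its inverse Q, so |R z| = |z| at some point, and R is a rotation.\<close>

lemma disc_automorphism_form:
  assumes T: "T holomorphic_on ball 0 1" "T ` ball 0 1 \<subseteq> ball 0 1"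
    and U: "U holomorphic_on ball 0 1" "U ` ball 0 1 \<subseteq> ball 0 1"
    and UT: "\<And>z. z \<in> ball 0 1 \<Longrightarrow> U (T z) = z" and TU: "\<And>z. z \<in> ball 0 1 \<Longrightarrow> T (U z) = z"
  obtains e a where "cmod e = 1" "cmod a < 1" "T a = 0"
    "\<And>z. z \<in> ball 0 1 \<Longrightarrow> T z = e * (z - a) / (1 - cnj a * z)"
proof -
  define a where "a = U 0"
  have a: "cmod a < 1" "T a = 0" using subsetD[OF U(2), of "U 0"] TU[of 0] by (auto simp: a_def)
  let ?m = "Moebius_function 0 a" and ?n = "Moebius_function 0 (-a)"
  have m: "?m holomorphic_on ball 0 1" "?m ` ball 0 1 \<subseteq> ball 0 1"
    using Moebius_function_holomorphic Moebius_function_norm_lt_1 a by auto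
  have n: "?n holomorphic_on ball 0 1" "?n ` ball 0 1 \<subseteq> ball 0 1"
    using Moebius_function_holomorphic[of "-a"] Moebius_function_norm_lt_1[of "-a"] a by auto
  have nm: "?n (?m z) = z" and mn: "?m (?n z) = z" if "z \<in> ball 0 1" for z
    using Moebius_function_compose[of a "-a" z] Moebius_function_compose[of "-a" a z] a that by auto
  define R where "R = T \<circ> ?n"
  define Q where "Q = ?m \<circ> U"
  have R: "R holomorphic_on ball 0 1" unfolding R_def by (rule holomorphic_on_compose_gen[OF n(1) T(1) n(2)])
  have Q: "Q holomorphic_on ball 0 1" unfolding Q_def by (rule holomorphic_on_compose_gen[OF U(1) m(1) U(2)])
  have R0: "R 0 = 0" using a by (simp add: R_def Moebius_function_of_zero)
  have Q0: "Q 0 = 0" by (simp add: Q_def a_def[symmetric] Moebius_function_eq_zero)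
  have Rb: "cmod (R z) < 1" if "cmod z < 1" for z using that T(2) n(2) by (force simp: R_def image_subset_iff)
  have Qb: "cmod (Q z) < 1" if "cmod z < 1" for z using that U(2) m(2) by (force simp: Q_def image_subset_iff)
  have QR: "Q (R z) = z" if "cmod z < 1" for z
  proof -
    have "?n z \<in> ball 0 1" using n(2) that by (force simp: image_subset_iff)
    then show ?thesis using UT mn that by (simp add: Q_def R_def)
  qed
  have le1: "cmod (R z) \<le> cmod z" if "cmod z < 1" for z using Schwarz_Lemma(1)[OF R R0 Rb that] .
  have le2: "cmod (Q z) \<le> cmod z" if "cmod z < 1" for z using Schwarz_Lemma(1)[OF Q Q0 Qb that] .
  have "cmod (R (1/2)) = cmod (1/2)"
    using le1[of "1/2"] le2[of "R (1/2)"] Rb[of "1/2"] QR[of "1/2"] by simp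
  then have "\<exists>z. cmod z < 1 \<and> z \<noteq> 0 \<and> cmod (R z) = cmod z" by (intro exI[of _ "1/2"]) simp
  then obtain e where e: "\<And>z. cmod z < 1 \<Longrightarrow> R z = e * z" "cmod e = 1"
    using Schwarz_Lemma(3)[OF R R0 Rb, of 0] by auto
  have "T z = e * (z - a) / (1 - cnj a * z)" if "z \<in> ball 0 1" for z
  proof -
    have "cmod (?m z) < 1" using m(2) that by (force simp: image_subset_iff)
    then have "R (?m z) = e * ?m z" by (rule e)
    then show ?thesis using nm[OF that] by (simp add: R_def Moebius_function_simple)
  qed
  then show thesis using that e a by blast
qed

lemma disc_half_plane:
  assumes p: "cmod p = 1"
  defines "\<phi> \<equiv> \<lambda>z. (p + z) / (p - z)" and "\<psi> \<equiv> \<lambda>w. p * (w - 1) / (w + 1)"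
  shows "\<phi> holomorphic_on ball 0 1"
    and "\<And>z. z \<in> ball 0 1 \<Longrightarrow> 0 < Re (\<phi> z) \<and> \<psi> (\<phi> z) = z"
    and "\<And>w. 0 < Re w \<Longrightarrow> \<psi> w \<in> ball 0 1 \<and> \<phi> (\<psi> w) = w"
proof -
  have p0: "p \<noteq> 0" using p by auto
  show "\<phi> holomorphic_on ball 0 1" unfolding \<phi>_def
    using p by (auto intro!: holomorphic_intros)
  show "0 < Re (\<phi> z) \<and> \<psi> (\<phi> z) = z" if z: "z \<in> ball 0 1" for z
  proof
    have ne: "p - z \<noteq> 0" using z p by auto
    have "Re ((p + z) / (p - z)) = Re ((p + z) * cnj (p - z)) / (cmod (p - z))\<^sup>2"
      by (subst complex_div_cnj) simp
    also have "Re ((p + z) * cnj (p - z)) = (cmod p)\<^sup>2 - (cmod z)\<^sup>2"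
      by (simp only: cmod_power2) (simp add: algebra_simps power2_eq_square)
    finally show "0 < Re (\<phi> z)" using z p ne by (simp add: \<phi>_def power_less_one_iff)
    show "\<psi> (\<phi> z) = z"
    proof -
      have "\<phi> z - 1 = 2 * z / (p - z)" "\<phi> z + 1 = 2 * p / (p - z)"
        using ne by (simp_all add: \<phi>_def field_simps)
      then show ?thesis using ne p0 by (simp add: \<psi>_def)
    qed
  qed
  show "\<psi> w \<in> ball 0 1 \<and> \<phi> (\<psi> w) = w" if w: "0 < Re w" for w
  proof
    have ne: "w + 1 \<noteq> 0" using w by (auto simp: complex_eq_iff)
    have "(cmod (w - 1))\<^sup>2 < (cmod (w + 1))\<^sup>2"
      using w by (simp only: cmod_power2) (simp add: power2_eq_square algebra_simps)
    then have "cmod (w - 1) < cmod (w + 1)" by (rule power2_less_imp_less) simp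
    then show "\<psi> w \<in> ball 0 1" using ne p by (simp add: \<psi>_def norm_mult norm_divide)
    have "p + \<psi> w = 2 * p * w / (w + 1)" "p - \<psi> w = 2 * p / (w + 1)"
      using ne by (simp_all add: \<psi>_def field_simps)
    then show "\<phi> (\<psi> w) = w" using ne p0 by (simp add: \<phi>_def)
  qed
qed

text \<open>A fixed point free automorphism fixes a point \<open>p\<close> of the unit circle; sending \<open>p\<close> to infinity
  makes it an affine map of the half plane.\<close>

lemma disc_automorphism_half_plane:
  assumes T: "T holomorphic_on ball 0 1" "T ` ball 0 1 \<subseteq> ball 0 1"
    and U: "U holomorphic_on ball 0 1" "U ` ball 0 1 \<subseteq> ball 0 1"
    and UT: "\<And>z. z \<in> ball 0 1 \<Longrightarrow> U (T z) = z" and TU: "\<And>z. z \<in> ball 0 1 \<Longrightarrow> T (U z) = z"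
    and nofix: "\<And>z. z \<in> ball 0 1 \<Longrightarrow> T z \<noteq> z"
  obtains \<phi> where "\<phi> holomorphic_on ball 0 1" "bij_betw \<phi> (ball 0 1) {w. 0 < Re w}"
    "(\<exists>\<alpha>::real. \<alpha> > 0 \<and> \<alpha> \<noteq> 1 \<and> (\<forall>z\<in>ball 0 1. \<phi> (T z) = of_real \<alpha> * \<phi> z)) \<or>
     (\<exists>\<beta>::real. \<beta> \<noteq> 0 \<and> (\<forall>z\<in>ball 0 1. \<phi> (T z) = \<phi> z + \<i> * of_real \<beta>))"
proof -
  obtain e a where e: "cmod e = 1" and a: "cmod a < 1" "T a = 0"
    and Tz: "\<And>z. z \<in> ball 0 1 \<Longrightarrow> T z = e * (z - a) / (1 - cnj a * z)"
    using disc_automorphism_form[OF T U UT TU] by metis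
  have a0: "a \<noteq> 0" using a nofix[of 0] by auto
  have e0: "e \<noteq> 0" using e by auto
  \<comment> \<open>The zeros of \<open>q\<close> in the disc are the fixed points of T, and
    \<open>p\<close> is a root from the quadratic formula.\<close>
  define q where "q = (\<lambda>z. - cnj a * z\<^sup>2 + (1 - e) * z + e * a)"
  define p where "p = ((1 - e) + csqrt ((1 - e)\<^sup>2 + 4 * cnj a * a * e)) / (2 * cnj a)"
  have den: "1 - cnj a * z \<noteq> 0" if "cmod z \<le> 1" for z
  proof
    assume "1 - cnj a * z = 0"
    then have "cnj a * z = 1" by simp
    then have "cmod a * cmod z = 1" by (metis norm_mult complex_mod_cnj norm_one)
    moreover have "cmod a * cmod z \<le> cmod a * 1" using that by (intro mult_left_mono) auto
    ultimately show False using a by simp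
  qed
  have qfix: "q z \<noteq> 0" if "cmod z < 1" for z
  proof
    assume "q z = 0"
    then have "e * (z - a) = z * (1 - cnj a * z)" by (simp add: q_def power2_eq_square algebra_simps)
    then have "T z = z" using Tz[of z] den[of z] that by simp
    then show False using nofix[of z] that by simp
  qed
  have qp: "q p = 0"
  proof -
    define s where "s = csqrt ((1 - e)\<^sup>2 + 4 * cnj a * a * e)"
    have s: "s * s = (1 - e) * (1 - e) + 4 * cnj a * a * e" by (simp add: s_def flip: power2_eq_square)
    define b where "b = cnj a"
    have b0: "b \<noteq> 0" using a0 by (simp add: b_def)
    have pb: "2 * b * p = (1 - e) + s" using b0 by (simp add: p_def s_def b_def)
    have "4 * b * q p = - (2 * b * p) * (2 * b * p) + 2 * (1 - e) * (2 * b * p) + 4 * b * e * a"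
      by (simp add: q_def b_def power2_eq_square algebra_simps)
    also have "\<dots> = 0" unfolding pb using s by (simp add: b_def algebra_simps)
    finally show ?thesis using b0 by simp
  qed
  \<comment> \<open>Reflection in the unit circle takes roots of \<open>q\<close> to roots: with p
    outside the circle, \<open>1 / cnj p\<close> would be a fixed point of T inside the
    disc.\<close>
  have p: "cmod p = 1"
  proof (rule ccontr)
    assume "cmod p \<noteq> 1"
    then have "cmod p > 1" using qfix[of p] qp by (meson not_less_iff_gr_or_eq)
    define r where "r = 1 / cnj p"
    have p0: "cnj p \<noteq> 0" using \<open>cmod p > 1\<close> by auto
    have "cmod r < 1" using \<open>cmod p > 1\<close> by (auto simp: r_def norm_divide divide_less_eq_1)
    have ee: "e * cnj e = 1" using e complex_norm_square[of e] by simp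
    have "cnj (q p) = 0" using qp by simp
    then have "- a * (cnj p)\<^sup>2 + (1 - cnj e) * cnj p + cnj e * cnj a = 0" by (simp add: q_def)
    then have "e * (- a * (cnj p)\<^sup>2 + (1 - cnj e) * cnj p + cnj e * cnj a) = 0" by simp
    then have *: "- e * a * (cnj p)\<^sup>2 + (e - e * cnj e) * cnj p + (e * cnj e) * cnj a = 0"
      by (simp add: algebra_simps)
    have "q r * (cnj p)\<^sup>2 = - cnj a + (1 - e) * cnj p + e * a * (cnj p)\<^sup>2"
      using p0 by (simp add: q_def r_def power2_eq_square field_simps)
    also have "\<dots> = 0" using * unfolding ee by (simp add: algebra_simps)
    finally show False using qfix[OF \<open>cmod r < 1\<close>] p0 by simp
  qed
  have p0: "p \<noteq> 0" using p by auto
  define d where "d = 1 - cnj a * p"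
  have d0: "d \<noteq> 0" using den[of p] p by (simp add: d_def)
  define A where "A = 1 - cnj a * a"
  have A: "A = of_real (1 - (cmod a)\<^sup>2)" using complex_norm_square[of a] by (simp add: A_def mult.commute)
  have Ar: "0 < 1 - (cmod a)\<^sup>2" using a by (simp add: power_less_one_iff)
  have A0: "A \<noteq> 0" unfolding A using Ar by (metis of_real_eq_0_iff less_irrefl)
  have pe: "p * d = e * (p - a)" using qp by (simp add: q_def d_def power2_eq_square algebra_simps)
  have pp: "p * cnj p = 1" using p complex_norm_square[of p] by simp
  have "p - a = p * cnj d" using pp by (simp add: d_def algebra_simps)
  then have ed: "d = e * cnj d" using pe p0 by simp
  \<comment> \<open>The reciprocal of the derivative of T at p. The relation
    \<open>d = e * cnj d\<close> makes it a positive real number.\<close>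
  define \<alpha> where "\<alpha> = (cmod d)\<^sup>2 / (1 - (cmod a)\<^sup>2)"
  have \<alpha>: "\<alpha> > 0" using d0 Ar by (simp add: \<alpha>_def)
  have \<alpha>c: "of_real \<alpha> = d * cnj d / A" unfolding \<alpha>_def A complex_norm_square[symmetric] by simp
  define \<phi> where "\<phi> = (\<lambda>z. (p + z) / (p - z))"
  define \<psi> where "\<psi> = (\<lambda>w. p * (w - 1) / (w + 1))"
  have HP: "\<phi> holomorphic_on ball 0 1"
      "\<And>z. z \<in> ball 0 1 \<Longrightarrow> 0 < Re (\<phi> z) \<and> \<psi> (\<phi> z) = z"
      "\<And>w. 0 < Re w \<Longrightarrow> \<psi> w \<in> ball 0 1 \<and> \<phi> (\<psi> w) = w"
    unfolding \<phi>_def \<psi>_def by (fact disc_half_plane[OF p])+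
  define \<kappa> where "\<kappa> = of_real \<alpha> - 1 + 2 * p * cnj a * cnj d / A"
  have \<phi>T: "\<phi> (T z) = of_real \<alpha> * \<phi> z + \<kappa>" if z: "z \<in> ball 0 1" for z
  proof -
    have pz: "p - z \<noteq> 0" using z p by auto
    have dz: "1 - cnj a * z \<noteq> 0" using den z by simp
    have "(p - T z) * d * (1 - cnj a * z) = e * (p - a) * (1 - cnj a * z) - e * (z - a) * d"
    proof -
      have TD: "T z * (1 - cnj a * z) = e * (z - a)" using Tz[OF z] dz by simp
      have "(p - T z) * d * (1 - cnj a * z) = (p * d) * (1 - cnj a * z) - (T z * (1 - cnj a * z)) * d"
        by (simp add: algebra_simps)
      then show ?thesis unfolding TD pe .
    qed
    also have "\<dots> = e * A * (p - z)" by (simp add: d_def A_def algebra_simps)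
    finally have 1: "(p - T z) * d * (1 - cnj a * z) = e * A * (p - z)" .
    have "e * ((p - T z) * cnj d * (1 - cnj a * z)) = (p - T z) * (e * cnj d) * (1 - cnj a * z)"
      by (simp add: algebra_simps)
    also have "\<dots> = e * (A * (p - z))" using 1 unfolding ed[symmetric] by (simp add: algebra_simps)
    finally have 2: "(p - T z) * cnj d * (1 - cnj a * z) = A * (p - z)" using e0 by simp
    have Tb: "T z \<in> ball 0 1" using T(2) z by (force simp: image_subset_iff)
    then have pT: "p - T z \<noteq> 0" using p by auto
    have "2 * p / (p - T z) = 2 * p * cnj d * (1 - cnj a * z) / (A * (p - z))"
      unfolding 2[symmetric] using pT d0 dz by simp
    also have "1 - cnj a * z = d + cnj a * (p - z)" by (simp add: d_def algebra_simps)
    also have "2 * p * cnj d * (d + cnj a * (p - z)) / (A * (p - z)) =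
        of_real \<alpha> * (2 * p / (p - z)) + 2 * p * cnj a * cnj d / A"
      unfolding \<alpha>c using pz A0 by (simp add: field_simps)
    finally have *: "2 * p / (p - T z) = of_real \<alpha> * (2 * p / (p - z)) + 2 * p * cnj a * cnj d / A" .
    have e2: "2 * p / (p - z) = \<phi> z + 1" using pz by (simp add: \<phi>_def field_simps)
    from pT have "\<phi> (T z) = 2 * p / (p - T z) - 1" by (simp add: \<phi>_def field_simps)
    also have "\<dots> = (of_real \<alpha> * (\<phi> z + 1) + 2 * p * cnj a * cnj d / A) - 1"
      unfolding * e2 ..
    finally show ?thesis by (simp add: \<kappa>_def algebra_simps)
  qed
  \<comment> \<open>w -> \<alpha> w + \<kappa> must map the right half plane onto itself. A point
    close to the boundary refutes Re \<kappa> < 0 through T, and a target point close to the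
    boundary refutes Re \<kappa> > 0 through the inverse U.\<close>
  have "Re \<kappa> = 0"
  proof (rule antisym)
    show "0 \<le> Re \<kappa>"
    proof (rule ccontr)
      assume "\<not> ?thesis"
      then have neg: "Re \<kappa> < 0" by simp
      define w where "w = complex_of_real (- Re \<kappa> / (2 * \<alpha>))"
      have "0 < Re w" using neg \<alpha> by (simp add: w_def divide_neg_pos)
      then have "\<psi> w \<in> ball 0 1" "\<phi> (\<psi> w) = w" using HP(3) by auto
      then have "0 < Re (of_real \<alpha> * w + \<kappa>)"
        using \<phi>T[of "\<psi> w"] HP(2)[of "T (\<psi> w)"] T(2) by (metis image_subset_iff)
      then show False using neg \<alpha> by (simp add: w_def)
    qed
    show "Re \<kappa> \<le> 0"
    proof (rule ccontr)
      assume "\<not> ?thesis"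
      then have pos: "Re \<kappa> > 0" by simp
      define w where "w = complex_of_real (Re \<kappa> / 2)"
      have "0 < Re w" using pos by (simp add: w_def)
      then have b: "\<psi> w \<in> ball 0 1" "\<phi> (\<psi> w) = w" using HP(3) by auto
      have Ub: "U (\<psi> w) \<in> ball 0 1" using U(2) b by (metis image_subset_iff)
      have "w = of_real \<alpha> * \<phi> (U (\<psi> w)) + \<kappa>" using \<phi>T[OF Ub] TU[OF b(1)] b by simp
      then have "Re w = \<alpha> * Re (\<phi> (U (\<psi> w))) + Re \<kappa>" by (metis Re_complex_of_real Im_complex_of_real plus_complex.sel(1) times_complex.sel(1) mult_zero_left diff_zero)
      moreover have "0 < \<alpha> * Re (\<phi> (U (\<psi> w)))" using HP(2)[OF Ub] \<alpha> by simp
      ultimately show False using pos by (simp add: w_def)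
    qed
  qed
  have bij: "bij_betw \<phi> (ball 0 1) {w. 0 < Re w}"
    by (rule bij_betwI[of _ _ _ \<psi>]) (use HP in auto)
  show thesis
  proof (cases "\<alpha> = 1")
    case True
    have "\<kappa> = \<i> * of_real (Im \<kappa>)" using \<open>Re \<kappa> = 0\<close> by (simp add: complex_eq_iff)
    moreover have "Im \<kappa> \<noteq> 0"
    proof
      assume "Im \<kappa> = 0"
      then have "\<phi> (T 0) = \<phi> 0" using \<phi>T[of 0] True \<open>Re \<kappa> = 0\<close> by (simp add: complex_eq_iff)
      then have "T 0 = 0" using bij T(2) by (force simp: bij_betw_def inj_on_def)
      then show False using nofix[of 0] by simp
    qed
    ultimately show thesis using that[OF HP(1) bij] \<phi>T True by (metis mult_1 of_real_1)
  next
    case False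
    \<comment> \<open>The finite fixed point \<open>- c\<close> of w -> \<alpha> w + \<kappa> lies
      on the imaginary axis; moving it to 0 turns the map into a pure dilation.\<close>
    define c where "c = \<kappa> / (of_real \<alpha> - 1)"
    have \<alpha>1: "complex_of_real \<alpha> - 1 \<noteq> 0" using False by (metis eq_iff_diff_eq_0 of_real_eq_1_iff)
    have "Re c = 0"
    proof -
      have "c = \<kappa> / of_real (\<alpha> - 1)" by (simp add: c_def)
      then show ?thesis using \<open>Re \<kappa> = 0\<close> by (simp only: Re_divide_of_real)
    qed
    define \<phi>2 where "\<phi>2 = (\<lambda>z. \<phi> z + c)"
    have "bij_betw \<phi>2 (ball 0 1) {w. 0 < Re w}"
      by (rule bij_betwI[of _ _ _ "\<lambda>w. \<psi> (w - c)"]) (use HP \<open>Re c = 0\<close> in \<open>auto simp: \<phi>2_def\<close>)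
    moreover have "\<phi>2 holomorphic_on ball 0 1"
      unfolding \<phi>2_def by (intro holomorphic_intros HP)
    moreover have "\<phi>2 (T z) = of_real \<alpha> * \<phi>2 z" if "z \<in> ball 0 1" for z
    proof -
      have "\<kappa> = c * (of_real \<alpha> - 1)" using \<alpha>1 by (simp add: c_def)
      then show ?thesis using \<phi>T[OF that] by (simp add: \<phi>2_def algebra_simps)
    qed
    ultimately show thesis using that[of \<phi>2] \<alpha> False by blast
  qed
qed

section \<open>The exponential covering of the disc minus a continuum\<close>

lemma connected_exp_preimage:
  assumes V: "open V" "connected V" "0 \<notin> V" and line: "\<And>\<zeta>. Re \<zeta> = c \<Longrightarrow> exp \<zeta> \<in> V"
  shows "connected {\<zeta>. exp \<zeta> \<in> V}"
proof -
  define S where "S = {\<zeta>. exp \<zeta> \<in> V}"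
  have "path_component S \<zeta> (of_real c)" if \<zeta>: "\<zeta> \<in> S" for \<zeta>
  proof -
    have "exp \<zeta> \<in> V" "exp (of_real c) \<in> V" using \<zeta> line by (auto simp: S_def)
    then obtain \<gamma> where \<gamma>: "path \<gamma>" "path_image \<gamma> \<subseteq> V" "pathstart \<gamma> = exp \<zeta>" "pathfinish \<gamma> = exp (of_real c)"
      using V connected_open_path_connected path_connected_def by metis
    have "0 \<notin> path_image \<gamma>" using \<gamma>(2) V(3) by blast
    then obtain q where q: "path q" "\<And>t. t \<in> {0..1} \<Longrightarrow> \<gamma> t = 0 + exp (q t)"
      using winding_number_as_continuous_log[OF \<gamma>(1)] by metis
    \<comment> \<open>The lift of \<gamma> that starts at \<zeta>. It ends on the line Re = c, which
      lies in the preimage and joins all lifts of the end point.\<close>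
    define k where "k = (\<lambda>t. q t + (\<zeta> - q 0))"
    have "exp (\<zeta> - q 0) = 1"
      using q(2)[of 0] \<gamma>(3) by (simp add: exp_diff pathstart_def)
    then have k: "\<gamma> t = exp (k t)" if "t \<in> {0..1}" for t
      using q(2)[OF that] by (simp add: k_def exp_add)
    have "path k" using q(1) unfolding k_def path_def by (intro continuous_intros)
    moreover have "path_image k \<subseteq> S" 
      using k \<gamma>(2) by (fastforce simp: path_image_def S_def image_subset_iff)
    ultimately have 1: "path_component S \<zeta> (k 1)"
      unfolding path_component_def by (intro exI[of _ k]) (simp add: pathstart_def pathfinish_def k_def)
    have "exp (k 1) = exp (of_real c)" using k[of 1] \<gamma>(4) by (simp add: pathfinish_def)
    then have "cmod (exp (k 1)) = cmod (exp (of_real c))" by simp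
    then have Re: "Re (k 1) = c" by simp
    have "path_component S (k 1) (of_real c)"
      unfolding path_component_def
    proof (intro exI conjI)
      show "path_image (linepath (k 1) (of_real c)) \<subseteq> S"
      proof
        fix z assume "z \<in> path_image (linepath (k 1) (of_real c))"
        then obtain u where "z = (1 - u) *\<^sub>R k 1 + u *\<^sub>R of_real c" by (auto simp: in_segment)
        then have "Re z = (1 - u) * Re (k 1) + u * c" by simp
        then have "Re z = c" using Re by (simp add: algebra_simps)
        then show "z \<in> S" using line by (simp add: S_def)
      qed
    qed auto
    with 1 show ?thesis by (rule path_component_trans)
  qed
  then have "path_connected S"
    unfolding path_connected_component by (meson path_component_sym path_component_trans)
  then show ?thesis unfolding S_def by (rule path_connected_imp_connected)
qed

lemma open_exp_preimage: "open V \<Longrightarrow> open {\<zeta>::complex. exp \<zeta> \<in> V}"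
  using open_vimage[of V exp] continuous_on_exp[OF continuous_on_id] by (auto simp: vimage_def)

text \<open>The complement of the preimage must have no bounded component. The right half plane
  belongs to an unbounded one, so a bounded component is mapped into K by exp; it would cut off from
  K a nonempty clopen part without 0, against connectedness.\<close>

lemma simply_connected_log_disc_minus_continuum:
  assumes K: "compact K" "connected K" "0 \<in> K" "K \<subseteq> ball 0 1" and V: "connected (ball 0 1 - K)"
  shows "simply_connected {\<zeta>::complex. exp \<zeta> \<in> ball 0 1 - K}"
proof -
  define S where "S = {\<zeta>::complex. exp \<zeta> \<in> ball 0 1 - K}"
  have oV: "open (ball 0 1 - K)" using K by (simp add: compact_imp_closed open_Diff)
  have oS: "open S" unfolding S_def by (rule open_exp_preimage[OF oV])
  obtain \<rho> where \<rho>: "0 < \<rho>" "\<rho> < 1" "\<And>z. z \<in> K \<Longrightarrow> cmod z < \<rho>"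
  proof -
    obtain m where m: "m \<in> K" "\<And>z. z \<in> K \<Longrightarrow> cmod z \<le> cmod m"
      using continuous_attains_sup[of K cmod] K by (auto intro: continuous_intros)
    then have "cmod m < 1" using K by auto
    then obtain \<rho> where "cmod m < \<rho>" "\<rho> < 1" using dense by blast
    then show thesis using m that[of \<rho>] by (meson le_less_trans norm_ge_zero)
  qed
  have connS: "connected S" unfolding S_def
  proof (rule connected_exp_preimage[OF oV V])
    fix \<zeta> assume "Re \<zeta> = ln \<rho>"
    then have "cmod (exp \<zeta>) = \<rho>" using \<rho> by simp
    then show "exp \<zeta> \<in> ball 0 1 - K" using \<rho> by fastforce
  qed (use K in auto)
  have "\<not> bounded C" if C: "C \<in> components (- S)" for C
  proof
    assume bC: "bounded C"
    have cl: "closed (- S)" using oS by blast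
    then have compC: "compact C" using C bC closed_components compact_eq_bounded_closed by blast
    define L where "L = {z. Re z < 0}"
    have CL: "C \<subseteq> L"
    proof (rule ccontr)
      assume "\<not> C \<subseteq> L"
      then have "C \<inter> {z. 0 \<le> Re z} \<noteq> {}" by (auto simp: L_def not_less)
      moreover have "connected {z. 0 \<le> Re z}" using convex_halfspace_Re_ge[of 0] convex_connected by blast
      moreover have "{z. 0 \<le> Re z} \<subseteq> - S" by (auto simp: S_def)
      ultimately have sub: "{z. 0 \<le> Re z} \<subseteq> C" using C components_maximal by blast
      obtain B where "\<And>z. z \<in> C \<Longrightarrow> cmod z \<le> B" using bC unfolding bounded_iff by blast
      with sub have B: "cmod z \<le> B" if "0 \<le> Re z" for z using that by auto
      show False using B[of "of_real (\<bar>B\<bar> + 1)"] by simp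
    qed
    have oL: "open L" unfolding L_def by (simp add: open_halfspace_Re_lt)
    obtain M where M: "openin (top_of_set (- S)) M" "compact M" "C \<subseteq> M" "M \<subseteq> L"
      using Sura_Bura_clopen_subset[OF closed_imp_locally_compact[OF cl] C compC oL CL] by metis
    obtain W where W: "open W" "M = - S \<inter> W" using M(1) by (auto simp: openin_open)
    have expM: "exp \<zeta> \<in> K" if "\<zeta> \<in> M" for \<zeta>
    proof -
      have "\<zeta> \<notin> S" "Re \<zeta> < 0" using that W M(4) by (auto simp: L_def)
      then show ?thesis by (auto simp: S_def)
    qed
    \<comment> \<open>The image of M is closed as a compact set and relatively open in K because exp
      is open and M is relatively open in the complement.\<close>
    have "closed (exp ` M)"
      by (intro compact_imp_closed compact_continuous_image M continuous_intros)
    moreover have "exp ` M = K \<inter> exp ` (W \<inter> L)"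
    proof
      show "exp ` M \<subseteq> K \<inter> exp ` (W \<inter> L)" using expM W M(4) by auto
      show "K \<inter> exp ` (W \<inter> L) \<subseteq> exp ` M"
      proof clarify
        fix \<zeta> assume "exp \<zeta> \<in> K" "\<zeta> \<in> W" "\<zeta> \<in> L"
        then have "\<zeta> \<in> M" using W by (auto simp: S_def)
        then show "exp \<zeta> \<in> exp ` M" by blast
      qed
    qed
    moreover have "open (exp ` (W \<inter> L))" using W oL by (intro open_exp_image) blast
    ultimately have "openin (top_of_set K) (exp ` M)" "closedin (top_of_set K) (exp ` M)"
      by (auto simp: openin_open closedin_closed)
    then have "exp ` M = {} \<or> exp ` M = K" using K(2) connected_clopen by blast
    moreover have "M \<noteq> {}" using M(3) C in_components_nonempty by blast
    moreover have "exp ` M \<noteq> K"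
    proof
      assume "exp ` M = K"
      then obtain \<zeta> where "\<zeta> \<in> M" "exp \<zeta> = (0::complex)" using K(3) by (metis imageE)
      then show False by simp
    qed
    ultimately show False by simp
  qed
  then show ?thesis using connS simply_connected_eq_unbounded_complement_components[OF oS] by (simp add: S_def)
qed

text \<open>W is constant on the fibres of exp and separates them, so it descends to a bijection of
  V; local branches of the logarithm show that this bijection is holomorphic.\<close>

lemma conformally_equivalent_exp_quotient:
  assumes V: "open V" "0 \<notin> V" and W: "W holomorphic_on {\<zeta>. exp \<zeta> \<in> V}" "W ` {\<zeta>. exp \<zeta> \<in> V} = B"
    and eq: "\<And>\<zeta> \<xi>. exp \<zeta> \<in> V \<Longrightarrow> exp \<xi> \<in> V \<Longrightarrow> W \<zeta> = W \<xi> \<longleftrightarrow> exp \<zeta> = exp \<xi>"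
  shows "conformally_equivalent V B"
proof -
  define F where "F = (\<lambda>z. W (Ln z))"
  have FW: "F (exp \<zeta>) = W \<zeta>" if "exp \<zeta> \<in> V" for \<zeta>
    unfolding F_def using eq[of "Ln (exp \<zeta>)" \<zeta>] that by simp
  have ex: "\<exists>\<zeta>. z = exp \<zeta>" if "z \<in> V" for z using that V by (metis exp_Ln)
  have oS: "open {\<zeta>. exp \<zeta> \<in> V}" by (rule open_exp_preimage[OF V(1)])
  have "F field_differentiable (at z0)" if z0: "z0 \<in> V" for z0
  proof -
    obtain \<zeta>0 where \<zeta>0: "z0 = exp \<zeta>0" using ex[OF z0] by blast
    define N where "N = V \<inter> {z. z / z0 \<in> - \<real>\<^sub>\<le>\<^sub>0}"
    have z00: "z0 \<noteq> 0" using \<zeta>0 by simp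
    \<comment> \<open>Near z0 the branch with value \<zeta>0 at z0 replaces \<open>Ln\<close>; the
      invariance of W makes the two descriptions agree.\<close>
    define G where "G = (\<lambda>z. W (Ln (z / z0) + \<zeta>0))"
    have e: "exp (Ln (z / z0) + \<zeta>0) = z" if "z \<in> N" for z
    proof -
      have "z \<noteq> 0" using that V by (auto simp: N_def)
      then show ?thesis using z00 by (simp add: exp_add \<zeta>0[symmetric])
    qed
    have "open ((\<lambda>z. z / z0) -` (- \<real>\<^sub>\<le>\<^sub>0))"
      using z00 by (intro open_vimage) (auto intro!: continuous_intros)
    then have oN: "open N" using V(1) by (auto simp: N_def vimage_def)
    have "G holomorphic_on N" unfolding G_def
    proof (rule holomorphic_on_compose_gen[OF _ W(1), unfolded o_def])
      show "(\<lambda>z. Ln (z / z0) + \<zeta>0) holomorphic_on N"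
        using z00 by (intro holomorphic_intros) (auto simp: N_def)
      show "(\<lambda>z. Ln (z / z0) + \<zeta>0) ` N \<subseteq> {\<zeta>. exp \<zeta> \<in> V}" using e by (auto simp: N_def)
    qed
    moreover have "F z = G z" if "z \<in> N" for z
      using FW[of "Ln (z / z0) + \<zeta>0"] e[OF that] that by (simp add: G_def N_def)
    ultimately have "F holomorphic_on N" using holomorphic_cong by metis
    moreover have "z0 \<in> N" using z0 z00 by (simp add: N_def)
    ultimately show ?thesis using oN holomorphic_on_imp_differentiable_at by blast
  qed
  then have "F holomorphic_on V" by (simp add: holomorphic_on_def field_differentiable_at_within)
  moreover have "bij_betw F V B"
  proof (rule bij_betw_imageI)
    show "inj_on F V"
    proof (rule inj_onI)
      fix z w assume zw: "z \<in> V" "w \<in> V" "F z = F w"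
      obtain \<zeta> \<xi> where "z = exp \<zeta>" "w = exp \<xi>" using ex zw by metis
      then show "z = w" using zw FW eq by metis
    qed
    show "F ` V = B"
    proof -
      have "V = exp ` {\<zeta>. exp \<zeta> \<in> V}"
      proof
        show "V \<subseteq> exp ` {\<zeta>. exp \<zeta> \<in> V}"
        proof
          fix z assume "z \<in> V"
          then show "z \<in> exp ` {\<zeta>. exp \<zeta> \<in> V}" using ex[of z] by auto
        qed
      qed auto
      then have "F ` V = F ` exp ` {\<zeta>. exp \<zeta> \<in> V}" by simp
      also have "\<dots> = W ` {\<zeta>. exp \<zeta> \<in> V}"
        unfolding image_image by (rule image_cong) (simp_all add: FW)
      finally show ?thesis using W(2) by simp
    qed
  qed
  ultimately show ?thesis by (auto simp: conformally_equivalent_def)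
qed

text \<open>The bounded inverse G extends over the puncture, and adding its value p there to V gives
  an open set. So p would be an isolated point of the connected set K, which has other
  points.\<close>

lemma punctured_disc_minus_continuum:
  assumes K: "connected K" "0 \<in> K" "\<exists>x\<in>K. x \<noteq> 0" "K \<subseteq> ball 0 1" and oV: "open (ball 0 1 - K)"
    and F: "F holomorphic_on ball 0 1 - K" "bij_betw F (ball 0 1 - K) (ball 0 1 - {0})"
  shows False
proof -
  define V where "V = ball 0 1 - K"
  have inj: "inj_on F V" and im: "F ` V = ball 0 1 - {0}" using F by (auto simp: V_def bij_betw_def)
  obtain G where G: "G holomorphic_on (F ` V)" "\<And>z. z \<in> V \<Longrightarrow> G (F z) = z"
    using holomorphic_has_inverse[of F V] F(1) oV inj unfolding V_def by metis
  have Gh: "G holomorphic_on ball 0 1 - {0}" using G(1) im by simp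
  have GV: "G w \<in> V" "F (G w) = w" if "w \<in> ball 0 1 - {0}" for w
    using that G(2) unfolding im[symmetric] by auto
  have "\<exists>B. eventually (\<lambda>z. norm (G z) \<le> B) (at 0)"
  proof -
    have "eventually (\<lambda>z. z \<in> ball 0 1 - {0}) (at (0::complex))"
      using eventually_at_ball'[of 1 "0::complex" UNIV] by simp
    then have "eventually (\<lambda>z. norm (G z) \<le> 1) (at 0)"
      by (rule eventually_mono) (use GV in \<open>force simp: V_def\<close>)
    then show ?thesis by blast
  qed
  then obtain g where g: "g holomorphic_on ball 0 1" "\<And>z. z \<in> ball 0 1 - {0} \<Longrightarrow> g z = G z"
    using holomorphic_on_extend_bounded[OF Gh, of ] by auto
  have inj_g: "z = w" if "z \<in> ball 0 1 - {0}" "w \<in> ball 0 1 - {0}" "g z = g w" for z w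
    using that g(2) GV by metis
  have nc: "\<not> g constant_on ball 0 1"
  proof
    assume "g constant_on ball 0 1"
    then have "g (1/2) = g (1/3)" unfolding constant_on_def by (metis mem_ball_0 norm_divide norm_one norm_numeral one_less_numeral_iff semiring_norm(76,77) divide_less_eq_1_pos zero_less_numeral)
    then have "(1/2::complex) = 1/3" by (rule inj_g[rotated 2]) (auto simp: norm_divide)
    then show False by simp
  qed
  have og: "open (g ` U)" if "open U" "U \<subseteq> ball 0 1" for U
    using open_mapping_thm[OF g(1) open_ball _ that(1) that(2) nc] by simp
  define p where "p = g 0"
  have eq: "g ` ball 0 1 = insert p V"
  proof -
    have "ball 0 1 = insert 0 (ball 0 1 - {0::complex})" by auto
    then have "g ` ball 0 1 = insert p (g ` (ball 0 1 - {0}))" unfolding p_def by (metis image_insert)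
    also have "g ` (ball 0 1 - {0}) = G ` F ` V" unfolding im by (rule image_cong) (auto simp: g(2))
    also have "\<dots> = V" using G(2) by (auto simp: image_image)
    finally show ?thesis .
  qed
  have "open (insert p V)" using og[of "ball 0 1"] by (simp add: eq)
  \<comment> \<open>As a limit of points of V, p lies in the closed disc; as a point of an open
    subset of it, p lies in the open disc.\<close>
  have "insert p V \<subseteq> cball 0 1"
  proof -
    have "V \<subseteq> ball 0 1" by (auto simp: V_def)
    moreover have "p \<in> closure V"
    proof -
      have "continuous_on (ball 0 1) g" using g(1) holomorphic_on_imp_continuous_on by blast
      then have "isCont g 0" by (simp add: continuous_on_interior)
      then have "(g \<longlongrightarrow> p) (at 0)" by (simp add: isCont_def p_def)
      moreover have "eventually (\<lambda>z. g z \<in> closure V) (at 0)"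
      proof -
        have "eventually (\<lambda>z. z \<in> ball 0 1 - {0}) (at (0::complex))"
          using eventually_at_ball'[of 1 "0::complex" UNIV] by simp
        then show ?thesis
          by (rule eventually_mono) (use GV(1) g(2) closure_subset in \<open>metis subsetD\<close>)
      qed
      ultimately show ?thesis by (rule Lim_in_closed_set[OF closed_closure _ trivial_limit_at, rotated])
    qed
    ultimately show ?thesis by (metis closure_mono closure_ball ball_subset_cball insert_subset order_trans subsetD zero_less_one zero_neq_one)
  qed
  with \<open>open (insert p V)\<close> have "insert p V \<subseteq> interior (cball 0 1)" by (rule interior_maximal[rotated])
  then have pb: "p \<in> ball 0 1" by simp
  \<comment> \<open>Otherwise g takes the value p at 0 and at another point z0. By the open mapping
    theorem it also takes some value other than p near both, against injectivity off 0.\<close>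
  have "p \<notin> V"
  proof
    assume "p \<in> V"
    define z0 where "z0 = F p"
    have z0: "z0 \<in> ball 0 1 - {0}" "g z0 = p"
    proof -
      show "z0 \<in> ball 0 1 - {0}" using \<open>p \<in> V\<close> im unfolding z0_def by blast
      then show "g z0 = p" using g(2) G(2) \<open>p \<in> V\<close> by (simp add: z0_def)
    qed
    obtain A B where AB: "open A" "open B" "0 \<in> A" "z0 \<in> B" "A \<inter> B = {}"
      using z0 hausdorff[of 0 z0] by auto
    define A' where "A' = A \<inter> ball 0 1"
    define B' where "B' = B \<inter> (ball 0 1 - {0})"
    have "open (g ` A')" "open (g ` B')" using AB og by (auto simp: A'_def B'_def intro!: og open_Int open_delete)
    then have o: "open (g ` A' \<inter> g ` B')" by blast
    have "0 \<in> A'" "z0 \<in> B'" using AB z0 by (auto simp: A'_def B'_def)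
    then have "p \<in> g ` A' \<inter> g ` B'" using z0(2) unfolding p_def by (metis IntI imageI)
    then obtain e where e: "0 < e" "ball p e \<subseteq> g ` A' \<inter> g ` B'" using o open_contains_ball by metis
    define p' where "p' = p + of_real (e/2)"
    have "p' \<in> ball p e" "p' \<noteq> p" using e by (auto simp: p'_def dist_norm)
    then have "p' \<in> g ` A'" "p' \<in> g ` B'" using e(2) by auto
    then obtain u v where uv: "u \<in> A'" "v \<in> B'" "g u = p'" "g v = p'" by (elim imageE) simp
    have "u \<noteq> 0" using \<open>p' \<noteq> p\<close> uv(3) by (auto simp: p_def)
    then have "u = v" using uv by (rule_tac inj_g) (auto simp: A'_def B'_def)
    then show False using uv AB by (auto simp: A'_def B'_def)
  qed
  then have "p \<in> K" using pb by (auto simp: V_def)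
  have "openin (top_of_set K) {p}"
    unfolding openin_open
    by (intro exI[of _ "insert p V"] conjI \<open>open (insert p V)\<close>) (use \<open>p \<in> K\<close> in \<open>auto simp: V_def\<close>)
  moreover have "closedin (top_of_set K) {p}" using \<open>p \<in> K\<close> by (simp add: closed_subset)
  ultimately have "K = {p}" using K(1) connected_clopen by (metis insert_not_empty)
  then show False using K by auto
qed

text \<open>\<open>Ln\<close> maps the half plane onto the strip |Im| < pi/2 and turns the dilation
  by \<alpha> into translation by ln \<alpha>. Rescaling this period to 2 pi \<i> and exponentiating
  divides it out; the edges of the strip give the radii.\<close>

lemma right_half_plane_hyperbolic_quotient:
  fixes \<alpha> :: real
  assumes "\<alpha> > 0" "\<alpha> \<noteq> 1"
  defines "E \<equiv> \<lambda>w. exp (2 * pi * \<i> * Ln w / ln \<alpha>)"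
  shows "E holomorphic_on {w. 0 < Re w}"
    and "E ` {w. 0 < Re w} = annulus (exp (- pi\<^sup>2 / \<bar>ln \<alpha>\<bar>)) (exp (pi\<^sup>2 / \<bar>ln \<alpha>\<bar>))"
    and "\<And>w v. 0 < Re w \<Longrightarrow> 0 < Re v \<Longrightarrow> E w = E v \<longleftrightarrow> (\<exists>k::int. w = of_real (\<alpha> powi k) * v)"
proof -
  have l0: "ln \<alpha> \<noteq> 0" using assms by simp
  have nn: "w \<notin> \<real>\<^sub>\<le>\<^sub>0" if "0 < Re w" for w using that by (auto simp: complex_nonpos_Reals_iff)
  show "E holomorphic_on {w. 0 < Re w}"
    unfolding E_def using nn l0 by (intro holomorphic_intros) auto
  have nE: "cmod (E w) = exp (- 2 * pi * Im (Ln w) / ln \<alpha>)" for w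
  proof -
    have "2 * pi * \<i> * Ln w / ln \<alpha> = of_real (2 * pi / ln \<alpha>) * (\<i> * Ln w)" by (simp add: field_simps)
    then have "Re (2 * pi * \<i> * Ln w / ln \<alpha>) = (2 * pi / ln \<alpha>) * Re (\<i> * Ln w)" by (simp only: Re_complex_of_real Im_complex_of_real times_complex.sel)
    then show ?thesis by (simp add: E_def)
  qed
  show "E ` {w. 0 < Re w} = annulus (exp (- pi\<^sup>2 / \<bar>ln \<alpha>\<bar>)) (exp (pi\<^sup>2 / \<bar>ln \<alpha>\<bar>))"
  proof (intro equalityI subsetI)
    fix y assume "y \<in> E ` {w. 0 < Re w}"
    then obtain w where w: "0 < Re w" "y = E w" by blast
    have "\<bar>Im (Ln w)\<bar> < pi / 2" using w(1) Re_Ln_pos_lt[of w] by (metis less_irrefl zero_complex.sel(1))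
    define t where "t = 2 * pi * Im (Ln w) / ln \<alpha>"
    have "\<bar>t\<bar> < pi\<^sup>2 / \<bar>ln \<alpha>\<bar>"
      using l0 \<open>\<bar>Im (Ln w)\<bar> < pi / 2\<close> by (simp add: t_def abs_mult divide_strict_right_mono power2_eq_square)
    moreover have "cmod y = exp (- t)" using w(2) nE by (simp add: t_def)
    ultimately show "y \<in> annulus (exp (- pi\<^sup>2 / \<bar>ln \<alpha>\<bar>)) (exp (pi\<^sup>2 / \<bar>ln \<alpha>\<bar>))"
      by (simp add: annulus_def abs_less_iff)
  next
    fix y assume y: "y \<in> annulus (exp (- pi\<^sup>2 / \<bar>ln \<alpha>\<bar>)) (exp (pi\<^sup>2 / \<bar>ln \<alpha>\<bar>))"
    then have y0: "y \<noteq> 0" by (auto simp: annulus_def)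
    define u where "u = Ln y * ln \<alpha> / (2 * pi * \<i>)"
    have "u = - \<i> * Ln y * of_real (ln \<alpha> / (2 * pi))" by (simp add: u_def field_simps)
    then have Imu: "Im u = - ln (cmod y) * (ln \<alpha> / (2 * pi))" using y0 by simp
    have "\<bar>ln (cmod y)\<bar> < pi\<^sup>2 / \<bar>ln \<alpha>\<bar>"
    proof -
      have "ln (exp (- pi\<^sup>2 / \<bar>ln \<alpha>\<bar>)) < ln (cmod y)" "ln (cmod y) < ln (exp (pi\<^sup>2 / \<bar>ln \<alpha>\<bar>))"
        using y y0 by (auto simp: annulus_def simp del: ln_exp)
      then show ?thesis by (simp add: abs_less_iff)
    qed
    then have "\<bar>ln (cmod y)\<bar> * \<bar>ln \<alpha>\<bar> < pi * pi" using l0 by (simp add: field_simps power2_eq_square)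
    then have Imb: "\<bar>Im u\<bar> < pi / 2" unfolding Imu by (simp add: abs_mult field_simps)
    have "0 < Re (exp u)" using Imb by (simp add: Re_exp cos_gt_zero_pi abs_less_iff)
    moreover have "Ln (exp u) = u" using Imb pi_gt_zero by (intro Ln_exp) (auto simp: abs_less_iff)
    then have "E (exp u) = y" using l0 y0 by (simp add: E_def u_def)
    ultimately show "y \<in> E ` {w. 0 < Re w}" by blast
  qed
  show "E w = E v \<longleftrightarrow> (\<exists>k::int. w = of_real (\<alpha> powi k) * v)" if wv: "0 < Re w" "0 < Re v" for w v
  proof
    have w0: "w \<noteq> 0" "v \<noteq> 0" using wv by auto
    {
      assume "E w = E v"
      then obtain k :: int where "2 * pi * \<i> * Ln w / ln \<alpha> = 2 * pi * \<i> * Ln v / ln \<alpha> + (of_int (2 * k) * pi) * \<i>"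
        unfolding E_def exp_eq by blast
      then have "(2 * pi * \<i> / ln \<alpha>) * Ln w = (2 * pi * \<i> / ln \<alpha>) * (Ln v + of_int k * ln \<alpha>)"
        using l0 by (simp add: field_simps)
      then have "Ln w = Ln v + of_int k * ln \<alpha>" using l0 by simp
      then have "exp (Ln w) = exp (Ln v) * exp (of_real (ln \<alpha> * k))" by (simp add: exp_add mult.commute)
      then have "w = v * of_real (exp (ln \<alpha> * k))" using w0 unfolding exp_of_real by (metis exp_Ln)
      moreover have "exp (ln \<alpha> * k) = \<alpha> powi k"
        using assms(1) by (metis exp_ln exp_power_int mult.commute)
      ultimately show "\<exists>k::int. w = of_real (\<alpha> powi k) * v" by (metis mult.commute)
    }
    assume "\<exists>k::int. w = of_real (\<alpha> powi k) * v"
    then obtain k :: int where k: "w = of_real (\<alpha> powi k) * v" by blast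
    have "Ln w = of_real (ln (\<alpha> powi k)) + Ln v"
      unfolding k using assms(1) w0 Ln_times_of_real[of "\<alpha> powi k" v] Ln_of_real[of "\<alpha> powi k"]
      by (simp del: of_real_power_int)
    also have "ln (\<alpha> powi k) = k * ln \<alpha>"
      using assms(1) by (metis exp_ln exp_power_int ln_exp)
    finally have "2 * pi * \<i> * Ln w / ln \<alpha> = 2 * pi * \<i> * Ln v / ln \<alpha> + (of_int (2 * k) * pi) * \<i>"
      using l0 by (simp add: field_simps)
    then show "E w = E v" unfolding E_def exp_eq by blast
  qed
qed

text \<open>The same for a vertical translation, whose period is already imaginary. The absolute
  value of \<beta> puts the image inside the unit circle for either direction of
  translation.\<close>

lemma right_half_plane_parabolic_quotient:
  fixes \<beta> :: real
  assumes "\<beta> \<noteq> 0"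
  defines "E \<equiv> \<lambda>w::complex. exp (- (2 * pi / \<bar>\<beta>\<bar>) * w)"
  shows "E holomorphic_on {w. 0 < Re w}"
    and "E ` {w. 0 < Re w} = ball 0 1 - {0}"
    and "\<And>w v :: complex. E w = E v \<longleftrightarrow> (\<exists>k::int. w = v + \<i> * of_real (\<beta> * k))"
proof -
  show "E holomorphic_on {w. 0 < Re w}" unfolding E_def by (intro holomorphic_intros)
  have nE: "cmod (E w) = exp (- (2 * pi / \<bar>\<beta>\<bar>) * Re w)" for w
    by (simp add: E_def)
  show "E ` {w. 0 < Re w} = ball 0 1 - {0}"
  proof (intro equalityI subsetI)
    fix y assume "y \<in> E ` {w. 0 < Re w}"
    then show "y \<in> ball 0 1 - {0}" using nE assms by (auto simp: mult_neg_pos)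
  next
    fix y :: complex assume y: "y \<in> ball 0 1 - {0}"
    define u where "u = Ln y * of_real (- \<bar>\<beta>\<bar> / (2 * pi))"
    have "E u = y" using y assms by (simp add: E_def u_def)
    moreover have "ln (cmod y) < 0" using y by (simp add: ln_less_zero)
    then have "0 < Re u" using y assms by (simp add: u_def mult_neg_pos divide_neg_pos)
    ultimately show "y \<in> E ` {w. 0 < Re w}" by blast
  qed
  fix w v :: complex
  have "E w = E v \<longleftrightarrow> (\<exists>k::int. - (2 * pi / \<bar>\<beta>\<bar>) * w = - (2 * pi / \<bar>\<beta>\<bar>) * v + (of_int (2 * k) * pi) * \<i>)"
    unfolding E_def exp_eq by simp
  also have "\<dots> \<longleftrightarrow> (\<exists>k::int. w = v - \<i> * of_real (\<bar>\<beta>\<bar> * k))"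
  proof (intro ex_cong1)
    fix k :: int
    define s where "s = complex_of_real \<bar>\<beta>\<bar>"
    have "s \<noteq> 0" using assms by (simp add: s_def)
    then have "- (2 * pi / \<bar>\<beta>\<bar>) * v + (of_int (2 * k) * pi) * \<i> = - (2 * pi / \<bar>\<beta>\<bar>) * (v - \<i> * of_real (\<bar>\<beta>\<bar> * k))"
      by (simp add: s_def[symmetric] field_simps)
    then show "- (2 * pi / \<bar>\<beta>\<bar>) * w = - (2 * pi / \<bar>\<beta>\<bar>) * v + (of_int (2 * k) * pi) * \<i> \<longleftrightarrow> w = v - \<i> * of_real (\<bar>\<beta>\<bar> * k)"
      using assms by simp
  qed
  also have "\<dots> \<longleftrightarrow> (\<exists>k::int. w = v + \<i> * of_real (\<beta> * k))"
  proof (cases "\<beta> > 0")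
    case True
    then show ?thesis by (metis abs_of_pos add.inverse_inverse diff_conv_add_uminus mult_minus_right of_int_minus of_real_minus)
  next
    case False
    then show ?thesis by simp
  qed
  finally show "E w = E v \<longleftrightarrow> (\<exists>k::int. w = v + \<i> * of_real (\<beta> * k))" .
qed

section \<open>Uniformization by a round annulus\<close>

lemma conformally_equivalent_trans:
  assumes "conformally_equivalent S T" "conformally_equivalent T U"
  shows "conformally_equivalent S U"
proof -
  obtain f g where f: "f holomorphic_on S" "bij_betw f S T" and g: "g holomorphic_on T" "bij_betw g T U"
    using assms by (auto simp: conformally_equivalent_def)
  have "(g \<circ> f) holomorphic_on S"
    using f g by (intro holomorphic_on_compose_gen) (auto simp: bij_betw_def)
  then show ?thesis using bij_betw_trans[OF f(2) g(2)] by (auto simp: conformally_equivalent_def)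
qed

lemma conformally_equivalent_sym:
  assumes "conformally_equivalent S T" "open S"
  shows "conformally_equivalent T S"
proof -
  obtain f where f: "f holomorphic_on S" "bij_betw f S T"
    using assms by (auto simp: conformally_equivalent_def)
  then obtain g where g: "g holomorphic_on (f ` S)" "\<And>z. z \<in> S \<Longrightarrow> g (f z) = z"
    using holomorphic_has_inverse[OF f(1) assms(2)] by (metis bij_betw_def)
  have "f ` S = T" using f by (simp add: bij_betw_def)
  moreover from this have "bij_betw g T S" using g f(2) by (auto simp: bij_betw_def inj_on_def image_iff)
  ultimately show ?thesis using g by (auto simp: conformally_equivalent_def)
qed

text \<open>\<open>P\<close> is a closed form for the iterates of A. Injectivity of A serves the
  induction towards negative exponents.\<close>

lemma translation_equivariant_int:
  assumes N: "\<And>\<zeta>. \<zeta> \<in> S \<Longrightarrow> N (\<zeta> + p) = A (N \<zeta>)" and S: "\<And>\<zeta>. \<zeta> \<in> S \<Longrightarrow> \<zeta> + p \<in> S" "\<And>\<zeta>. \<zeta> \<in> S \<Longrightarrow> \<zeta> - p \<in> S"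
    and P0: "\<And>w. P (0::int) w = w" and PA: "\<And>k w. P (k + 1) w = A (P k w)" and injA: "inj A"
    and \<zeta>: "(\<zeta>::complex) \<in> S"
  shows "N (\<zeta> + of_int k * p) = P k (N \<zeta>)"
proof (induction k rule: int_induct[where k=0])
  case base
  then show ?case by (simp add: P0)
next
  have mem: "\<zeta> + of_int i * p \<in> S" for i
  proof (induction i rule: int_induct[where k=0])
    case (step1 i)
    then show ?case using S(1)[OF step1(2)] by (simp add: algebra_simps)
  next
    case (step2 i)
    then show ?case using S(2)[OF step2(2)] by (simp add: algebra_simps)
  qed (use \<zeta> in simp)
  {
    case (step1 i)
    have "N (\<zeta> + of_int (i + 1) * p) = N ((\<zeta> + of_int i * p) + p)" by (simp add: algebra_simps)
    then show ?case using N[OF mem] step1 PA by simp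
  next
    case (step2 i)
    have "A (N (\<zeta> + of_int (i - 1) * p)) = N ((\<zeta> + of_int (i - 1) * p) + p)" by (rule N[OF mem, symmetric])
    also have "\<dots> = N (\<zeta> + of_int i * p)" by (simp add: algebra_simps)
    also have "\<dots> = A (P (i - 1) (N \<zeta>))" using step2 PA[of "i - 1"] by simp
    finally show ?case using injA by (simp add: inj_eq)
  }
qed

lemma disc_minus_continuum_conformal_annulus:
  assumes K: "compact K" "connected K" "0 \<in> K" "\<exists>x\<in>K. x \<noteq> 0" "K \<subseteq> ball 0 1" and V: "connected (ball 0 1 - K)"
  shows "\<exists>r R. 0 < r \<and> r < R \<and> conformally_equivalent (ball 0 1 - K) (annulus r R)"
proof -
  define S where "S = {\<zeta>. exp \<zeta> \<in> ball 0 1 - K}"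
  have oV: "open (ball 0 1 - K)" using K by (simp add: compact_imp_closed open_Diff)
  have V0: "0 \<notin> ball 0 1 - K" using K by simp
  have oS: "open S" unfolding S_def by (rule open_exp_preimage[OF oV])
  have sc: "simply_connected S" unfolding S_def
    by (rule simply_connected_log_disc_minus_continuum[OF K(1-3) K(5) V])
  have "ball 0 1 - K \<noteq> {}"
  proof
    assume "ball 0 1 - K = {}"
    then have "K = ball 0 1" using K(5) by auto
    then have "closed (ball (0::complex) 1)" using K(1) compact_imp_closed by blast
    then have "ball (0::complex) 1 = {} \<or> ball (0::complex) 1 = UNIV" by (intro clopen[THEN iffD1]) auto
    then show False by (metis ball_eq_empty bounded_ball not_bounded_UNIV not_one_le_zero)
  qed
  then obtain z0 where z0: "z0 \<in> ball 0 1 - K" by blast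
  then have "exp (Ln z0) = z0" using V0 by (metis exp_Ln)
  then have "S \<noteq> {}" using z0 unfolding S_def by (metis empty_Collect_eq)
  moreover have "0 \<notin> S" by (simp add: S_def)
  then have "S \<noteq> UNIV" by blast
  ultimately obtain f g where fg: "f holomorphic_on S" "g holomorphic_on ball 0 1"
     "\<forall>z\<in>S. f z \<in> ball 0 1 \<and> g (f z) = z" "\<forall>z\<in>ball 0 1. g z \<in> S \<and> f (g z) = z"
    using Riemann_mapping_theorem[of S] oS sc by auto
  define p where "p = 2 * complex_of_real pi * \<i>"
  have per: "\<zeta> + p \<in> S" "\<zeta> - p \<in> S" if "\<zeta> \<in> S" for \<zeta>
    using that by (simp_all add: S_def p_def exp_add exp_diff)
  \<comment> \<open>The deck translations by 2 pi \<i> and - 2 pi \<i>, read in the disc coordinate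
    of the covering.\<close>
  define T where "T = (\<lambda>z. f (g z + p))"
  define U where "U = (\<lambda>z. f (g z - p))"
  have holT: "T holomorphic_on ball 0 1" unfolding T_def
    by (rule holomorphic_on_compose_gen[OF _ fg(1), unfolded o_def, of _ "ball 0 1"]) (use fg per in \<open>auto intro!: holomorphic_intros\<close>)
  have holU: "U holomorphic_on ball 0 1" unfolding U_def
    by (rule holomorphic_on_compose_gen[OF _ fg(1), unfolded o_def, of _ "ball 0 1"]) (use fg per in \<open>auto intro!: holomorphic_intros\<close>)
  have imT: "T ` ball 0 1 \<subseteq> ball 0 1" and imU: "U ` ball 0 1 \<subseteq> ball 0 1"
    using fg per by (auto simp: T_def U_def image_subset_iff simp del: mem_ball)
  have gT: "g (T z) = g z + p" and gU: "g (U z) = g z - p" if "z \<in> ball 0 1" for z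
    using fg per that by (auto simp: T_def U_def)
  have UT: "U (T z) = z" and TU: "T (U z) = z" if z: "z \<in> ball 0 1" for z
  proof -
    have "U (T z) = f (g (T z) - p)" "T (U z) = f (g (U z) + p)" by (simp_all add: U_def T_def)
    then show "U (T z) = z" "T (U z) = z" using gT[OF z] gU[OF z] fg(4) z by auto
  qed
  have p0: "p \<noteq> 0" by (simp add: p_def)
  have nofix: "T z \<noteq> z" if "z \<in> ball 0 1" for z using gT[OF that] p0 by auto
  obtain \<phi> where \<phi>: "\<phi> holomorphic_on ball 0 1" "bij_betw \<phi> (ball 0 1) {w. 0 < Re w}"
    and cases: "(\<exists>\<alpha>::real. \<alpha> > 0 \<and> \<alpha> \<noteq> 1 \<and> (\<forall>z\<in>ball 0 1. \<phi> (T z) = of_real \<alpha> * \<phi> z)) \<or>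
     (\<exists>\<beta>::real. \<beta> \<noteq> 0 \<and> (\<forall>z\<in>ball 0 1. \<phi> (T z) = \<phi> z + \<i> * of_real \<beta>))"
    using disc_automorphism_half_plane[OF holT imT holU imU UT TU nofix] by metis
  define N where "N = (\<lambda>\<zeta>. \<phi> (f \<zeta>))"
  have bf: "bij_betw f S (ball 0 1)" by (rule bij_betwI[of _ _ _ g]) (use fg in \<open>auto simp del: mem_ball\<close>)
  have bN: "bij_betw N S {w. 0 < Re w}"
    unfolding N_def using bij_betw_trans[OF bf \<phi>(2)] by (simp add: o_def)
  have hN: "N holomorphic_on S" unfolding N_def
    by (rule holomorphic_on_compose_gen[OF fg(1) \<phi>(1), unfolded o_def]) (use fg in auto)
  have NT: "N (\<zeta> + p) = \<phi> (T (f \<zeta>))" if "\<zeta> \<in> S" for \<zeta>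
    using fg that by (simp add: N_def T_def)
  have injN: "inj_on N S" using bN by (simp add: bij_betw_def)
  have Npos: "0 < Re (N \<zeta>)" if "\<zeta> \<in> S" for \<zeta> using bN that by (auto simp: bij_betw_def)
  have perk: "\<zeta> + of_int k * p \<in> S" if "\<zeta> \<in> S" for \<zeta> k
  proof -
    have "exp (\<zeta> + of_int k * p) = exp \<zeta>" unfolding exp_eq p_def by (intro exI[of _ k]) simp
    then show ?thesis using that unfolding S_def by (simp only: mem_Collect_eq)
  qed
  \<comment> \<open>Common to both cases: a function E on the half plane whose fibres are the orbits
    of the deck group induces the conformal map of the quotient.\<close>
  have quot: "conformally_equivalent (ball 0 1 - K) B"
    if E: "E holomorphic_on {w. 0 < Re w}" "E ` {w. 0 < Re w} = B"
      and eq: "\<And>w v. 0 < Re w \<Longrightarrow> 0 < Re v \<Longrightarrow> E w = E v \<longleftrightarrow> (\<exists>k::int. w = P k v)"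
      and P: "\<And>\<zeta> k. \<zeta> \<in> S \<Longrightarrow> N (\<zeta> + of_int k * p) = P k (N \<zeta>)" for E B P
  proof (rule conformally_equivalent_exp_quotient[OF oV V0, of "\<lambda>\<zeta>. E (N \<zeta>)"])
    show "(\<lambda>\<zeta>. E (N \<zeta>)) holomorphic_on {\<zeta>. exp \<zeta> \<in> ball 0 1 - K}"
      using holomorphic_on_compose_gen[OF hN E(1)] bN by (auto simp: S_def bij_betw_def o_def)
    have "E ` N ` S = B" using bN E(2) by (simp add: bij_betw_def)
    then show "(\<lambda>\<zeta>. E (N \<zeta>)) ` {\<zeta>. exp \<zeta> \<in> ball 0 1 - K} = B" by (simp add: S_def image_image)
    fix \<zeta> \<xi> assume "exp \<zeta> \<in> ball 0 1 - K" "exp \<xi> \<in> ball 0 1 - K"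
    then have S2: "\<zeta> \<in> S" "\<xi> \<in> S" by (auto simp: S_def)
    have "E (N \<zeta>) = E (N \<xi>) \<longleftrightarrow> (\<exists>k::int. N \<zeta> = N (\<xi> + of_int k * p))"
      using eq[OF Npos Npos] P S2 by simp
    also have "\<dots> \<longleftrightarrow> (\<exists>k::int. \<zeta> = \<xi> + of_int k * p)"
      using inj_on_eq_iff[OF injN S2(1) perk[OF S2(2)]] by simp
    also have "\<dots> \<longleftrightarrow> exp \<zeta> = exp \<xi>" unfolding exp_eq p_def by (simp add: mult_ac)
    finally show "E (N \<zeta>) = E (N \<xi>) \<longleftrightarrow> exp \<zeta> = exp \<xi>" .
  qed
  from cases show ?thesis
  proof
    assume "\<exists>\<alpha>::real. \<alpha> > 0 \<and> \<alpha> \<noteq> 1 \<and> (\<forall>z\<in>ball 0 1. \<phi> (T z) = of_real \<alpha> * \<phi> z)"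
    then obtain \<alpha> :: real where \<alpha>: "\<alpha> > 0" "\<alpha> \<noteq> 1" "\<And>z. z \<in> ball 0 1 \<Longrightarrow> \<phi> (T z) = of_real \<alpha> * \<phi> z" by blast
    have step: "N (\<zeta> + p) = of_real \<alpha> * N \<zeta>" if "\<zeta> \<in> S" for \<zeta>
      using NT[OF that] \<alpha>(3)[of "f \<zeta>"] fg that by (simp add: N_def)
    have P: "N (\<zeta> + of_int k * p) = of_real (\<alpha> powi k) * N \<zeta>" if "\<zeta> \<in> S" for \<zeta> k
    proof (rule translation_equivariant_int[of S N p "\<lambda>w. of_real \<alpha> * w" "\<lambda>k w. of_real (\<alpha> powi k) * w"])
      show "of_real (\<alpha> powi (k + 1)) * w = of_real \<alpha> * (of_real (\<alpha> powi k) * w)" for k and w :: complex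
        using \<alpha> by (simp add: power_int_add_1)
      show "inj (\<lambda>w. complex_of_real \<alpha> * w)" using \<alpha> by (simp add: inj_def)
    qed (use step per that in auto)
    have "conformally_equivalent (ball 0 1 - K) (annulus (exp (- pi\<^sup>2 / \<bar>ln \<alpha>\<bar>)) (exp (pi\<^sup>2 / \<bar>ln \<alpha>\<bar>)))"
      by (rule quot[OF right_half_plane_hyperbolic_quotient[OF \<alpha>(1,2)] P])
    moreover have "exp (- pi\<^sup>2 / \<bar>ln \<alpha>\<bar>) < exp (pi\<^sup>2 / \<bar>ln \<alpha>\<bar>)"
    proof -
      have "0 < pi\<^sup>2 / \<bar>ln \<alpha>\<bar>" using \<alpha> by simp
      then show ?thesis by simp
    qed
    ultimately show ?thesis using exp_gt_zero by blast
  next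
    assume "\<exists>\<beta>::real. \<beta> \<noteq> 0 \<and> (\<forall>z\<in>ball 0 1. \<phi> (T z) = \<phi> z + \<i> * of_real \<beta>)"
    then obtain \<beta> :: real where \<beta>: "\<beta> \<noteq> 0" "\<And>z. z \<in> ball 0 1 \<Longrightarrow> \<phi> (T z) = \<phi> z + \<i> * of_real \<beta>" by blast
    have step: "N (\<zeta> + p) = N \<zeta> + \<i> * of_real \<beta>" if "\<zeta> \<in> S" for \<zeta>
      using NT[OF that] \<beta>(2)[of "f \<zeta>"] fg that by (simp add: N_def)
    have P: "N (\<zeta> + of_int k * p) = N \<zeta> + \<i> * of_real (\<beta> * k)" if "\<zeta> \<in> S" for \<zeta> k
      by (rule translation_equivariant_int[of S N p "\<lambda>w. w + \<i> * of_real \<beta>" "\<lambda>k w. w + \<i> * of_real (\<beta> * k)"])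
        (use step per that in \<open>auto simp: inj_def algebra_simps\<close>)
    note Q = right_half_plane_parabolic_quotient[OF \<beta>(1)]
    have "conformally_equivalent (ball 0 1 - K) (ball 0 1 - {0})"
      by (rule quot[OF Q(1,2) Q(3) P])
    then have False
      using punctured_disc_minus_continuum[OF K(2-5) oV] by (auto simp: conformally_equivalent_def)
    then show ?thesis ..
  qed
qed

text \<open>A Riemann map of the filled domain takes the domain to the disc minus a continuum; a
  disc automorphism then moves a point of the continuum to 0, where the exponential covering needs
  it.\<close>

theorem nondegenerate_conformal_annulus:
  assumes "nondegenerate \<Omega>"
  obtains r R where "0 < r" "r < R" "conformally_equivalent \<Omega> (annulus r R)"
proof -
  have \<Omega>: "open \<Omega>" "connected \<Omega>" using assms by (auto simp: nondegenerate_def doubly_connected_def plane_domain_def)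
  obtain K where K: "compact K" "connected K" "K \<inter> \<Omega> = {}" "\<exists>x\<in>K. \<exists>y\<in>K. x \<noteq> y"
    "open (\<Omega> \<union> K)" "simply_connected (\<Omega> \<union> K)" "\<Omega> \<union> K \<noteq> UNIV"
    using nondegenerate_imp_filled[OF assms] .
  then obtain p q where pq: "p \<in> K" "q \<in> K" "p \<noteq> q" by blast
  obtain f g where fg: "f holomorphic_on \<Omega> \<union> K" "g holomorphic_on ball 0 1"
     "\<forall>z\<in>\<Omega> \<union> K. f z \<in> ball 0 1 \<and> g (f z) = z" "\<forall>z\<in>ball 0 1. g z \<in> \<Omega> \<union> K \<and> f (g z) = z"
    using Riemann_mapping_theorem[of "\<Omega> \<union> K"] K pq by auto
  have "f p \<in> ball 0 1" using fg pq by blast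
  then obtain f2 g2 where f2: "f2 (f p) = 0"
                "f2 holomorphic_on ball 0 1" "f2 ` ball 0 1 \<subseteq> ball 0 1"
                "g2 holomorphic_on ball 0 1" "g2 ` ball 0 1 \<subseteq> ball 0 1"
                "\<And>z. z \<in> ball 0 1 \<Longrightarrow> f2 (g2 z) = z"
                "\<And>z. z \<in> ball 0 1 \<Longrightarrow> g2 (f2 z) = z"
    by (rule ball_biholomorphism_exists) blast
  define F where "F = (\<lambda>z. f2 (f z))"
  have hF: "F holomorphic_on \<Omega> \<union> K" unfolding F_def
    by (rule holomorphic_on_compose_gen[OF fg(1) f2(2), unfolded o_def]) (use fg in auto)
  have bF: "bij_betw F (\<Omega> \<union> K) (ball 0 1)"
  proof (rule bij_betwI[of _ _ _ "\<lambda>w. g (g2 w)"])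
    show "F \<in> \<Omega> \<union> K \<rightarrow> ball 0 1" using fg(3) f2(3) unfolding F_def by blast
    show "(\<lambda>w. g (g2 w)) \<in> ball 0 1 \<rightarrow> \<Omega> \<union> K" using fg(4) f2(5) by blast
    show "g (g2 (F x)) = x" if "x \<in> \<Omega> \<union> K" for x using fg(3) f2(7) that by (simp add: F_def del: mem_ball)
    show "F (g (g2 y)) = y" if "y \<in> ball 0 1" for y
    proof -
      have "g2 y \<in> ball 0 1" using f2(5) that by blast
      then show ?thesis using fg(4) f2(6)[OF that] by (simp add: F_def del: mem_ball)
    qed
  qed
  have inj: "inj_on F (\<Omega> \<union> K)" using bF by (simp add: bij_betw_def)
  have FV: "F ` \<Omega> = ball 0 1 - F ` K"
  proof -
    have "F ` ((\<Omega> \<union> K) - K) = F ` (\<Omega> \<union> K) - F ` K"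
      by (rule inj_on_image_set_diff[OF inj]) auto
    moreover have "(\<Omega> \<union> K) - K = \<Omega>" using K by blast
    ultimately show ?thesis using bF by (simp add: bij_betw_def)
  qed
  have cF: "continuous_on (\<Omega> \<union> K) F" using hF holomorphic_on_imp_continuous_on by blast
  have "\<exists>r R. 0 < r \<and> r < R \<and> conformally_equivalent (ball 0 1 - F ` K) (annulus r R)"
  proof (rule disc_minus_continuum_conformal_annulus)
    show "compact (F ` K)" "connected (F ` K)"
      using K cF by (auto intro!: compact_continuous_image connected_continuous_image intro: continuous_on_subset)
    show "0 \<in> F ` K" using f2(1) pq by (force simp: F_def)
    have "F q \<noteq> F p" using inj pq by (auto simp: inj_on_def)
    then show "\<exists>x\<in>F ` K. x \<noteq> 0" using f2(1) pq by (auto simp: F_def)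
    show "F ` K \<subseteq> ball 0 1" using bF by (auto simp: bij_betw_def)
    show "connected (ball 0 1 - F ` K)" unfolding FV[symmetric]
      using \<Omega> cF by (auto intro!: connected_continuous_image intro: continuous_on_subset)
  qed
  then obtain r R where rR: "0 < r" "r < R" "conformally_equivalent (F ` \<Omega>) (annulus r R)" by (auto simp: FV)
  have "conformally_equivalent \<Omega> (F ` \<Omega>)"
    unfolding conformally_equivalent_def
  proof (intro exI conjI)
    show "F holomorphic_on \<Omega>" using hF by (rule holomorphic_on_subset) auto
    show "bij_betw F \<Omega> (F ` \<Omega>)" using inj by (auto simp: bij_betw_def intro: inj_on_subset)
  qed
  then show thesis using that rR conformally_equivalent_trans by blast
qed

section \<open>The modulus under quasiconformal maps\<close>

lemma jac_mult_left: "jac (\<lambda>v. c * L v) = (cmod c)\<^sup>2 * jac L"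
proof -
  have "cnj (c * L 1) * (c * L \<i>) = of_real ((cmod c)\<^sup>2) * (cnj (L 1) * L \<i>)"
    unfolding complex_norm_square by (simp add: mult_ac)
  then show ?thesis unfolding jac_def by (simp only: Re_complex_of_real Im_complex_of_real times_complex.sel)
qed

lemma conformal_homeomorphism:
  assumes "f holomorphic_on S" "open S" "bij_betw f S T"
  obtains g where "homeomorphism S T f g" "g holomorphic_on T" "bij_betw g T S"
proof -
  have im: "f ` S = T" and inj: "inj_on f S" using assms by (auto simp: bij_betw_def)
  obtain g where g: "g holomorphic_on (f ` S)" "\<And>z. z \<in> S \<Longrightarrow> g (f z) = z"
    using holomorphic_has_inverse[OF assms(1,2) inj] by metis
  have "g ` T = S" using g(2) unfolding im[symmetric] by (simp add: image_image cong: image_cong_simp)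
  moreover have "f (g y) = y" if "y \<in> T" for y using that g(2) unfolding im[symmetric] by auto
  moreover have "continuous_on S f" "continuous_on T g"
    using g(1) assms(1) im by (auto intro: holomorphic_on_imp_continuous_on)
  ultimately have "homeomorphism S T f g"
    unfolding homeomorphism_def using g(2) im by blast
  moreover have "bij_betw g T S" by (rule bij_betwI[of _ _ _ f]) (use g im in auto)
  ultimately show thesis using that g im by simp
qed

text \<open>Conformal factors scale the squared length of the image vector and the Jacobian alike,
  so K does not change.\<close>

lemma quasiconformal_on_conformal_compose:
  assumes f: "f holomorphic_on A" "open A" "f ` A \<subseteq> U"
    and qc: "quasiconformal_on K U F D" and FV: "F ` U \<subseteq> V"
    and h: "h holomorphic_on V" "open V"
  shows "quasiconformal_on K A (\<lambda>z. h (F (f z))) (\<lambda>z v. deriv h (F (f z)) * D (f z) (deriv f z * v))"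
  unfolding quasiconformal_on_def
proof (intro conjI ballI allI)
  have der: "(F has_derivative D u) (at u)" and qcu: "(cmod (D u v))\<^sup>2 \<le> K * \<bar>jac (D u)\<bar> * (cmod v)\<^sup>2" if "u \<in> U" for u v
    using qc that by (auto simp: quasiconformal_on_def)
  have lin: "linear (D u)" if "u \<in> U" for u using der[OF that] has_derivative_linear by blast
  have fU: "f z \<in> U" and FfV: "F (f z) \<in> V" if "z \<in> A" for z using that f FV by auto
  {
    fix z v assume z: "z \<in> A"
    have 1: "(f has_derivative (*) (deriv f z)) (at z)"
      using f z holomorphic_derivI has_field_derivative_imp_has_derivative by blast
    have 2: "(h has_derivative (*) (deriv h (F (f z)))) (at (F (f z)))"
      using h FfV[OF z] holomorphic_derivI has_field_derivative_imp_has_derivative by blast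
    show "((\<lambda>z. h (F (f z))) has_derivative (\<lambda>v. deriv h (F (f z)) * D (f z) (deriv f z * v))) (at z)"
      by (rule has_derivative_compose[OF has_derivative_compose[OF 1 der[OF fU[OF z]]] 2])
    have "jac (\<lambda>v. deriv h (F (f z)) * D (f z) (deriv f z * v)) =
        (cmod (deriv h (F (f z))))\<^sup>2 * ((cmod (deriv f z))\<^sup>2 * jac (D (f z)))"
      by (simp add: jac_mult_left jac_mult_right[OF lin[OF fU[OF z]]])
    then have j: "\<bar>jac (\<lambda>v. deriv h (F (f z)) * D (f z) (deriv f z * v))\<bar> =
        (cmod (deriv h (F (f z))))\<^sup>2 * ((cmod (deriv f z))\<^sup>2 * \<bar>jac (D (f z))\<bar>)"
      by (simp add: abs_mult)
    have "(cmod (deriv h (F (f z))))\<^sup>2 * (cmod (D (f z) (deriv f z * v)))\<^sup>2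
        \<le> (cmod (deriv h (F (f z))))\<^sup>2 * (K * \<bar>jac (D (f z))\<bar> * (cmod (deriv f z * v))\<^sup>2)"
      by (intro mult_left_mono qcu fU z) simp
    then show "(cmod (deriv h (F (f z)) * D (f z) (deriv f z * v)))\<^sup>2
        \<le> K * \<bar>jac (\<lambda>v. deriv h (F (f z)) * D (f z) (deriv f z * v))\<bar> * (cmod v)\<^sup>2"
      unfolding j by (simp add: norm_mult power_mult_distrib mult_ac)
  }
  fix v
  have cf: "continuous_on A f" "continuous_on A (deriv f)"
    using f by (auto intro: holomorphic_on_imp_continuous_on holomorphic_deriv)
  have cF: "continuous_on A (\<lambda>z. F (f z))"
    by (rule continuous_on_compose2[OF quasiconformal_on_imp_continuous_on[OF qc] cf(1) f(3)])
  have ch: "continuous_on A (\<lambda>z. deriv h (F (f z)))"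
    by (rule continuous_on_compose2[OF _ cF]) (use h FfV in \<open>auto intro: holomorphic_on_imp_continuous_on holomorphic_deriv\<close>)
  have cD: "continuous_on A (\<lambda>z. D (f z) w)" for w
    by (rule continuous_on_compose2[OF _ cf(1) f(3)]) (use qc in \<open>auto simp: quasiconformal_on_def\<close>)
  have "continuous_on A (\<lambda>z. deriv h (F (f z)) * (Re (deriv f z * v) *\<^sub>R D (f z) 1 + Im (deriv f z * v) *\<^sub>R D (f z) \<i>))"
    by (intro continuous_intros ch cD cf)
  moreover have "D (f z) w = Re w *\<^sub>R D (f z) 1 + Im w *\<^sub>R D (f z) \<i>" if "z \<in> A" for z w
    by (rule linear_complex_expand[OF lin[OF fU[OF that]]])
  ultimately show "continuous_on A (\<lambda>z. deriv h (F (f z)) * D (f z) (deriv f z * v))"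
    using continuous_on_cong by (metis (no_types, lifting))
qed

lemma quasiconformal_annular_modulus_le:
  assumes K: "0 < K" and qc: "quasiconformal_on K U F D" and hom: "homeomorphism U V F G"
    and oU: "open U" and r: "0 < r" "r < R" and cU: "conformally_equivalent U (annulus r R)"
    and oV: "open V" and r': "0 < r'" "r' < R'" and cV: "conformally_equivalent V (annulus r' R')"
  shows "ln (R / r) \<le> K * ln (R' / r')"
proof -
  obtain f where f: "f holomorphic_on (annulus r R)" "bij_betw f (annulus r R) U"
    using conformally_equivalent_sym[OF cU oU] by (auto simp: conformally_equivalent_def)
  obtain h where h: "h holomorphic_on V" "bij_betw h V (annulus r' R')"
    using cV by (auto simp: conformally_equivalent_def)
  obtain f' where f': "homeomorphism (annulus r R) U f f'" using conformal_homeomorphism[OF f(1) open_annulus f(2)] by metis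
  obtain h' where h': "homeomorphism V (annulus r' R') h h'" using conformal_homeomorphism[OF h(1) oV h(2)] by metis
  have "quasiconformal_on K (annulus r R) (\<lambda>z. h (F (f z))) (\<lambda>z v. deriv h (F (f z)) * D (f z) (deriv f z * v))"
    by (rule quasiconformal_on_conformal_compose[OF f(1) open_annulus _ qc _ h(1) oV])
      (use f hom in \<open>auto simp: bij_betw_def homeomorphism_def\<close>)
  moreover have "homeomorphism (annulus r R) (annulus r' R') (\<lambda>z. h (F (f z))) (f' \<circ> G \<circ> h')"
    using homeomorphism_compose[OF homeomorphism_compose[OF f' hom] h'] by (simp add: o_def)
  ultimately have "ln R - ln r \<le> K * (ln R' - ln r')"
    by (intro quasiconformal_annuli_modulus_le[OF r r' K])
  then show ?thesis using r r' by (simp add: ln_div)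
qed

text \<open>The definite description is unique by the modulus inequality with K = 1 for the
  identity, used in both directions.\<close>

lemma conformal_modulus_eq:
  assumes nd: "nondegenerate \<Omega>" and r: "0 < r" "r < R" and c: "conformally_equivalent \<Omega> (annulus r R)"
  shows "conformal_modulus \<Omega> = ereal (ln (R / r))"
proof -
  have o: "open \<Omega>" using nd by (auto simp: nondegenerate_def doubly_connected_def plane_domain_def)
  have qc: "quasiconformal_on 1 \<Omega> (\<lambda>z. z) (\<lambda>z v. deriv (\<lambda>z. z) z * v)"
    by (rule holomorphic_imp_quasiconformal[OF _ o]) (intro holomorphic_intros)
  have hom: "homeomorphism \<Omega> \<Omega> (\<lambda>z. z) (\<lambda>z. z)" by (simp add: homeomorphism_def)
  have "(THE m. \<exists>r R. 0 < r \<and> r < R \<and> conformally_equivalent \<Omega> (annulus r R) \<and> m = ln (R / r)) = ln (R / r)"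
  proof (rule the_equality)
    show "\<exists>r' R'. 0 < r' \<and> r' < R' \<and> conformally_equivalent \<Omega> (annulus r' R') \<and> ln (R / r) = ln (R' / r')"
      using r c by blast
    fix m assume "\<exists>r R. 0 < r \<and> r < R \<and> conformally_equivalent \<Omega> (annulus r R) \<and> m = ln (R / r)"
    then obtain r' R' where r': "0 < r'" "r' < R'" and c': "conformally_equivalent \<Omega> (annulus r' R')" and m: "m = ln (R' / r')"
      by blast
    show "m = ln (R / r)" unfolding m
      using quasiconformal_annular_modulus_le[OF zero_less_one qc hom o r c o r' c']
        quasiconformal_annular_modulus_le[OF zero_less_one qc hom o r' c' o r c] by simp
  qed
  then show ?thesis using nd by (simp add: conformal_modulus_def)
qed

text \<open>A real value suits continuity and the intermediate value theorem. An infinite modulus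
  would become 0 here, so nondegeneracy accompanies its use.\<close>

definition real_modulus :: "complex set \<Rightarrow> real" where
  "real_modulus \<Omega> = real_of_ereal (conformal_modulus \<Omega>)"

lemma nondegenerate_imp_open: "nondegenerate \<Omega> \<Longrightarrow> open \<Omega>"
  by (auto simp: nondegenerate_def doubly_connected_def plane_domain_def)

lemma nondegenerate_real_modulus:
  assumes "nondegenerate \<Omega>"
  obtains r R where "0 < r" "r < R" "conformally_equivalent \<Omega> (annulus r R)" "real_modulus \<Omega> = ln (R / r)"
    "conformal_modulus \<Omega> = ereal (real_modulus \<Omega>)" "0 < real_modulus \<Omega>"
proof -
  obtain r R where r: "0 < r" "r < R" "conformally_equivalent \<Omega> (annulus r R)"
    using nondegenerate_conformal_annulus[OF assms] .
  then show thesis using that[OF r] conformal_modulus_eq[OF assms r] by (simp add: real_modulus_def)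
qed

lemma quasiconformal_real_modulus_le:
  assumes K: "0 < K" and qc: "quasiconformal_on K U F D" and hom: "homeomorphism U V F G"
    and U: "nondegenerate U" and V: "nondegenerate V"
  shows "real_modulus U \<le> K * real_modulus V"
proof -
  obtain r R where r: "0 < r" "r < R" "conformally_equivalent U (annulus r R)" "real_modulus U = ln (R / r)"
    using nondegenerate_real_modulus[OF U] by metis
  obtain r' R' where r': "0 < r'" "r' < R'" "conformally_equivalent V (annulus r' R')" "real_modulus V = ln (R' / r')"
    using nondegenerate_real_modulus[OF V] by metis
  show ?thesis unfolding r(4) r'(4)
    by (rule quasiconformal_annular_modulus_le[OF K qc hom nondegenerate_imp_open[OF U] r(1-3) nondegenerate_imp_open[OF V] r'(1-3)])
qed

lemma equal_modulus_imp_conformally_equivalent: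
  assumes U: "nondegenerate U" and V: "nondegenerate V" and eq: "real_modulus U = real_modulus V"
  shows "conformally_equivalent U V"
proof -
  obtain r R where r: "0 < r" "r < R" "conformally_equivalent U (annulus r R)" "real_modulus U = ln (R / r)"
    using nondegenerate_real_modulus[OF U] by metis
  obtain r' R' where r': "0 < r'" "r' < R'" "conformally_equivalent V (annulus r' R')" "real_modulus V = ln (R' / r')"
    using nondegenerate_real_modulus[OF V] by metis
  have q: "R / r = R' / r'" using eq r r' by simp
  have "conformally_equivalent (annulus r R) (annulus r' R')"
    unfolding conformally_equivalent_def
  proof (intro exI[of _ "\<lambda>z. of_real (r' / r) * z"] conjI)
    show "(\<lambda>z. of_real (r' / r) * z) holomorphic_on annulus r R" by (intro holomorphic_intros)
    have R': "R' = r' * R / r" using q r r' by (simp add: field_simps)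
    show "bij_betw (\<lambda>z. of_real (r' / r) * z) (annulus r R) (annulus r' R')"
      by (rule bij_betwI[of _ _ _ "\<lambda>z. of_real (r / r') * z"])
        (use r r' in \<open>auto simp: annulus_def norm_mult norm_divide R' field_simps\<close>)
  qed
  then show ?thesis
    using conformally_equivalent_trans r(3) conformally_equivalent_sym[OF r'(3) nondegenerate_imp_open[OF V]] by blast
qed

text \<open>Read between annuli, the inclusion is a holomorphic injection. If the modulus did not
  increase, the equality case would make it onto, contradicting proper inclusion.\<close>

lemma real_modulus_strict_mono:
  assumes U: "nondegenerate U" and V: "nondegenerate V" and sub: "U \<subset> V"
    and hom: "homeomorphism U V \<tau> \<tau>'" and seg: "\<And>z. z \<in> U \<Longrightarrow> closed_segment z (\<tau> z) \<subseteq> V"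
  shows "real_modulus U < real_modulus V"
proof (rule ccontr)
  assume nless: "\<not> ?thesis"
  obtain r R where r: "0 < r" "r < R" "conformally_equivalent U (annulus r R)" "real_modulus U = ln (R / r)"
    using nondegenerate_real_modulus[OF U] by metis
  obtain r' R' where r': "0 < r'" "r' < R'" "conformally_equivalent V (annulus r' R')" "real_modulus V = ln (R' / r')"
    using nondegenerate_real_modulus[OF V] by metis
  have oU: "open U" and oV: "open V" using U V nondegenerate_imp_open by auto
  obtain f where f: "f holomorphic_on (annulus r R)" "bij_betw f (annulus r R) U"
    using conformally_equivalent_sym[OF r(3) oU] by (auto simp: conformally_equivalent_def)
  obtain h where h: "h holomorphic_on V" "bij_betw h V (annulus r' R')"
    using r'(3) by (auto simp: conformally_equivalent_def)
  obtain f' where f': "homeomorphism (annulus r R) U f f'" using conformal_homeomorphism[OF f(1) open_annulus f(2)] by metis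
  obtain h' where h': "homeomorphism V (annulus r' R') h h'" using conformal_homeomorphism[OF h(1) oV h(2)] by metis
  have fU: "f ` annulus r R = U" and hV: "h ` V = annulus r' R'" using f h by (auto simp: bij_betw_def)
  have hom1: "homeomorphism (annulus r R) (annulus r' R') (h \<circ> (\<tau> \<circ> f)) (f' \<circ> \<tau>' \<circ> h')"
    by (rule homeomorphism_compose[OF homeomorphism_compose[OF f' hom] h'])
  obtain \<sigma> where \<sigma>: "r < \<sigma>" "\<sigma> < R" using r dense by blast
  define c where "c = circlepath 0 \<sigma>"
  have c: "c t \<in> annulus r R" for t unfolding c_def using \<sigma> r by (intro circlepath_mem_annulus) auto
  have pc: "path (f \<circ> c)"
    by (intro path_continuous_image continuous_on_subset[OF holomorphic_on_imp_continuous_on[OF f(1)]])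
      (use c in \<open>auto simp: path_image_def c_def\<close>)
  have fc: "f (c t) \<in> U" for t using c fU by auto
  have loop: "c 1 = c 0" unfolding c_def by (simp add: circlepath)
  \<comment> \<open>The straight segments from z to \<open>\<tau> z\<close> deform the inclusion
    into the homeomorphism; hence the inclusion has nonzero winding number too.\<close>
  have "homotopic_loops V (f \<circ> c) (\<tau> \<circ> (f \<circ> c))"
  proof (rule homotopic_loops_linear)
    show "path (\<tau> \<circ> (f \<circ> c))"
      by (intro path_continuous_image pc continuous_on_subset[OF homeomorphism_cont1[OF hom]]) (use fc in \<open>auto simp: path_image_def\<close>)
  qed (use pc fc seg loop in \<open>auto simp: pathfinish_def pathstart_def\<close>)
  then have "homotopic_loops (-{0}) (h \<circ> (f \<circ> c)) (h \<circ> (\<tau> \<circ> (f \<circ> c)))"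
    by (rule homotopic_loops_continuous_image[OF _ holomorphic_on_imp_continuous_on[OF h(1)]])
      (use hV r' in \<open>force simp: annulus_def\<close>)
  then have "winding_number ((h \<circ> f) \<circ> c) 0 = winding_number ((h \<circ> (\<tau> \<circ> f)) \<circ> c) 0"
    by (metis comp_assoc winding_number_homotopic_loops)
  then have wn: "winding_number ((h \<circ> f) \<circ> circlepath 0 \<sigma>) 0 \<noteq> 0"
    using homeomorphism_annuli_winding_nonzero[OF r(1,2) r'(1,2) hom1 \<sigma>] by (simp add: c_def)
  have "(h \<circ> f) ` annulus r R = annulus r' R'"
  proof (rule holomorphic_annuli_equal_modulus_onto[OF r(1,2) r'(1,2) _ _ _ \<sigma> wn])
    show "h \<circ> f holomorphic_on annulus r R"
      by (rule holomorphic_on_compose_gen[OF f(1) h(1)]) (use fU sub in auto)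
    show "inj_on (h \<circ> f) (annulus r R)"
      using f h sub fU by (intro comp_inj_on) (auto simp: bij_betw_def intro: inj_on_subset)
    show "(h \<circ> f) ` annulus r R \<subseteq> annulus r' R'"
      using fU hV sub by (auto simp: image_comp[symmetric])
    show "ln R' - ln r' \<le> ln R - ln r" using nless r r' by (simp add: ln_div)
  qed
  then have "h ` U = h ` V" using fU hV by (metis image_comp)
  moreover have "inj_on h V" using h by (simp add: bij_betw_def)
  ultimately have "U = V" using sub inj_on_image_eq_iff[of h V U V] by blast
  then show False using sub by blast
qed

section \<open>Harmonic maps and the intermediate value argument\<close>

lemma real_harmonic_on_Re_holomorphic:
  assumes "F holomorphic_on S" "open S"
  shows "real_harmonic_on (\<lambda>z. Re (F z)) S"
proof -
  have *: "C1_with_partials (\<lambda>z. Re (G z)) (\<lambda>z. Re (deriv G z)) (\<lambda>z. - Im (deriv G z)) S"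
    if "G holomorphic_on S" for G
    unfolding C1_with_partials_def
  proof (intro conjI ballI)
    have "continuous_on S (deriv G)" using that assms by (intro holomorphic_on_imp_continuous_on holomorphic_deriv)
    then show "continuous_on S (\<lambda>z. Re (deriv G z))" "continuous_on S (\<lambda>z. - Im (deriv G z))"
      by (intro continuous_intros; assumption)+
    fix z assume "z \<in> S"
    then have "(G has_derivative (*) (deriv G z)) (at z)"
      using that assms holomorphic_derivI has_field_derivative_imp_has_derivative by blast
    from has_derivative_Re[OF this]
    show "((\<lambda>z. Re (G z)) has_derivative (\<lambda>h. Re (deriv G z) * Re h + - Im (deriv G z) * Im h)) (at z)"
      by simp
  qed
  \<comment> \<open>The partial derivative -Im F' is itself the real part of \<i> F', so the same
    first-order formula yields the second derivatives.\<close>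
  have h1: "deriv F holomorphic_on S" and h2: "(\<lambda>z. \<i> * deriv F z) holomorphic_on S"
    using assms by (auto intro!: holomorphic_intros holomorphic_deriv)
  have d2: "deriv (\<lambda>z. \<i> * deriv F z) z = \<i> * deriv (deriv F) z" if "z \<in> S" for z
    using h1 assms(2) that by (intro deriv_cmult) (auto intro: holomorphic_on_imp_differentiable_at)
  show ?thesis unfolding real_harmonic_on_def
  proof (intro exI conjI)
    show "C1_with_partials (\<lambda>z. Re (F z)) (\<lambda>z. Re (deriv F z)) (\<lambda>z. - Im (deriv F z)) S" by (rule *[OF assms(1)])
    show "C1_with_partials (\<lambda>z. Re (deriv F z)) (\<lambda>z. Re (deriv (deriv F) z)) (\<lambda>z. - Im (deriv (deriv F) z)) S" by (rule *[OF h1])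
    show "C1_with_partials (\<lambda>z. - Im (deriv F z)) (\<lambda>z. Re (deriv (\<lambda>z. \<i> * deriv F z) z)) (\<lambda>z. - Im (deriv (\<lambda>z. \<i> * deriv F z) z)) S"
      using *[OF h2] by simp
    show "\<forall>z\<in>S. Re (deriv (deriv F) z) + - Im (deriv (\<lambda>z. \<i> * deriv F z) z) = 0"
      by (simp add: d2)
  qed
qed

text \<open>The real and imaginary parts are Re (P + Q) and Re (-\<i> (P - Q)); invariance of domain
  makes the inverse continuous.\<close>

lemma harmonic_homeomorphism_sum_cnj:
  assumes P: "P holomorphic_on S" and Q: "Q holomorphic_on S" and S: "open S"
    and bij: "bij_betw (\<lambda>z. P z + cnj (Q z)) S T"
  shows "harmonic_homeomorphism S T (\<lambda>z. P z + cnj (Q z))"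
  unfolding harmonic_homeomorphism_def
proof
  have cont: "continuous_on S (\<lambda>z. P z + cnj (Q z))"
    using P Q by (intro continuous_intros holomorphic_on_imp_continuous_on)
  have inj: "inj_on (\<lambda>z. P z + cnj (Q z)) S" and im: "(\<lambda>z. P z + cnj (Q z)) ` S = T"
    using bij by (auto simp: bij_betw_def)
  obtain g where "homeomorphism S ((\<lambda>z. P z + cnj (Q z)) ` S) (\<lambda>z. P z + cnj (Q z)) g"
    using invariance_of_domain_homeomorphism[OF S cont order_refl inj] .
  then show "\<exists>g. homeomorphism S T (\<lambda>z. P z + cnj (Q z)) g" unfolding im by blast
  show "complex_harmonic_on (\<lambda>z. P z + cnj (Q z)) S"
    using real_harmonic_on_Re_holomorphic[of "\<lambda>z. P z + Q z" S] real_harmonic_on_Re_holomorphic[of "\<lambda>z. - \<i> * (P z - Q z)" S] P Q S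
    by (simp add: complex_harmonic_on_def holomorphic_intros)
qed

text \<open>The bound is used with x and y in both orders, which squeezes \<open>m y\<close> between
  two multiples of \<open>m x\<close> tending to \<open>m x\<close>.\<close>

lemma continuous_on_of_multiplicative_bound:
  fixes m :: "real \<Rightarrow> real"
  assumes C: "0 \<le> C"
    and bound: "\<And>x y. x \<in> S \<Longrightarrow> y \<in> S \<Longrightarrow> C * \<bar>x - y\<bar> < 1 \<Longrightarrow> m x \<le> 1 / (1 - C * \<bar>x - y\<bar>) * m y"
  shows "continuous_on S m"
proof (unfold continuous_on, intro ballI)
  fix x assume x: "x \<in> S"
  have t: "((\<lambda>y. C * \<bar>x - y\<bar>) \<longlongrightarrow> 0) (at x within S)"
    by (auto intro!: tendsto_eq_intros)
  then have ev: "eventually (\<lambda>y. C * \<bar>x - y\<bar> < 1) (at x within S)"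
    by (rule order_tendstoD) simp
  have evS: "eventually (\<lambda>y. y \<in> S) (at x within S)" by (simp add: eventually_at_filter)
  show "(m \<longlongrightarrow> m x) (at x within S)"
  proof (rule real_tendsto_sandwich)
    show "eventually (\<lambda>y. (1 - C * \<bar>x - y\<bar>) * m x \<le> m y) (at x within S)"
      using ev evS
    proof eventually_elim
      case (elim y)
      then show ?case using bound[OF x, of y] by (simp add: field_simps)
    qed
    show "eventually (\<lambda>y. m y \<le> 1 / (1 - C * \<bar>x - y\<bar>) * m x) (at x within S)"
      using ev evS
    proof eventually_elim
      case (elim y)
      then show ?case using bound[of y x] x by (simp add: abs_minus_commute)
    qed
    show "((\<lambda>y. (1 - C * \<bar>x - y\<bar>) * m x) \<longlongrightarrow> m x) (at x within S)"
      using t by (auto intro!: tendsto_eq_intros)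
    show "((\<lambda>y. 1 / (1 - C * \<bar>x - y\<bar>) * m x) \<longlongrightarrow> m x) (at x within S)"
      using t by (auto intro!: tendsto_eq_intros)
  qed
qed

text \<open>The admissible \<epsilon> is the gain in modulus at the end of the family. The constant
  C links the parameter distance to the dilatation and thereby gives continuity of the
  modulus.\<close>

lemma harmonic_homeomorphism_of_family:
  fixes U :: "real \<Rightarrow> complex set"
  assumes nd: "nondegenerate \<Omega>'" and ndU: "\<And>x. x \<in> {0..1} \<Longrightarrow> nondegenerate (U x)"
    and C: "0 \<le> C"
    and qc: "\<And>x y. x \<in> {0..1} \<Longrightarrow> y \<in> {0..1} \<Longrightarrow> C * \<bar>x - y\<bar> < 1 \<Longrightarrow>
       \<exists>F D G. quasiconformal_on (1 / (1 - C * \<bar>x - y\<bar>)) (U x) F D \<and> homeomorphism (U x) (U y) F G"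
    and harm: "\<And>x. x \<in> {0..1} \<Longrightarrow> \<exists>P Q. P holomorphic_on U x \<and> Q holomorphic_on U x \<and>
       bij_betw (\<lambda>z. P z + cnj (Q z)) (U x) \<Omega>'"
    and m0: "real_modulus (U 0) \<le> real_modulus \<Omega>'" and m1: "real_modulus \<Omega>' < real_modulus (U 1)"
  shows "\<exists>\<epsilon>::real. 0 < \<epsilon> \<and>
           (\<forall>\<Omega> :: complex set.
              doubly_connected \<Omega> \<longrightarrow>
              conformal_modulus \<Omega>' < conformal_modulus \<Omega> \<longrightarrow>
              conformal_modulus \<Omega> < conformal_modulus \<Omega>' + ereal \<epsilon> \<longrightarrow>
              (\<exists>h. harmonic_homeomorphism \<Omega> \<Omega>' h))"
proof (intro exI[of _ "real_modulus (U 1) - real_modulus \<Omega>'"] conjI allI impI)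
  show "0 < real_modulus (U 1) - real_modulus \<Omega>'" using m1 by simp
  fix \<Omega> assume dc: "doubly_connected \<Omega>" and l: "conformal_modulus \<Omega>' < conformal_modulus \<Omega>"
    and u: "conformal_modulus \<Omega> < conformal_modulus \<Omega>' + ereal (real_modulus (U 1) - real_modulus \<Omega>')"
  have e': "conformal_modulus \<Omega>' = ereal (real_modulus \<Omega>')" using nondegenerate_real_modulus[OF nd] by metis
  \<comment> \<open>A degenerate domain has infinite modulus and violates the upper bound.\<close>
  have nd\<Omega>: "nondegenerate \<Omega>"
  proof (rule ccontr)
    assume "\<not> nondegenerate \<Omega>"
    then have "conformal_modulus \<Omega> = \<infinity>" by (simp add: conformal_modulus_def)
    then show False using u by simp
  qed
  have e: "conformal_modulus \<Omega> = ereal (real_modulus \<Omega>)" using nondegenerate_real_modulus[OF nd\<Omega>] by metis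
  have lu: "real_modulus \<Omega>' < real_modulus \<Omega>" "real_modulus \<Omega> < real_modulus (U 1)"
    using l u by (simp_all add: e e')
  have "continuous_on {0..1} (\<lambda>x. real_modulus (U x))"
  proof (rule continuous_on_of_multiplicative_bound[OF C])
    fix x y :: real assume xy: "x \<in> {0..1}" "y \<in> {0..1}" "C * \<bar>x - y\<bar> < 1"
    then obtain F D G where FDG: "quasiconformal_on (1 / (1 - C * \<bar>x - y\<bar>)) (U x) F D" "homeomorphism (U x) (U y) F G"
      using qc by blast
    show "real_modulus (U x) \<le> 1 / (1 - C * \<bar>x - y\<bar>) * real_modulus (U y)"
      by (rule quasiconformal_real_modulus_le[OF _ FDG ndU ndU]) (use xy in auto)
  qed
  then obtain x where x: "x \<in> {0..1}" "real_modulus (U x) = real_modulus \<Omega>"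
    using IVT'[of "\<lambda>x. real_modulus (U x)" 0 "real_modulus \<Omega>" 1] lu m0 by auto
  obtain P Q where PQ: "P holomorphic_on U x" "Q holomorphic_on U x" "bij_betw (\<lambda>z. P z + cnj (Q z)) (U x) \<Omega>'"
    using harm[OF x(1)] by blast
  obtain f where f: "f holomorphic_on \<Omega>" "bij_betw f \<Omega> (U x)"
    using equal_modulus_imp_conformally_equivalent[OF nd\<Omega> ndU[OF x(1)]] x(2) by (auto simp: conformally_equivalent_def)
  have im: "f ` \<Omega> \<subseteq> U x" using f by (simp add: bij_betw_def)
  have "harmonic_homeomorphism \<Omega> \<Omega>' (\<lambda>z. P (f z) + cnj (Q (f z)))"
  proof (rule harmonic_homeomorphism_sum_cnj)
    show "(\<lambda>z. P (f z)) holomorphic_on \<Omega>" "(\<lambda>z. Q (f z)) holomorphic_on \<Omega>"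
      using holomorphic_on_compose_gen[OF f(1) PQ(1) im] holomorphic_on_compose_gen[OF f(1) PQ(2) im] by (simp_all add: o_def)
    show "open \<Omega>" by (rule nondegenerate_imp_open[OF nd\<Omega>])
    show "bij_betw (\<lambda>z. P (f z) + cnj (Q (f z))) \<Omega> \<Omega>'"
      using bij_betw_trans[OF f(2) PQ(3)] by (simp add: o_def)
  qed
  then show "\<exists>h. harmonic_homeomorphism \<Omega> \<Omega>' h" by blast
qed

section \<open>Affine images\<close>

lemma quasiconformal_on_mono:
  assumes "quasiconformal_on K S F D" "K \<le> K'"
  shows "quasiconformal_on K' S F D"
proof -
  have "(cmod (D z v))\<^sup>2 \<le> K' * \<bar>jac (D z)\<bar> * (cmod v)\<^sup>2" if "z \<in> S" for z v
  proof -
    have "(cmod (D z v))\<^sup>2 \<le> K * \<bar>jac (D z)\<bar> * (cmod v)\<^sup>2" using assms that by (auto simp: quasiconformal_on_def)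
    also have "\<dots> \<le> K' * \<bar>jac (D z)\<bar> * (cmod v)\<^sup>2" using assms(2) by (intro mult_right_mono) auto
    finally show ?thesis .
  qed
  then show ?thesis using assms by (auto simp: quasiconformal_on_def)
qed

text \<open>The inverse is Cramer's rule for the linear system formed by the equation for w and its
  conjugate.\<close>

lemma homeomorphism_affine:
  assumes "cmod a \<noteq> cmod b"
  shows "homeomorphism UNIV UNIV (\<lambda>z. a * z + b * cnj z + c)
    (\<lambda>w. (cnj a * (w - c) - b * cnj (w - c)) / (a * cnj a - b * cnj b))"
proof -
  have d: "a * cnj a - b * cnj b \<noteq> 0"
  proof
    assume "a * cnj a - b * cnj b = 0"
    then have "of_real ((cmod a)\<^sup>2) = (of_real ((cmod b)\<^sup>2) :: complex)" unfolding complex_norm_square by simp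
    then have "(cmod a)\<^sup>2 = (cmod b)\<^sup>2" by (simp only: of_real_eq_iff)
    then show False using assms by (simp add: power2_eq_iff_nonneg)
  qed
  have d': "cnj a * a - cnj b * b = a * cnj a - b * cnj b" by (simp add: mult.commute)
  have 1: "(cnj a * ((a * z + b * cnj z + c) - c) - b * cnj ((a * z + b * cnj z + c) - c)) / (a * cnj a - b * cnj b) = z" for z
    using d by (simp add: field_simps)
  have 2: "a * ((cnj a * u - b * cnj u) / (a * cnj a - b * cnj b)) + b * cnj ((cnj a * u - b * cnj u) / (a * cnj a - b * cnj b)) = u" for u
  proof -
    have "cnj ((cnj a * u - b * cnj u) / (a * cnj a - b * cnj b)) = (a * cnj u - cnj b * u) / (a * cnj a - b * cnj b)"
      by (simp add: d')
    then have "a * ((cnj a * u - b * cnj u) / (a * cnj a - b * cnj b)) + b * cnj ((cnj a * u - b * cnj u) / (a * cnj a - b * cnj b))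
      = (a * (cnj a * u - b * cnj u) + b * (a * cnj u - cnj b * u)) / (a * cnj a - b * cnj b)"
      by (simp add: add_divide_distrib)
    also have "a * (cnj a * u - b * cnj u) + b * (a * cnj u - cnj b * u) = (a * cnj a - b * cnj b) * u"
      by (simp add: algebra_simps)
    finally show ?thesis using d by simp
  qed
  have 3: "a * ((cnj a * (w - c) - b * cnj (w - c)) / (a * cnj a - b * cnj b)) + b * cnj ((cnj a * (w - c) - b * cnj (w - c)) / (a * cnj a - b * cnj b)) + c = w" for w
    unfolding 2 by simp
  show ?thesis
  proof (rule homeomorphismI)
    show "continuous_on UNIV (\<lambda>z. a * z + b * cnj z + c)"
      "continuous_on UNIV (\<lambda>w. (cnj a * (w - c) - b * cnj (w - c)) / (a * cnj a - b * cnj b))"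
      using d by (intro continuous_intros; simp)+
  qed (rule subset_UNIV 1 3)+
qed

text \<open>The largest stretch is |a| + |b|, and the Jacobian has absolute value (|a| + |b|) | |a|
  - |b| |.\<close>

lemma quasiconformal_on_affine:
  assumes "cmod a \<noteq> cmod b"
  shows "quasiconformal_on ((cmod a + cmod b) / \<bar>cmod a - cmod b\<bar>) S
     (\<lambda>z. a * z + b * cnj z + c) (\<lambda>z v. a * v + b * cnj v)"
  unfolding quasiconformal_on_def
proof (intro conjI ballI allI)
  fix z v
  show "((\<lambda>z. a * z + b * cnj z + c) has_derivative (\<lambda>v. a * v + b * cnj v)) (at z)"
    by (auto intro!: derivative_eq_intros has_derivative_cnj)
  have "jac (\<lambda>v. a * v + b * cnj v) = (cmod a)\<^sup>2 - (cmod b)\<^sup>2"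
    unfolding cmod_power2 by (simp add: jac_def algebra_simps power2_eq_square)
  also have "\<dots> = (cmod a + cmod b) * (cmod a - cmod b)" by (simp add: algebra_simps power2_eq_square)
  finally have j: "\<bar>jac (\<lambda>v. a * v + b * cnj v)\<bar> = (cmod a + cmod b) * \<bar>cmod a - cmod b\<bar>"
    by (simp add: abs_mult)
  have "cmod (a * v + b * cnj v) \<le> (cmod a + cmod b) * cmod v"
    using norm_triangle_ineq[of "a * v" "b * cnj v"] by (simp add: norm_mult algebra_simps)
  then have "(cmod (a * v + b * cnj v))\<^sup>2 \<le> ((cmod a + cmod b) * cmod v)\<^sup>2" by (rule power_mono) simp
  also have "\<dots> = (cmod a + cmod b) / \<bar>cmod a - cmod b\<bar> * \<bar>jac (\<lambda>v. a * v + b * cnj v)\<bar> * (cmod v)\<^sup>2"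
    unfolding j using assms by (simp add: power2_eq_square)
  finally show "(cmod (a * v + b * cnj v))\<^sup>2 \<le> (cmod a + cmod b) / \<bar>cmod a - cmod b\<bar> * \<bar>jac (\<lambda>v. a * v + b * cnj v)\<bar> * (cmod v)\<^sup>2" .
qed (intro continuous_intros)

lemma nondegenerate_affine_image:
  assumes "cmod a \<noteq> cmod b" "nondegenerate S"
  shows "nondegenerate ((\<lambda>z. a * z + b * cnj z + c) ` S)"
  using nondegenerate_image[OF homeomorphism_affine[OF assms(1)] assms(2)] .

lemma real_modulus_affine_image_le:
  assumes "cmod a \<noteq> cmod b" "nondegenerate S"
  shows "real_modulus S \<le> (cmod a + cmod b) / \<bar>cmod a - cmod b\<bar> * real_modulus ((\<lambda>z. a * z + b * cnj z + c) ` S)"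
proof (rule quasiconformal_real_modulus_le[OF _ quasiconformal_on_affine[OF assms(1)]])
  show "0 < (cmod a + cmod b) / \<bar>cmod a - cmod b\<bar>"
    using assms(1) norm_ge_zero[of a] norm_ge_zero[of b] by (intro divide_pos_pos) linarith+
  show "homeomorphism S ((\<lambda>z. a * z + b * cnj z + c) ` S) (\<lambda>z. a * z + b * cnj z + c)
    (\<lambda>w. (cnj a * (w - c) - b * cnj (w - c)) / (a * cnj a - b * cnj b))"
    by (rule homeomorphism_of_subsets[OF homeomorphism_affine[OF assms(1)]]) auto
qed (use nondegenerate_affine_image[OF assms] assms(2) in auto)

lemma real_modulus_similarity:
  assumes "a \<noteq> 0" "nondegenerate S"
  shows "real_modulus ((\<lambda>z. a * z + c) ` S) = real_modulus S"
proof (rule antisym)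
  have nd: "nondegenerate ((\<lambda>z. a * z + c) ` S)" using nondegenerate_affine_image[of a 0 S c] assms by simp
  have "(\<lambda>z. (1/a) * z + (- c / a)) ` (\<lambda>z. a * z + c) ` S = (\<lambda>z. z) ` S"
    unfolding image_image by (rule image_cong) (use assms in \<open>auto simp: field_simps\<close>)
  then show "real_modulus ((\<lambda>z. a * z + c) ` S) \<le> real_modulus S"
    using real_modulus_affine_image_le[of "1/a" 0 "(\<lambda>z. a * z + c) ` S" "- c / a"] assms nd by simp
  show "real_modulus S \<le> real_modulus ((\<lambda>z. a * z + c) ` S)"
    using real_modulus_affine_image_le[of a 0 S c] assms by simp
qed

lemma real_modulus_cnj_image:
  assumes "nondegenerate S"
  shows "real_modulus (cnj ` S) = real_modulus S"
proof (rule antisym)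
  have nd: "nondegenerate (cnj ` S)" using nondegenerate_affine_image[of 0 1 S 0] assms by simp
  have "cnj ` cnj ` S = S" by (simp add: image_image)
  then show "real_modulus (cnj ` S) \<le> real_modulus S"
    using real_modulus_affine_image_le[of 0 1 "cnj ` S" 0] nd by simp
  show "real_modulus S \<le> real_modulus (cnj ` S)"
    using real_modulus_affine_image_le[of 0 1 S 0] assms by simp
qed

text \<open>A similarity does not change the modulus and normalises a to 1 and c to 0. An
  orientation-reversing map is first followed by conjugation.\<close>

lemma beltrami_normal_form:
  assumes nd: "nondegenerate S" and lt: "conformal_modulus S < affine_modulus S"
  obtains \<mu> where "cmod \<mu> < 1" "real_modulus S < real_modulus ((\<lambda>z. z + \<mu> * cnj z) ` S)"
proof -
  note goal = that
  have key: thesis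
    if ab: "cmod b < cmod a" and m: "real_modulus S < real_modulus ((\<lambda>z. a * z + b * cnj z + c) ` S)" for a b c
  proof (rule goal[of "b / a"])
    have a0: "a \<noteq> 0" using ab by auto
    show \<mu>: "cmod (b / a) < 1" using ab by (simp add: norm_divide divide_less_eq a0)
    have nd': "nondegenerate ((\<lambda>z. z + b / a * cnj z) ` S)"
      using nondegenerate_affine_image[of 1 "b / a" S 0] nd \<mu> by simp
    have "(\<lambda>z. a * z + b * cnj z + c) ` S = (\<lambda>w. a * w + c) ` (\<lambda>z. z + b / a * cnj z) ` S"
      unfolding image_image by (rule image_cong) (use a0 in \<open>auto simp: field_simps\<close>)
    then show "real_modulus S < real_modulus ((\<lambda>z. z + b / a * cnj z) ` S)"
      using real_modulus_similarity[OF a0 nd', of c] m by simp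
  qed
  obtain \<phi> where "affine_transformation \<phi>" and lt\<phi>: "conformal_modulus S < conformal_modulus (\<phi> ` S)"
    using lt unfolding affine_modulus_def less_SUP_iff by auto
  then obtain a b c where ab: "(cmod a)\<^sup>2 - (cmod b)\<^sup>2 \<noteq> 0" and \<phi>: "\<phi> = (\<lambda>z. a * z + b * cnj z + c)"
    by (auto simp: affine_transformation_def)
  have ne: "cmod a \<noteq> cmod b" using ab by auto
  have nd\<phi>: "nondegenerate (\<phi> ` S)" unfolding \<phi> by (rule nondegenerate_affine_image[OF ne nd])
  have m: "real_modulus S < real_modulus (\<phi> ` S)"
    using lt\<phi> nondegenerate_real_modulus[OF nd] nondegenerate_real_modulus[OF nd\<phi>] by (metis less_ereal.simps(1))
  show thesis
  proof (cases "cmod b < cmod a")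
    case True
    then show ?thesis using key[of b a c] m \<phi> by simp
  next
    case False
    then have lt: "cmod (cnj a) < cmod (cnj b)" using ne by simp
    have "cnj ` \<phi> ` S = (\<lambda>z. cnj b * z + cnj a * cnj z + cnj c) ` S"
      unfolding image_image \<phi> by (rule image_cong) auto
    then show ?thesis using key[OF lt, of "cnj c"] m real_modulus_cnj_image[OF nd\<phi>] by simp
  qed
qed

lemma harmonic_homeomorphism_of_affine_modulus:
  assumes nd: "nondegenerate \<Omega>'" and lt: "conformal_modulus \<Omega>' < affine_modulus \<Omega>'"
  shows "\<exists>\<epsilon>::real. 0 < \<epsilon> \<and>
           (\<forall>\<Omega> :: complex set.
              doubly_connected \<Omega> \<longrightarrow>
              conformal_modulus \<Omega>' < conformal_modulus \<Omega> \<longrightarrow>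
              conformal_modulus \<Omega> < conformal_modulus \<Omega>' + ereal \<epsilon> \<longrightarrow>
              (\<exists>h. harmonic_homeomorphism \<Omega> \<Omega>' h))"
proof -
  obtain \<mu> where \<mu>: "cmod \<mu> < 1" and m1: "real_modulus \<Omega>' < real_modulus ((\<lambda>z. z + \<mu> * cnj z) ` \<Omega>')"
    using beltrami_normal_form[OF nd lt] .
  define m where "m = (cmod \<mu>)\<^sup>2"
  have m: "0 \<le> m" "m < 1" using \<mu> by (auto simp: m_def power_less_one_iff)
  have \<mu>m: "\<mu> * cnj \<mu> = of_real m" unfolding m_def complex_norm_square ..
  define \<phi> where "\<phi> = (\<lambda>x z. z + of_real x * \<mu> * cnj z)"
  define U where "U = (\<lambda>x. \<phi> x ` \<Omega>')"
  define e where "e = (\<lambda>x::real. 1 - x\<^sup>2 * m)"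
  have e: "1 - m \<le> e x" "0 < e x" if "x \<in> {0..1}" for x
  proof -
    have "x\<^sup>2 * m \<le> 1 * m" using that m by (intro mult_right_mono) (auto simp: power_le_one)
    then show "1 - m \<le> e x" "0 < e x" using m by (auto simp: e_def)
  qed
  \<comment> \<open>The explicit form of \<phi>_y o \<phi>_x^(-1), in which \<open>e x\<close> is
    the determinant of \<phi>_x.\<close>
  define F where "F = (\<lambda>x y w. of_real ((1 - x * y * m) / e x) * w + of_real ((y - x) / e x) * \<mu> * cnj w)"
  have F\<phi>: "F x y (\<phi> x z) = \<phi> y z" if "x \<in> {0..1}" for x y z
  proof -
    have e0: "complex_of_real (e x) \<noteq> 0" using e[OF that] by simp
    have "of_real (e x) * F x y (\<phi> x z) = (1 - of_real x * of_real y * of_real m) * \<phi> x z + (of_real y - of_real x) * \<mu> * cnj (\<phi> x z)"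
      unfolding F_def using e0 by (simp add: distrib_left)
    also have "\<dots> = of_real (e x) * \<phi> y z"
      unfolding \<phi>_def e_def of_real_diff of_real_mult of_real_power of_real_1 \<mu>m[symmetric] by (simp add: algebra_simps power2_eq_square)
    finally show ?thesis using e0 by simp
  qed
  \<comment> \<open>The constant comes from (A + B) / (A - B) with A at least 1 - m and B at most |x
    - y|.\<close>
  have C0: "0 \<le> 2 / (1 - m)" using m by simp
  show ?thesis
  proof (rule harmonic_homeomorphism_of_family[OF nd _ C0, of U])
    have "U 0 = \<Omega>'" by (simp add: U_def \<phi>_def)
    then show "real_modulus (U 0) \<le> real_modulus \<Omega>'" by simp
    have "U 1 = (\<lambda>z. z + \<mu> * cnj z) ` \<Omega>'" by (simp add: U_def \<phi>_def)
    then show "real_modulus \<Omega>' < real_modulus (U 1)" using m1 by simp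
  next
    fix x :: real assume x: "x \<in> {0..1}"
    have "cmod (of_real x * \<mu>) < 1"
    proof -
      have "cmod (of_real x * \<mu>) \<le> 1 * cmod \<mu>" unfolding norm_mult using x by (intro mult_right_mono) auto
      then show ?thesis using \<mu> by simp
    qed
    then show "nondegenerate (U x)"
      using nondegenerate_affine_image[of 1 "of_real x * \<mu>" \<Omega>' 0] nd by (simp add: U_def \<phi>_def)
    have e0: "complex_of_real (e x) \<noteq> 0" using e[OF x] by simp
    \<comment> \<open>\<open>F x 0\<close> inverts \<phi>_x, and as a real-affine map it is visibly
      a holomorphic plus an antiholomorphic term.\<close>
    have F0: "F x 0 w = w / of_real (e x) + cnj (- of_real x * cnj \<mu> * w / of_real (e x))" for w
      by (simp add: F_def)
    have "bij_betw (F x 0) (U x) \<Omega>'"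
    proof (rule bij_betwI[of _ _ _ "\<phi> x"])
      have "\<phi> 0 z = z" for z by (simp add: \<phi>_def)
      then have F0\<phi>: "F x 0 (\<phi> x z) = z" for z using F\<phi>[OF x, of 0 z] by simp
      then show "F x 0 \<in> U x \<rightarrow> \<Omega>'" "\<And>w. w \<in> U x \<Longrightarrow> \<phi> x (F x 0 w) = w" "\<And>z. z \<in> \<Omega>' \<Longrightarrow> F x 0 (\<phi> x z) = z"
        by (auto simp: U_def)
    qed (auto simp: U_def)
    then have "bij_betw (\<lambda>w. w / of_real (e x) + cnj (- of_real x * cnj \<mu> * w / of_real (e x))) (U x) \<Omega>'"
      unfolding F0[symmetric] by simp
    then show "\<exists>P Q. P holomorphic_on U x \<and> Q holomorphic_on U x \<and> bij_betw (\<lambda>z. P z + cnj (Q z)) (U x) \<Omega>'"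
      by (intro exI[of _ "\<lambda>w. w / of_real (e x)"] exI[of _ "\<lambda>w. - of_real x * cnj \<mu> * w / of_real (e x)"])
        (use e0 in \<open>auto intro!: holomorphic_intros\<close>)
  next
    fix x y :: real assume x: "x \<in> {0..1}" and y: "y \<in> {0..1}" and C: "2 / (1 - m) * \<bar>x - y\<bar> < 1"
    define A where "A = 1 - x * y * m"
    have A: "1 - m \<le> A"
    proof -
      have "x * y * m \<le> 1 * m" using x y m by (intro mult_right_mono mult_le_one) auto
      then show ?thesis by (simp add: A_def)
    qed
    define d where "d = \<bar>x - y\<bar>"
    have dC: "2 * d < 1 - m" using C m by (simp add: d_def field_simps)
    have d0: "0 \<le> d" by (simp add: d_def)
    define B where "B = d * cmod \<mu>"
    have B: "0 \<le> B" "B \<le> d" using \<mu> d0 by (auto simp: B_def mult_left_le)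
    define a where "a = complex_of_real (A / e x)"
    define b where "b = of_real ((y - x) / e x) * \<mu>"
    have na: "cmod a = A / e x"
      using e(2)[OF x] A m unfolding a_def norm_of_real by (simp add: abs_of_nonneg)
    have nb: "cmod b = B / e x"
      using e(2)[OF x] unfolding b_def norm_mult norm_of_real by (simp add: B_def d_def abs_minus_commute)
    have BA: "B < A" using B dC A d0 m by linarith
    have less: "cmod b < cmod a" unfolding na nb using BA e[OF x] by (simp add: divide_strict_right_mono)
    have K: "(cmod a + cmod b) / \<bar>cmod a - cmod b\<bar> \<le> 1 / (1 - 2 / (1 - m) * \<bar>x - y\<bar>)"
    proof -
      have "(cmod a + cmod b) / \<bar>cmod a - cmod b\<bar> = (A + B) / (A - B)"
      proof -
        have "cmod a + cmod b = (A + B) / e x" "\<bar>cmod a - cmod b\<bar> = (A - B) / e x"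
          using less unfolding na nb by (simp_all add: add_divide_distrib diff_divide_distrib)
        then show ?thesis using e[OF x] by simp
      qed
      also have "\<dots> \<le> (1 - m) / (1 - m - 2 * d)"
      proof -
        have "(A + B) * (1 - m - 2 * d) \<le> (1 - m) * (A - B)"
        proof -
          have "(1 - m) * B \<le> A * d" using A B m d0 by (intro mult_mono) auto
          moreover have "0 \<le> B * d" using B d0 by simp
          ultimately show ?thesis by (simp add: algebra_simps)
        qed
        then show ?thesis using BA dC by (simp add: divide_le_eq pos_le_divide_eq mult.commute)
      qed
      also have "\<dots> = 1 / (1 - 2 / (1 - m) * \<bar>x - y\<bar>)"
      proof -
        have "1 - 2 / (1 - m) * \<bar>x - y\<bar> = (1 - m - 2 * d) / (1 - m)" using m by (simp add: d_def field_simps)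
        then show ?thesis by simp
      qed
      finally show ?thesis .
    qed
    have "quasiconformal_on (1 / (1 - 2 / (1 - m) * \<bar>x - y\<bar>)) (U x) (\<lambda>z. a * z + b * cnj z + 0) (\<lambda>z v. a * v + b * cnj v)"
      using less by (intro quasiconformal_on_mono[OF quasiconformal_on_affine K]) auto
    moreover have "(\<lambda>z. a * z + b * cnj z + 0) = F x y" by (simp add: F_def a_def b_def A_def fun_eq_iff)
    moreover have "homeomorphism (U x) (U y) (F x y) (F y x)"
    proof (rule homeomorphismI)
      show "continuous_on (U x) (F x y)" "continuous_on (U y) (F y x)"
        unfolding F_def by (intro continuous_intros)+
    qed (use F\<phi> x y in \<open>auto simp: U_def\<close>)
    ultimately show "\<exists>F D G. quasiconformal_on (1 / (1 - 2 / (1 - m) * \<bar>x - y\<bar>)) (U x) F D \<and> homeomorphism (U x) (U y) F G"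
      by auto
  qed
qed

section \<open>Slit domains\<close>

text \<open>The flag \<open>b\<close> tells whether the left slit is present; without it, \<open>s\<close> is irrelevant. Up to a
  similarity, this covers both kinds of Teichmueller rings.\<close>

definition slit_domain :: "bool \<Rightarrow> real \<Rightarrow> real \<Rightarrow> complex set" where
  "slit_domain b s t = - (complex_of_real ` ({-1..1} \<union> (if b then {..-s} else {}) \<union> {t..}))"

lemma mem_slit_domain:
  "z \<in> slit_domain b s t \<longleftrightarrow> Im z \<noteq> 0 \<or> (1 < \<bar>Re z\<bar> \<and> Re z < t \<and> (b \<longrightarrow> - s < Re z))"
proof (cases "Im z = 0")
  case True
  then have "z = of_real (Re z)" by (simp add: complex_eq_iff)
  then have "z \<in> complex_of_real ` X \<longleftrightarrow> Re z \<in> X" for X by (metis Re_complex_of_real image_iff)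
  then show ?thesis using True by (auto simp: slit_domain_def abs_if not_le)
next
  case False
  then show ?thesis by (auto simp: slit_domain_def)
qed

section \<open>Horizontal stretches between slit domains\<close>

lemma surj_of_linear_growth:
  fixes f :: "real \<Rightarrow> real"
  assumes cont: "continuous_on UNIV f" and e: "0 < e"
    and up: "\<And>x. B \<le> x \<Longrightarrow> e * x - C \<le> f x" and low: "\<And>x. x \<le> - B \<Longrightarrow> f x \<le> e * x + C"
  shows "\<exists>x. f x = y"
proof -
  define M where "M = max \<bar>B\<bar> ((\<bar>y\<bar> + \<bar>C\<bar>) / e)"
  have M: "B \<le> M" "- M \<le> - B" "0 \<le> M" by (auto simp: M_def)
  have "(\<bar>y\<bar> + \<bar>C\<bar>) / e \<le> M" by (simp add: M_def)
  then have eM: "\<bar>y\<bar> + \<bar>C\<bar> \<le> e * M" using e by (simp add: pos_divide_le_eq mult.commute)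
  have "y \<le> f M" using up[OF M(1)] eM by linarith
  moreover have "f (- M) \<le> y" using low[OF M(2)] eM by simp
  ultimately show ?thesis
    using IVT'[of f "-M" y M] M continuous_on_subset[OF cont] by auto
qed

text \<open>Beyond 1 this is (x - 1)^2 / x: a double zero at 1 makes it \<open>C1\<close>, and
  linear growth keeps its derivative below 1.\<close>

definition ramp :: "real \<Rightarrow> real" where "ramp x = max 1 x - 2 + 1 / max 1 x"

definition ramp' :: "real \<Rightarrow> real" where "ramp' x = 1 - 1 / (max 1 x)\<^sup>2"

lemma ramp_eq: "x \<le> 1 \<Longrightarrow> ramp x = 0" "1 \<le> x \<Longrightarrow> ramp x = (x - 1)\<^sup>2 / x"
  by (auto simp: ramp_def max_def power2_eq_square field_simps)

lemma ramp'_bounds: "0 \<le> ramp' x" "ramp' x < 1" "x \<le> 1 \<Longrightarrow> ramp' x = 0"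
  by (auto simp: ramp'_def divide_le_eq max_def one_le_power)

lemma ramp_bounds: "0 \<le> ramp x" "1 \<le> x \<Longrightarrow> ramp x \<le> x"
proof -
  show "0 \<le> ramp x" by (cases "x \<le> 1") (auto simp: ramp_eq)
  show "ramp x \<le> x" if "1 \<le> x" using that by (simp add: ramp_def max_def divide_le_eq)
qed

lemma has_derivative_ramp: "(ramp has_real_derivative ramp' x) (at x)"
proof -
  consider "x < 1" | "x = 1" | "1 < x" by linarith
  then show ?thesis
  proof cases
    case 1
    have "((\<lambda>x. 0) has_real_derivative 0) (at x)" by simp
    then have "(ramp has_real_derivative 0) (at x)"
      by (rule has_field_derivative_transform_within_open[of _ _ _ "{..<1}"]) (use 1 in \<open>auto simp: ramp_eq\<close>)
    then show ?thesis using 1 by (simp add: ramp'_bounds)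
  next
    case 2
    \<comment> \<open>At the joint both sides have slope 0, since the difference quotient is at most
      |h| in absolute value.\<close>
    have "((\<lambda>h. (ramp (1 + h) - ramp 1) / h) \<longlongrightarrow> 0) (at 0)"
    proof (rule tendsto_rabs_zero_cancel, rule tendsto_sandwich)
      show "((\<lambda>h::real. 0::real) \<longlongrightarrow> 0) (at 0)" "((\<lambda>h::real. \<bar>h\<bar>) \<longlongrightarrow> 0) (at 0)"
        by (auto intro!: tendsto_eq_intros)
      have "\<bar>(ramp (1 + h) - ramp 1) / h\<bar> \<le> \<bar>h\<bar>" for h
      proof (cases "0 < h")
        case True
        then have "(ramp (1 + h) - ramp 1) / h = h / (1 + h)"
          by (simp add: ramp_eq power2_eq_square)
        then show ?thesis using True by (simp add: divide_le_eq)
      next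
        case False
        then show ?thesis by (simp add: ramp_eq)
      qed
      then show "\<forall>\<^sub>F h in at 0. \<bar>(ramp (1 + h) - ramp 1) / h\<bar> \<le> \<bar>h\<bar>" by simp
    qed simp
    then show ?thesis using 2 by (simp add: DERIV_def ramp'_def)
  next
    case 3
    have "((\<lambda>x. x - 2 + 1 / x) has_real_derivative ramp' x) (at x)"
      using 3 by (auto intro!: derivative_eq_intros simp: ramp'_def max_def power2_eq_square)
    then show ?thesis
      by (rule has_field_derivative_transform_within_open[of _ _ _ "{1<..}"]) (use 3 in \<open>auto simp: ramp_def max_def\<close>)
  qed
qed

lemma continuous_on_ramp': "continuous_on S ramp'"
  unfolding ramp'_def by (intro continuous_intros) (auto simp: max_def)

text \<open>The two rays get independent coefficients while [-1, 1] stays fixed. At each point at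
  most one ramp is active, so bounds on \<open>a\<close> and \<open>c\<close> do not add up.\<close>

definition stretch :: "real \<Rightarrow> real \<Rightarrow> real \<Rightarrow> real" where
  "stretch a c x = x + a * ramp x - c * ramp (- x)"

definition stretch' :: "real \<Rightarrow> real \<Rightarrow> real \<Rightarrow> real" where
  "stretch' a c x = 1 + a * ramp' x + c * ramp' (- x)"

lemma has_derivative_stretch: "(stretch a c has_real_derivative stretch' a c x) (at x)"
proof -
  have m: "((\<lambda>x::real. - x) has_real_derivative -1) (at x)"
    by (auto intro!: derivative_eq_intros)
  from DERIV_chain2[OF has_derivative_ramp m]
  have "((\<lambda>x. ramp (- x)) has_real_derivative - ramp' (- x)) (at x)" by simp
  then show ?thesis unfolding stretch_def stretch'_def
    by (auto intro!: derivative_eq_intros has_derivative_ramp)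
qed

lemma stretch'_bound:
  assumes "\<bar>a\<bar> \<le> d" "\<bar>c\<bar> \<le> d"
  shows "\<bar>stretch' a c x - 1\<bar> \<le> d"
proof (cases "x \<le> 1")
  case True
  have "\<bar>c * ramp' (- x)\<bar> \<le> d * 1"
    unfolding abs_mult using assms ramp'_bounds[of "-x"] by (intro mult_mono) auto
  then show ?thesis using True by (simp add: stretch'_def ramp'_bounds)
next
  case False
  have "\<bar>a * ramp' x\<bar> \<le> d * 1"
    unfolding abs_mult using assms ramp'_bounds[of x] by (intro mult_mono) auto
  then show ?thesis using False by (simp add: stretch'_def ramp'_bounds)
qed

lemma stretch'_pos:
  assumes "-1 < a" "-1 < c"
  shows "0 < stretch' a c x"
proof -
  have *: "-1 < a * r" if "-1 < a" "0 \<le> r" "r < 1" for a r :: real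
  proof (cases "0 \<le> a")
    case False
    then have "a * 1 \<le> a * r" using that by (intro mult_left_mono_neg) auto
    then show ?thesis using that by simp
  qed (use that in \<open>smt (verit) mult_nonneg_nonneg\<close>)
  show ?thesis
    using *[OF assms(1), of "ramp' x"] *[OF assms(2), of "ramp' (- x)"] ramp'_bounds[of x] ramp'_bounds[of "-x"]
    by (cases "x \<le> 1") (auto simp: stretch'_def)
qed

lemma stretch_strict_mono:
  assumes "-1 < a" "-1 < c"
  shows "strict_mono (stretch a c)"
  using DERIV_pos_imp_increasing[of _ _ "stretch a c"] has_derivative_stretch stretch'_pos[OF assms]
  by (metis strict_monoI)

lemma stretch_id: "-1 \<le> x \<Longrightarrow> x \<le> 1 \<Longrightarrow> stretch a c x = x"
  by (simp add: stretch_def ramp_eq)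

lemma stretch_surj:
  assumes "-1 < a" "-1 < c"
  shows "\<exists>x. stretch a c x = y"
proof -
  \<comment> \<open>A lower bound for the linear growth rate on both rays; the cap at 1 makes
    \<open>e - 1\<close> nonpositive, as the estimate below needs.\<close>
  define e where "e = min 1 (min (1 + a) (1 + c))"
  have e: "0 < e" "e \<le> 1" "e - 1 \<le> a" "e - 1 \<le> c" using assms by (auto simp: e_def)
  have *: "(e - 1) * x \<le> a * ramp x" if "1 \<le> x" "e - 1 \<le> a" for a x :: real
  proof -
    have "(e - 1) * x \<le> (e - 1) * ramp x" using ramp_bounds[of x] that e by (intro mult_left_mono_neg) auto
    also have "\<dots> \<le> a * ramp x" using ramp_bounds[of x] that by (intro mult_right_mono) auto
    finally show ?thesis .
  qed
  show ?thesis
  proof (rule surj_of_linear_growth[of _ e 1 0])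
    show "continuous_on UNIV (stretch a c)"
      using has_derivative_stretch by (meson DERIV_continuous_on has_field_derivative_at_within)
    show "e * x - 0 \<le> stretch a c x" if "1 \<le> x" for x
      using *[OF that e(3)] that by (simp add: stretch_def ramp_eq algebra_simps)
    show "stretch a c x \<le> e * x + 0" if "x \<le> -1" for x
      using *[of "-x" c] e that by (simp add: stretch_def ramp_eq algebra_simps)
  qed (rule e)
qed

definition stretch_map :: "real \<Rightarrow> real \<Rightarrow> complex \<Rightarrow> complex" where
  "stretch_map a c z = Complex (stretch a c (Re z)) (Im z)"

lemma stretch_map_homeomorphism:
  assumes "-1 < a" "-1 < c"
  obtains G where "homeomorphism UNIV UNIV (stretch_map a c) G"
proof -
  have cont: "continuous_on UNIV (stretch a c)"
    using has_derivative_stretch by (meson DERIV_continuous_on has_field_derivative_at_within)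
  have "continuous_on UNIV (stretch_map a c)" unfolding stretch_map_def
    by (intro continuous_intros continuous_on_compose2[OF cont]) auto
  moreover have "inj (stretch_map a c)"
    using strict_mono_eq[OF stretch_strict_mono[OF assms]]
    by (auto simp: inj_def stretch_map_def complex_eq_iff)
  moreover have "range (stretch_map a c) = UNIV"
  proof -
    have "\<exists>z. stretch_map a c z = w" for w
    proof -
      obtain x where "stretch a c x = Re w" using stretch_surj[OF assms] by blast
      then show ?thesis by (intro exI[of _ "Complex x (Im w)"]) (simp add: stretch_map_def)
    qed
    then show ?thesis by (metis surjI surj_def)
  qed
  ultimately show thesis
    using invariance_of_domain_homeomorphism[of UNIV "stretch_map a c"] that by (metis open_UNIV order_refl)
qed

text \<open>The differential is diagonal with entries f and 1, where 1 - d \<le> f \<le> 1 + d. Both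
  f and 1/f are then at most 1 / (1 - d).\<close>

lemma stretch_map_quasiconformal:
  assumes d: "d < 1" and ac: "\<bar>a\<bar> \<le> d" "\<bar>c\<bar> \<le> d"
  shows "quasiconformal_on (1 / (1 - d)) S (stretch_map a c) (\<lambda>z v. Complex (stretch' a c (Re z) * Re v) (Im v))"
  unfolding quasiconformal_on_def
proof (intro conjI ballI allI)
  fix z v
  let ?f = "stretch' a c (Re z)"
  have "((\<lambda>z. stretch a c (Re z)) has_derivative (\<lambda>v. ?f * Re v)) (at z)"
    using has_derivative_compose[OF has_derivative_Re[OF has_derivative_ident]
        has_derivative_stretch[unfolded has_field_derivative_def]] by simp
  then have "((\<lambda>z. of_real (stretch a c (Re z)) + \<i> * of_real (Im z)) has_derivative (\<lambda>v. of_real (?f * Re v) + \<i> * of_real (Im v))) (at z)"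
    by (intro has_derivative_add has_derivative_mult_right has_derivative_of_real has_derivative_Im has_derivative_ident)
  then show "(stretch_map a c has_derivative (\<lambda>v. Complex (?f * Re v) (Im v))) (at z)"
    by (simp add: stretch_map_def[abs_def] Complex_eq)
  have f: "1 - d \<le> ?f" "?f \<le> 1 + d" "0 < ?f" using stretch'_bound[OF ac, of "Re z"] d by linarith+
  have j: "\<bar>jac (\<lambda>v. Complex (?f * Re v) (Im v))\<bar> = ?f" using f by (simp add: jac_def)
  have d0: "0 \<le> d" using ac by linarith
  have K1: "1 \<le> 1 / (1 - d) * ?f" using f d by (simp add: field_simps)
  have K2: "?f \<le> 1 / (1 - d)"
  proof -
    have "(1 + d) * (1 - d) \<le> 1" by (simp add: algebra_simps)
    then have "1 + d \<le> 1 / (1 - d)" using d by (simp add: pos_le_divide_eq)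
    then show ?thesis using f by linarith
  qed
  have "(cmod (Complex (?f * Re v) (Im v)))\<^sup>2 = ?f * ?f * (Re v)\<^sup>2 + 1 * (Im v)\<^sup>2"
    unfolding cmod_power2 by (simp add: power2_eq_square)
  also have "\<dots> \<le> (1 / (1 - d) * ?f) * (Re v)\<^sup>2 + (1 / (1 - d) * ?f) * (Im v)\<^sup>2"
    using K1 K2 f by (intro add_mono mult_right_mono) auto
  also have "\<dots> = 1 / (1 - d) * ?f * (cmod v)\<^sup>2" unfolding cmod_power2 by (simp only: distrib_left)
  finally show "(cmod (Complex (?f * Re v) (Im v)))\<^sup>2 \<le> 1 / (1 - d) * \<bar>jac (\<lambda>v. Complex (?f * Re v) (Im v))\<bar> * (cmod v)\<^sup>2"
    unfolding j .
next
  fix v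
  have "continuous_on UNIV (\<lambda>x. ramp' (- x))"
    by (rule continuous_on_compose2[OF continuous_on_ramp'[of UNIV]]) (auto intro: continuous_intros)
  then have "continuous_on UNIV (stretch' a c)" unfolding stretch'_def
    by (intro continuous_intros continuous_on_ramp')
  then have "continuous_on S (\<lambda>z. stretch' a c (Re z))"
    by (rule continuous_on_compose2) (auto intro: continuous_intros)
  then show "continuous_on S (\<lambda>z. Complex (stretch' a c (Re z) * Re v) (Im v))"
    by (intro continuous_intros)
qed

text \<open>The solution a of \<open>t + a * ramp t = u\<close>: the coefficient that carries the
  tip t to u.\<close>

definition stretch_coeff :: "real \<Rightarrow> real \<Rightarrow> real" where
  "stretch_coeff t u = (u - t) * t / (t - 1)\<^sup>2"

lemma stretch_coeff_ramp:
  assumes "1 < t" shows "t + stretch_coeff t u * ramp t = u"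
  using assms by (simp add: stretch_coeff_def ramp_eq)

lemma stretch_coeff_nonneg: "1 < t \<Longrightarrow> t \<le> u \<Longrightarrow> 0 \<le> stretch_coeff t u"
  by (simp add: stretch_coeff_def)

text \<open>The factor t / (t - 1)^2 decreases for t > 1, so its value at t0 serves all tips beyond
  t0.\<close>

lemma stretch_coeff_abs_le:
  assumes "1 < t0" "t0 \<le> t"
  shows "\<bar>stretch_coeff t u\<bar> \<le> \<bar>u - t\<bar> * (t0 / (t0 - 1)\<^sup>2)"
proof -
  have "t / (t - 1) \<le> t0 / (t0 - 1)" using assms by (simp add: field_simps)
  moreover have "1 / (t - 1) \<le> 1 / (t0 - 1)" using assms by (simp add: frac_le)
  ultimately have "t / (t - 1) * (1 / (t - 1)) \<le> t0 / (t0 - 1) * (1 / (t0 - 1))"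
    using assms by (intro mult_mono) auto
  then have "t / (t - 1)\<^sup>2 \<le> t0 / (t0 - 1)\<^sup>2" by (simp add: power2_eq_square)
  then have "\<bar>u - t\<bar> * (t / (t - 1)\<^sup>2) \<le> \<bar>u - t\<bar> * (t0 / (t0 - 1)\<^sup>2)" by (intro mult_left_mono) auto
  then show ?thesis using assms by (simp add: stretch_coeff_def abs_mult)
qed

lemma stretch_map_slit_domain:
  assumes st: "1 < s" "1 < t" "1 < s'" "1 < t'"
    and ac: "-1 < stretch_coeff t t'" "-1 < stretch_coeff s s'"
  defines "\<Phi> \<equiv> stretch_map (stretch_coeff t t') (stretch_coeff s s')"
  shows "\<Phi> ` slit_domain b s t = slit_domain b s' t'"
proof -
  let ?f = "stretch (stretch_coeff t t') (stretch_coeff s s')"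
  note mono = strict_mono_less[OF stretch_strict_mono[OF ac]]
  have vals: "?f 1 = 1" "?f (-1) = -1" "?f t = t'" "?f (- s) = - s'"
    using st stretch_coeff_ramp[OF st(2), of t'] stretch_coeff_ramp[OF st(1), of s']
    by (simp_all add: stretch_id) (simp_all add: stretch_def ramp_eq)
  have iff: "1 < ?f x \<longleftrightarrow> 1 < x" "?f x < -1 \<longleftrightarrow> x < -1" "?f x < t' \<longleftrightarrow> x < t" "- s' < ?f x \<longleftrightarrow> - s < x" for x
    using mono[of 1 x] mono[of x "-1"] mono[of x t] mono[of "-s" x] vals by simp_all
  have mem: "\<Phi> z \<in> slit_domain b s' t' \<longleftrightarrow> z \<in> slit_domain b s t" for z
  proof -
    have "1 < \<bar>?f x\<bar> \<longleftrightarrow> 1 < \<bar>x\<bar>" for x using iff(1,2)[of x] by linarith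
    then show ?thesis by (simp add: mem_slit_domain \<Phi>_def stretch_map_def iff)
  qed
  obtain G where "homeomorphism UNIV UNIV \<Phi> G"
    using stretch_map_homeomorphism[OF ac] unfolding \<Phi>_def by blast
  then have "\<exists>z. \<Phi> z = w" for w by (metis UNIV_I homeomorphism_def)
  then show ?thesis using mem by (auto simp: image_iff) metis
qed

section \<open>The inverse Joukowski map and the harmonic shear\<close>

text \<open>A branch of \<open>sqrt (z\<^sup>2 - 1)\<close> that is holomorphic off the segment \<open>[-1, 1]\<close>.\<close>

definition slit_sqrt :: "complex \<Rightarrow> complex" where
  "slit_sqrt z = z * csqrt (1 - 1 / z\<^sup>2)"

definition joukowski_inverse :: "complex \<Rightarrow> complex" where
  "joukowski_inverse z = z - slit_sqrt z"

text \<open>Chosen as a primitive of \<open>-J\<^sup>2\<close> for the inverse Joukowski map \<open>J\<close>, so that its derivative is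
  bounded up to the tips of the segment.\<close>

definition shear_potential :: "complex \<Rightarrow> complex" where
  "shear_potential z = (joukowski_inverse z - (joukowski_inverse z) ^ 3 / 3) / 2"

definition slit_plane :: "complex set" where
  "slit_plane = - (complex_of_real ` {-1..1})"

lemma mem_slit_plane: "z \<in> slit_plane \<longleftrightarrow> Im z \<noteq> 0 \<or> 1 < \<bar>Re z\<bar>"
proof (cases "Im z = 0")
  case True
  then have "z = of_real (Re z)" by (simp add: complex_eq_iff)
  then have "z \<in> complex_of_real ` {-1..1} \<longleftrightarrow> Re z \<in> {-1..1}" by (metis Re_complex_of_real image_iff)
  then show ?thesis using True by (auto simp: slit_plane_def)
qed (auto simp: slit_plane_def)

lemma open_slit_plane: "open slit_plane"
  unfolding slit_plane_def
  by (intro open_Compl compact_imp_closed compact_continuous_image continuous_intros) simp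

text \<open>If 1 - 1/z^2 is a nonpositive real, then z^2 lies in (0, 1], which puts z on the removed
  segment; so \<open>csqrt\<close> is never evaluated on its cut.\<close>

lemma slit_plane_sqrt_arg:
  assumes "z \<in> slit_plane"
  shows "z \<noteq> 0" "1 - 1 / z\<^sup>2 \<notin> \<real>\<^sub>\<le>\<^sub>0"
proof -
  show z0: "z \<noteq> 0" using assms by (auto simp: mem_slit_plane)
  show "1 - 1 / z\<^sup>2 \<notin> \<real>\<^sub>\<le>\<^sub>0"
  proof
    assume "1 - 1 / z\<^sup>2 \<in> \<real>\<^sub>\<le>\<^sub>0"
    then obtain r where r: "1 - 1 / z\<^sup>2 = of_real r" "r \<le> 0" by (auto elim: nonpos_Reals_cases)
    define u where "u = 1 / (1 - r)"
    have u: "0 < u" "u \<le> 1" using r(2) by (auto simp: u_def divide_le_eq)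
    have "1 / z\<^sup>2 = of_real (1 - r)" using r(1) by (simp add: algebra_simps)
    then have "z\<^sup>2 = of_real u" using z0 r(2) by (simp add: u_def field_simps)
    then have "Re (z\<^sup>2) = u" "Im (z\<^sup>2) = 0" by simp_all
    then have 1: "(Re z)\<^sup>2 - (Im z)\<^sup>2 = u" "Re z * Im z = 0" by (auto simp: power2_eq_square)
    have "Re z \<noteq> 0"
    proof
      assume "Re z = 0"
      then show False using 1(1) u zero_le_power2[of "Im z"] by simp
    qed
    then have "Im z = 0" using 1(2) by simp
    then have "(Re z)\<^sup>2 \<le> 1" using 1 u by simp
    then have "\<bar>Re z\<bar> \<le> 1" by (simp add: abs_square_le_1)
    then show False using assms \<open>Im z = 0\<close> by (simp add: mem_slit_plane)
  qed
qed

lemma slit_sqrt_square: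
  assumes "z \<in> slit_plane"
  shows "slit_sqrt z * slit_sqrt z = z * z - 1"
proof -
  have "slit_sqrt z * slit_sqrt z = z\<^sup>2 * (csqrt (1 - 1 / z\<^sup>2))\<^sup>2"
    by (simp add: slit_sqrt_def power2_eq_square mult_ac)
  also have "\<dots> = z * z - 1"
    unfolding power2_csqrt using slit_plane_sqrt_arg(1)[OF assms]
    by (simp add: power2_eq_square right_diff_distrib)
  finally show ?thesis .
qed

lemma joukowski_inverse_mult:
  assumes "z \<in> slit_plane"
  shows "joukowski_inverse z * (z + slit_sqrt z) = 1"
  using slit_sqrt_square[OF assms] by (simp add: joukowski_inverse_def algebra_simps)

text \<open>J and 1/J are z (1 - w) and z (1 + w) for the root w, and Re w > 0 makes the first one
  smaller.\<close>

lemma joukowski_inverse_norm_less_1: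
  assumes "z \<in> slit_plane"
  shows "cmod (joukowski_inverse z) < 1"
proof -
  define w where "w = csqrt (1 - 1 / z\<^sup>2)"
  have "0 < Re w"
  proof (rule ccontr)
    assume "\<not> 0 < Re w"
    then have "Re w = 0" using csqrt_principal[of "1 - 1 / z\<^sup>2"] by (auto simp: w_def)
    then have "w\<^sup>2 \<in> \<real>\<^sub>\<le>\<^sub>0" by (simp add: complex_nonpos_Reals_iff power2_eq_square)
    moreover have "w\<^sup>2 = 1 - 1 / z\<^sup>2" unfolding w_def by (rule power2_csqrt)
    ultimately have "1 - 1 / z\<^sup>2 \<in> \<real>\<^sub>\<le>\<^sub>0" by simp
    then show False using slit_plane_sqrt_arg(2)[OF assms] by simp
  qed
  then have "(cmod (1 - w))\<^sup>2 < (cmod (1 + w))\<^sup>2"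
    unfolding cmod_power2 by (simp add: power2_eq_square algebra_simps)
  then have lt: "cmod (1 - w) < cmod (1 + w)" by (rule power2_less_imp_less) simp
  define J where "J = joukowski_inverse z"
  have J: "J = z * (1 - w)" by (simp add: J_def joukowski_inverse_def slit_sqrt_def w_def algebra_simps)
  have "z + slit_sqrt z = z * (1 + w)" by (simp add: slit_sqrt_def w_def algebra_simps)
  then have "J * (z * (1 + w)) = 1" using joukowski_inverse_mult[OF assms] by (simp add: J_def)
  then have 1: "cmod J * cmod (z * (1 + w)) = 1" by (metis norm_mult norm_one)
  then have J0: "0 < cmod J" by (metis mult_zero_left norm_ge_zero order_le_less zero_neq_one)
  have "cmod J < cmod (z * (1 + w))"
    unfolding J norm_mult using lt slit_plane_sqrt_arg(1)[OF assms] by simp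
  then have "cmod J * cmod J < cmod J * cmod (z * (1 + w))" using J0 by (rule mult_strict_left_mono)
  then have "(cmod J)\<^sup>2 < 1" using 1 by (simp add: power2_eq_square)
  then show ?thesis unfolding J_def[symmetric] by (simp add: power_less_one_iff)
qed

lemma holomorphic_slit_sqrt: "slit_sqrt holomorphic_on slit_plane"
  unfolding slit_sqrt_def using slit_plane_sqrt_arg by (intro holomorphic_intros) auto

lemma holomorphic_shear_potential: "shear_potential holomorphic_on slit_plane"
  unfolding shear_potential_def joukowski_inverse_def
  by (intro holomorphic_intros holomorphic_slit_sqrt) auto

lemma shear_potential_bound:
  assumes "z \<in> slit_plane"
  shows "cmod (shear_potential z) \<le> 1"
proof -
  define J where "J = joukowski_inverse z"
  have J: "cmod J \<le> 1" using joukowski_inverse_norm_less_1[OF assms] by (simp add: J_def)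
  have "cmod (J - J ^ 3 / 3) \<le> cmod J + cmod (J ^ 3 / 3)" by (rule norm_triangle_ineq4)
  also have "\<dots> \<le> 1 + 1 / 3" using J power_le_one[of "cmod J" 3] by (simp add: norm_divide norm_power)
  finally have "cmod (J - J ^ 3 / 3) \<le> 4 / 3" by simp
  then show ?thesis unfolding shear_potential_def J_def[symmetric] norm_divide by simp
qed

text \<open>With S the root, J' = -J / S and 1 - J^2 = 2 J S. In (J' - J^2 J') / 2 the factor S,
  which vanishes at the tips, cancels.\<close>

lemma has_derivative_shear_potential:
  assumes z: "z \<in> slit_plane"
  shows "(shear_potential has_field_derivative - (joukowski_inverse z)\<^sup>2) (at z)"
proof -
  define S where "S = slit_sqrt z"
  define J where "J = joukowski_inverse z"
  have SS: "S * S = z * z - 1" using slit_sqrt_square[OF z] by (simp add: S_def)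
  have S0: "S \<noteq> 0"
  proof
    assume "S = 0"
    then have "z * z = 1" using SS by simp
    then have "z = 1 \<or> z = -1" by (simp add: square_eq_1_iff)
    then show False using z by (auto simp: mem_slit_plane)
  qed
  obtain S' where S': "(slit_sqrt has_field_derivative S') (at z)"
    using holomorphic_slit_sqrt z open_slit_plane holomorphic_on_imp_differentiable_at field_differentiable_def by blast
  have "((\<lambda>w. slit_sqrt w * slit_sqrt w) has_field_derivative S' * S + S' * S) (at z)"
    using DERIV_mult[OF S' S'] by (simp add: S_def)
  moreover have "((\<lambda>w. slit_sqrt w * slit_sqrt w) has_field_derivative 2 * z) (at z)"
  proof (rule has_field_derivative_transform_within_open[OF _ open_slit_plane z])
    show "((\<lambda>w. w * w - 1) has_field_derivative 2 * z) (at z)" by (auto intro!: derivative_eq_intros)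
  qed (simp add: slit_sqrt_square)
  \<comment> \<open>S' is found by differentiating S^2 = z^2 - 1, which avoids the derivative of
    \<open>csqrt\<close>.\<close>
  ultimately have "S' * S + S' * S = 2 * z" by (rule DERIV_unique)
  then have S'S: "S' = z / S" using S0 by (simp add: field_simps)
  have J': "(joukowski_inverse has_field_derivative 1 - S') (at z)"
    unfolding joukowski_inverse_def[abs_def] by (intro DERIV_diff DERIV_ident S')
  have "(shear_potential has_field_derivative ((1 - S') - (3 * J ^ 2 * (1 - S')) / 3) / 2) (at z)"
    unfolding shear_potential_def[abs_def] J_def by (auto intro!: derivative_eq_intros J')
  moreover have "((1 - S') - (3 * J ^ 2 * (1 - S')) / 3) / 2 = - J\<^sup>2"
  proof -
    have JS: "J = z - S" by (simp add: J_def S_def joukowski_inverse_def)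
    have J1: "J * (z + S) = 1" using joukowski_inverse_mult[OF z] by (simp add: J_def S_def)
    have "1 - J\<^sup>2 = 2 * J * S" using J1 unfolding JS by (simp add: algebra_simps power2_eq_square)
    moreover have "1 - S' = - J / S" using S0 by (simp add: S'S JS field_simps)
    ultimately have "(1 - S') * (1 - J\<^sup>2) = - 2 * J\<^sup>2" using S0 by (simp add: power2_eq_square)
    moreover have "(1 - S') - (3 * J ^ 2 * (1 - S')) / 3 = (1 - S') * (1 - J\<^sup>2)"
      by (simp add: right_diff_distrib mult.commute)
    ultimately show ?thesis by simp
  qed
  ultimately show ?thesis by (simp add: J_def)
qed

lemma has_derivative_shear_row:
  assumes "Complex x y \<in> slit_plane"
  shows "((\<lambda>x. x + c * Re (shear_potential (Complex x y))) has_real_derivative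
           1 - c * Re ((joukowski_inverse (Complex x y))\<^sup>2)) (at x)"
proof -
  have "((\<lambda>x. of_real x + \<i> * of_real y) has_vector_derivative 1) (at x)"
    by (auto intro!: derivative_eq_intros)
  then have "((\<lambda>x. Complex x y) has_vector_derivative 1) (at x)" by (simp add: Complex_eq)
  from field_vector_diff_chain_at[OF this has_derivative_shear_potential[OF assms]]
  have "((\<lambda>x. shear_potential (Complex x y)) has_vector_derivative - (joukowski_inverse (Complex x y))\<^sup>2) (at x)"
    by (simp add: o_def)
  then have "((\<lambda>x. Re (shear_potential (Complex x y))) has_vector_derivative Re (- (joukowski_inverse (Complex x y))\<^sup>2)) (at x)"
    by (rule bounded_linear.has_vector_derivative[OF bounded_linear_Re])
  then have "((\<lambda>x. Re (shear_potential (Complex x y))) has_real_derivative - Re ((joukowski_inverse (Complex x y))\<^sup>2)) (at x)"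
    by (simp add: has_real_derivative_iff_has_vector_derivative)
  from DERIV_add[OF DERIV_ident DERIV_cmult[OF this, of c]] show ?thesis by simp
qed

text \<open>Off the segment |J| < 1, so for c < 1 the shear increases along horizontal
  lines.\<close>

lemma shear_row_derivative_ge:
  assumes "z \<in> slit_plane" "0 \<le> c"
  shows "1 - c \<le> 1 - c * Re ((joukowski_inverse z)\<^sup>2)"
proof -
  have "Re ((joukowski_inverse z)\<^sup>2) \<le> cmod ((joukowski_inverse z)\<^sup>2)" by (rule complex_Re_le_cmod)
  also have "\<dots> \<le> 1" using joukowski_inverse_norm_less_1[OF assms(1)] by (simp add: norm_power power_le_one)
  finally have "c * Re ((joukowski_inverse z)\<^sup>2) \<le> c * 1" using assms(2) by (intro mult_left_mono) auto
  then show ?thesis by simp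
qed

lemma shear_row_strict_mono:
  assumes "0 \<le> c" "c < 1" "x1 < x2" "\<And>x. x1 \<le> x \<Longrightarrow> x \<le> x2 \<Longrightarrow> Complex x y \<in> slit_plane"
  shows "x1 + c * Re (shear_potential (Complex x1 y)) < x2 + c * Re (shear_potential (Complex x2 y))"
proof (rule DERIV_pos_imp_increasing[OF assms(3)])
  fix x assume "x1 \<le> x" "x \<le> x2"
  then have S: "Complex x y \<in> slit_plane" using assms(4) by blast
  show "\<exists>d. ((\<lambda>x. x + c * Re (shear_potential (Complex x y))) has_real_derivative d) (at x) \<and> 0 < d"
  proof (intro exI conjI)
    show "((\<lambda>x. x + c * Re (shear_potential (Complex x y))) has_real_derivative
        1 - c * Re ((joukowski_inverse (Complex x y))\<^sup>2)) (at x)"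
      by (rule has_derivative_shear_row[OF S])
    show "0 < 1 - c * Re ((joukowski_inverse (Complex x y))\<^sup>2)"
      using shear_row_derivative_ge[OF S assms(1)] assms(2) by linarith
  qed
qed

lemma shear_row_surj:
  assumes c: "0 \<le> c" and y: "y \<noteq> 0"
  shows "\<exists>x. x + c * Re (shear_potential (Complex x y)) = u"
proof (rule surj_of_linear_growth[of _ 1 0 c])
  have S: "Complex x y \<in> slit_plane" for x using y by (simp add: mem_slit_plane)
  show "continuous_on UNIV (\<lambda>x. x + c * Re (shear_potential (Complex x y)))"
    using has_derivative_shear_row[OF S] by (meson DERIV_continuous_on has_field_derivative_at_within)
  have b: "\<bar>c * Re (shear_potential (Complex x y))\<bar> \<le> c" for x
  proof -
    have "\<bar>Re (shear_potential (Complex x y))\<bar> \<le> 1"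
      using abs_Re_le_cmod[of "shear_potential (Complex x y)"] shear_potential_bound[OF S, of x] by linarith
    then have "c * \<bar>Re (shear_potential (Complex x y))\<bar> \<le> c * 1" using c by (rule mult_left_mono)
    then show ?thesis using c by (simp add: abs_mult)
  qed
  show "1 * x - c \<le> x + c * Re (shear_potential (Complex x y))"
    and "x + c * Re (shear_potential (Complex x y)) \<le> 1 * x + c" for x using b[of x] by (simp_all add: abs_le_iff)
qed simp

text \<open>The root inside \<open>slit_sqrt\<close> depends only on \<open>z\<^sup>2\<close>, so
  everything built on it is odd. The left ray thus reduces to the right one.\<close>

lemma shear_potential_minus: "shear_potential (- z) = - shear_potential z"
  by (simp add: shear_potential_def joukowski_inverse_def slit_sqrt_def power3_eq_cube algebra_simps diff_divide_distrib)

text \<open>The shear on the ray \<open>x > 1\<close>, extended continuously to the tip \<open>x = 1\<close>.\<close>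

definition real_shear :: "real \<Rightarrow> real \<Rightarrow> real" where
  "real_shear c x = x + c * ((x - sqrt (x\<^sup>2 - 1)) - (x - sqrt (x\<^sup>2 - 1)) ^ 3 / 3) / 2"

lemma real_shear_1: "real_shear c 1 = 1 + c / 3"
  by (simp add: real_shear_def)

lemma real_shear_eq:
  assumes "1 < x"
  shows "x + c * Re (shear_potential (of_real x)) = real_shear c x"
proof -
  have "1 / x\<^sup>2 \<le> 1" using assms by (simp add: divide_le_eq one_le_power)
  then have "csqrt (of_real (1 - 1 / x\<^sup>2)) = of_real (sqrt (1 - 1 / x\<^sup>2))"
    by (simp only: of_real_sqrt diff_ge_0_iff_ge)
  then have "slit_sqrt (of_real x) = of_real (x * sqrt (1 - 1 / x\<^sup>2))" by (simp add: slit_sqrt_def)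
  also have "x * sqrt (1 - 1 / x\<^sup>2) = sqrt (x\<^sup>2 * (1 - 1 / x\<^sup>2))"
    using assms by (simp add: real_sqrt_mult)
  also have "x\<^sup>2 * (1 - 1 / x\<^sup>2) = x\<^sup>2 - 1" using assms by (simp add: right_diff_distrib)
  finally have "joukowski_inverse (of_real x) = of_real (x - sqrt (x\<^sup>2 - 1))" by (simp add: joukowski_inverse_def)
  then have "shear_potential (of_real x) = of_real (((x - sqrt (x\<^sup>2 - 1)) - (x - sqrt (x\<^sup>2 - 1)) ^ 3 / 3) / 2)"
    by (simp add: shear_potential_def)
  then show ?thesis by (simp only: real_shear_def Re_complex_of_real times_divide_eq_right)
qed

lemma continuous_on_real_shear: "continuous_on S (real_shear c)"
  unfolding real_shear_def by (intro continuous_intros) auto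

text \<open>The mean value theorem needs the derivative only between the end points, so the estimate
  extends to the tip x = 1.\<close>

lemma real_shear_diff_ge:
  assumes "0 \<le> c" "1 \<le> x1" "x1 < x2"
  shows "(1 - c) * (x2 - x1) \<le> real_shear c x2 - real_shear c x1"
proof -
  have der: "(real_shear c has_real_derivative 1 - c * Re ((joukowski_inverse (of_real x))\<^sup>2)) (at x)"
    if "1 < x" for x
  proof -
    have S: "Complex x 0 \<in> slit_plane" using that by (simp add: mem_slit_plane)
    have "(real_shear c has_real_derivative 1 - c * Re ((joukowski_inverse (Complex x 0))\<^sup>2)) (at x)"
    proof (rule has_field_derivative_transform_within_open[OF has_derivative_shear_row[OF S]])
      show "open {1::real<..}" "x \<in> {1<..}" using that by auto
      show "u + c * Re (shear_potential (Complex u 0)) = real_shear c u" if "u \<in> {1<..}" for u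
        using real_shear_eq[of u c] that by (simp add: complex_of_real_def)
    qed
    then show ?thesis by (simp add: complex_of_real_def)
  qed
  obtain l z where z: "x1 < z" "z < x2" "(real_shear c has_real_derivative l) (at z)"
     "real_shear c x2 - real_shear c x1 = (x2 - x1) * l"
    using MVT[OF assms(3) continuous_on_real_shear, of c] der assms(2)
    by (metis real_differentiable_def le_less_trans)
  have "l = 1 - c * Re ((joukowski_inverse (of_real z))\<^sup>2)"
    using DERIV_unique[OF z(3) der] z assms by simp
  also have "\<dots> \<ge> 1 - c"
    by (rule shear_row_derivative_ge) (use z assms in \<open>auto simp: mem_slit_plane\<close>)
  finally have "(x2 - x1) * (1 - c) \<le> (x2 - x1) * l" using assms by (intro mult_left_mono) auto
  then show ?thesis using z(4) by (simp add: mult.commute)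
qed

lemma real_shear_less_iff:
  assumes "0 \<le> c" "c < 1" "1 \<le> x1" "1 \<le> x2"
  shows "real_shear c x1 < real_shear c x2 \<longleftrightarrow> x1 < x2"
proof -
  have "real_shear c a < real_shear c b" if "1 \<le> a" "a < b" for a b
  proof -
    have "0 < (1 - c) * (b - a)" using assms that by simp
    then show ?thesis using real_shear_diff_ge[OF assms(1) that] by linarith
  qed
  then show ?thesis using assms by (metis less_asym' linorder_neqE_linordered_idom less_irrefl)
qed

text \<open>The displacement is (u - u^3 / 3) / 2 with u = J in [0, 1], increasing in u, with value
  1/3 at the tip u = 1.\<close>

lemma real_shear_potential_bounds:
  assumes "1 \<le> x"
  shows "0 \<le> real_shear 1 x - x" "real_shear 1 x - x \<le> 1 / 3"
proof -
  define u where "u = x - sqrt (x\<^sup>2 - 1)"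
  have "sqrt (x\<^sup>2 - 1) \<le> sqrt (x\<^sup>2)" by (rule real_sqrt_le_mono) simp
  then have u0: "0 \<le> u" using assms by (simp add: u_def)
  have "(x - 1)\<^sup>2 \<le> x\<^sup>2 - 1" using assms by (simp add: power2_eq_square algebra_simps)
  then have "sqrt ((x - 1)\<^sup>2) \<le> sqrt (x\<^sup>2 - 1)" by (rule real_sqrt_le_mono)
  then have u1: "u \<le> 1" using assms by (simp add: u_def)
  have e: "real_shear 1 x - x = (u - u ^ 3 / 3) / 2" by (simp add: real_shear_def u_def)
  have "u ^ 3 \<le> u" using power_decreasing[of 1 3 u] u0 u1 by simp
  then show "0 \<le> real_shear 1 x - x" using u0 unfolding e by simp
  \<comment> \<open>This factorization is the upper bound: the difference to 1/3 has a double zero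
    at u = 1.\<close>
  have "0 \<le> (u - 1)\<^sup>2 * (u + 2)" using u0 by simp
  also have "\<dots> = u ^ 3 - 3 * u + 2" by (simp add: power2_eq_square power3_eq_cube algebra_simps)
  finally show "real_shear 1 x - x \<le> 1 / 3" unfolding e by simp
qed

lemma real_shear_affine: "real_shear c x = x + c * (real_shear 1 x - x)"
  by (simp add: real_shear_def algebra_simps)

text \<open>The divisor is the image \<open>real_shear c 1\<close> of the tip 1, so that the middle
  slit is again [-1, 1].\<close>

definition shear_map :: "real \<Rightarrow> complex \<Rightarrow> complex" where
  "shear_map c z = (z + of_real (c * Re (shear_potential z))) / of_real (1 + c / 3)"

lemma shear_map_sel:
  "Re (shear_map c z) = (Re z + c * Re (shear_potential z)) / (1 + c / 3)"
  "Im (shear_map c z) = Im z / (1 + c / 3)"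
  unfolding shear_map_def Re_divide_of_real Im_divide_of_real by simp_all

lemma shear_map_minus: "shear_map c (- z) = - shear_map c z"
proof -
  have "- z + of_real (c * Re (shear_potential (- z))) = - (z + of_real (c * Re (shear_potential z)))"
    by (simp add: shear_potential_minus)
  then show ?thesis unfolding shear_map_def by (simp only: minus_divide_left)
qed

lemma shear_map_real:
  assumes "1 < x"
  shows "Re (shear_map c (of_real x)) = real_shear c x / (1 + c / 3)"
  unfolding shear_map_sel Re_complex_of_real using real_shear_eq[OF assms, of c] by simp

lemma shear_map_mem_slit_domain_iff:
  assumes c: "0 \<le> c" "c < 1" and st: "1 < s'" "1 < t'"
    and t: "real_shear c t' = (1 + c / 3) * t" and s: "real_shear c s' = (1 + c / 3) * s"
    and z: "z \<in> slit_plane"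
  shows "shear_map c z \<in> slit_domain b s t \<longleftrightarrow> z \<in> slit_domain b s' t'"
proof (cases "Im z = 0")
  case False
  then show ?thesis using c by (simp add: mem_slit_domain shear_map_sel)
next
  case True
  have l: "0 < 1 + c / 3" using c by simp
  have iff: "1 < real_shear c x / (1 + c / 3)"
    "real_shear c x / (1 + c / 3) < t \<longleftrightarrow> x < t'"
    "real_shear c x / (1 + c / 3) < s \<longleftrightarrow> x < s'" if "1 < x" for x
    using real_shear_less_iff[OF c, of 1 x] real_shear_less_iff[OF c, of x t'] real_shear_less_iff[OF c, of x s']
      that st t s l real_shear_1[of c] by (simp_all add: less_divide_eq divide_less_eq mult.commute)
  have t1: "1 < t" "1 < s"
  proof -
    have "(1 + c / 3) * 1 < (1 + c / 3) * t" "(1 + c / 3) * 1 < (1 + c / 3) * s"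
      using real_shear_less_iff[OF c, of 1 t'] real_shear_less_iff[OF c, of 1 s'] st t s real_shear_1[of c] by auto
    then show "1 < t" "1 < s" using mult_less_cancel_left_pos[OF l] by blast+
  qed
  define x where "x = Re z"
  have zx: "z = of_real x" using True by (simp add: x_def complex_eq_iff)
  have "1 < \<bar>x\<bar>" using z True by (simp add: mem_slit_plane x_def)
  then consider "1 < x" | "x < -1" by linarith
  then show ?thesis
  proof cases
    case 1
    define q where "q = real_shear c x / (1 + c / 3)"
    have "Re (shear_map c z) = q" using shear_map_real[OF 1] zx by (simp add: q_def)
    then show ?thesis
      using iff[OF 1, folded q_def] 1 True st t1 by (auto simp: mem_slit_domain shear_map_sel(2) x_def[symmetric])
  next
    case 2
    then have 1: "1 < - x" by simp
    have "Re (shear_map c z) = - Re (shear_map c (of_real (- x)))"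
      using shear_map_minus[of c "of_real (- x)"] by (simp add: zx)
    moreover define q where "q = real_shear c (- x) / (1 + c / 3)"
    ultimately have "Re (shear_map c z) = - q" using shear_map_real[OF 1] by simp
    then show ?thesis
      using iff[OF 1, folded q_def] 1 True st t1 by (auto simp: mem_slit_domain shear_map_sel(2) x_def[symmetric])
  qed
qed

lemma inj_on_shear_map:
  assumes c: "0 \<le> c" "c < 1"
  shows "inj_on (shear_map c) slit_plane"
proof (rule inj_onI)
  have l: "1 + c / 3 \<noteq> 0" using c by simp
  have le: "Re w \<le> Re z"
    if zw: "z \<in> slit_plane" "w \<in> slit_plane" "shear_map c z = shear_map c w" for z w
  proof (rule ccontr)
    assume "\<not> Re w \<le> Re z"
    then have lt: "Re z < Re w" by simp
    have im: "Im z = Im w" using zw(3) l by (metis divide_cancel_right shear_map_sel(2))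
    have re: "Re z + c * Re (shear_potential z) = Re w + c * Re (shear_potential w)"
      using zw(3) l by (metis divide_cancel_right shear_map_sel(1))
    show False
    \<comment> \<open>In these cases the horizontal segment from z to w avoids the slit. Otherwise z
      and w lie on opposite real rays, and their images have opposite signs.\<close>
    proof (cases "Im w \<noteq> 0 \<or> 1 < Re z \<or> Re w < -1")
      case True
      have "Complex x (Im w) \<in> slit_plane" if "Re z \<le> x" "x \<le> Re w" for x
        using True that by (auto simp: mem_slit_plane)
      from shear_row_strict_mono[OF c lt this]
      have "Re z + c * Re (shear_potential (Complex (Re z) (Im w))) < Re w + c * Re (shear_potential (Complex (Re w) (Im w)))" .
      moreover have "Complex (Re z) (Im w) = z" "Complex (Re w) (Im w) = w" by (simp_all add: complex_eq_iff im)
      ultimately show False using re by simp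
    next
      case False
      then have "Im w = 0" "Re z < -1" "1 < Re w" using zw(1,2) im by (auto simp: mem_slit_plane)
      define u where "u = Re w"
      define v where "v = - Re z"
      have uv: "1 < u" "1 < v" using \<open>Re z < -1\<close> \<open>1 < Re w\<close> by (auto simp: u_def v_def)
      have "w = of_real u" "z = - of_real v"
        using \<open>Im w = 0\<close> im by (auto simp: complex_eq_iff u_def v_def)
      then have "Re (shear_map c w) = real_shear c u / (1 + c / 3)"
        "Re (shear_map c z) = - (real_shear c v / (1 + c / 3))"
        using shear_map_real[OF uv(1), of c] shear_map_real[OF uv(2), of c] shear_map_minus[of c "of_real v"] by simp_all
      moreover have "0 < real_shear c x" if "1 < x" for x
        using real_shear_less_iff[OF c, of 1 x] that real_shear_1[of c] c by simp
      ultimately have "Re (shear_map c z) < 0" "0 < Re (shear_map c w)"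
        using uv c by simp_all
      then show False using zw(3) by simp
    qed
  qed
  fix z w assume "z \<in> slit_plane" "w \<in> slit_plane" "shear_map c z = shear_map c w"
  moreover from this have "Im z = Im w" using l by (metis divide_cancel_right shear_map_sel(2))
  ultimately show "z = w" using le[of z w] le[of w z] by (simp add: complex_eq_iff)
qed

lemma shear_map_surj:
  assumes c: "0 \<le> c" "c < 1" and w: "w \<in> slit_plane"
  shows "\<exists>z\<in>slit_plane. shear_map c z = w"
proof -
  have l: "0 < 1 + c / 3" using c by simp
  have pos: "\<exists>z\<in>slit_plane. shear_map c z = of_real u" if u: "1 < u" for u
  proof -
    define v where "v = (1 + c / 3) * u"
    have v: "1 + c / 3 < v" using mult_strict_left_mono[OF u l] by (simp add: v_def)
    have v1: "1 \<le> v" using v c by simp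
    \<comment> \<open>The interval [1, v] brackets the solution: its left end goes to 1 + c/3, below
      v, and its right end to at least v.\<close>
    have "v \<le> real_shear c v"
      using real_shear_affine[of c v] real_shear_potential_bounds(1)[OF v1] c by simp
    then obtain x where x: "1 \<le> x" "real_shear c x = v"
      using IVT'[of "real_shear c" 1 v v] continuous_on_real_shear v v1 real_shear_1[of c] by auto
    then have "x \<noteq> 1" using v real_shear_1[of c] by auto
    then have x1: "1 < x" using x by simp
    have "shear_map c (of_real x) = of_real u"
      using shear_map_real[OF x1, of c] x l by (simp add: complex_eq_iff shear_map_sel(2) v_def)
    then show ?thesis using x1 by (intro bexI[of _ "of_real x"]) (auto simp: mem_slit_plane)
  qed
  show ?thesis
  proof (cases "Im w = 0")
    case False
    obtain x where x: "x + c * Re (shear_potential (Complex x ((1 + c / 3) * Im w))) = (1 + c / 3) * Re w"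
      using shear_row_surj[OF c(1), of "(1 + c / 3) * Im w"] False l by auto
    have "shear_map c (Complex x ((1 + c / 3) * Im w)) = w"
      using l x by (simp add: complex_eq_iff shear_map_sel)
    moreover have "Complex x ((1 + c / 3) * Im w) \<in> slit_plane" using False l by (simp add: mem_slit_plane)
    ultimately show ?thesis by blast
  next
    case True
    then have "w = of_real (Re w)" by (simp add: complex_eq_iff)
    have "1 < \<bar>Re w\<bar>" using w True by (simp add: mem_slit_plane)
    then consider "1 < Re w" | "1 < - Re w" by linarith
    then show ?thesis
    proof cases
      case 1
      then show ?thesis using pos \<open>w = of_real (Re w)\<close> by metis
    next
      case 2
      then obtain z where z: "z \<in> slit_plane" "shear_map c z = of_real (- Re w)" using pos by blast
      have "shear_map c (- z) = w" using z(2) \<open>w = of_real (Re w)\<close> by (simp add: shear_map_minus)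
      moreover have "- z \<in> slit_plane" using z(1) by (simp add: mem_slit_plane)
      ultimately show ?thesis by blast
    qed
  qed
qed

lemma slit_domain_subset_slit_plane: "1 < s \<Longrightarrow> 1 < t \<Longrightarrow> slit_domain b s t \<subseteq> slit_plane"
  by (auto simp: mem_slit_domain mem_slit_plane)

lemma bij_betw_shear_map:
  assumes c: "0 \<le> c" "c < 1" and st: "1 < s'" "1 < t'" "1 < s" "1 < t"
    and t: "real_shear c t' = (1 + c / 3) * t" and s: "real_shear c s' = (1 + c / 3) * s"
  shows "bij_betw (shear_map c) (slit_domain b s' t') (slit_domain b s t)"
proof (rule bij_betw_imageI)
  note mem = shear_map_mem_slit_domain_iff[OF c st(1,2) t s]
  have sub: "slit_domain b s' t' \<subseteq> slit_plane" "slit_domain b s t \<subseteq> slit_plane"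
    using slit_domain_subset_slit_plane st by auto
  show "inj_on (shear_map c) (slit_domain b s' t')"
    by (rule inj_on_subset[OF inj_on_shear_map[OF c] sub(1)])
  show "shear_map c ` slit_domain b s' t' = slit_domain b s t"
  proof (intro equalityI subsetI)
    fix w assume w: "w \<in> slit_domain b s t"
    then obtain z where "z \<in> slit_plane" "shear_map c z = w" using shear_map_surj[OF c] sub(2) by blast
    then show "w \<in> shear_map c ` slit_domain b s' t'" using mem w by blast
  qed (use mem sub(1) in blast)
qed

text \<open>\<open>T c\<close> is the tip that the normalised shear sends to t. For c > 0 it lies
  beyond t, since the shear moves t by at most c/3 while the target has moved by c t / 3. Keeping c
  \<le> 1/2 bounds the slope below by 1/2 and makes T Lipschitz.\<close>

lemma tip_preimage:
  assumes t: "1 < t"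
  shows "\<exists>T. (\<forall>c\<in>{0..1/2}. t \<le> T c \<and> real_shear c (T c) = (1 + c / 3) * t) \<and> T 0 = t \<and> t < T (1/2) \<and>
    (\<forall>c\<in>{0..1/2}. \<forall>d\<in>{0..1/2}. \<bar>T c - T d\<bar> \<le> 2 * t / 3 * \<bar>c - d\<bar>)"
proof -
  have ex: "\<exists>u. t \<le> u \<and> real_shear c u = (1 + c / 3) * t" if c: "0 \<le> c" "c \<le> 1/2" for c
  proof -
    have "real_shear c t \<le> (1 + c / 3) * t"
    proof -
      have "c * (real_shear 1 t - t) \<le> c * (t / 3)"
        using real_shear_potential_bounds(2)[of t] t c by (intro mult_left_mono) auto
      then show ?thesis using real_shear_affine[of c t] by (simp add: algebra_simps)
    qed
    moreover have "(1 + c / 3) * t \<le> real_shear c (2 * t)"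
    proof -
      have "(1 + c / 3) * t \<le> 2 * t" using c t by (intro mult_right_mono) auto
      moreover have "0 \<le> c * (real_shear 1 (2 * t) - 2 * t)"
        using real_shear_potential_bounds(1)[of "2 * t"] t c by simp
      ultimately show ?thesis using real_shear_affine[of c "2 * t"] by linarith
    qed
    ultimately show ?thesis
      using IVT'[of "real_shear c" t "(1 + c / 3) * t" "2 * t"] continuous_on_real_shear t by auto
  qed
  define T where "T = (\<lambda>c. SOME u. t \<le> u \<and> real_shear c u = (1 + c / 3) * t)"
  have T: "t \<le> T c \<and> real_shear c (T c) = (1 + c / 3) * t" if "0 \<le> c" "c \<le> 1/2" for c
    unfolding T_def by (rule someI_ex[OF ex[OF that]])
  show ?thesis
  proof (intro exI[of _ T] conjI ballI)
    show "t \<le> T c" "real_shear c (T c) = (1 + c / 3) * t" if "c \<in> {0..1/2}" for c using T[of c] that by auto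
    show "T 0 = t" using T[of 0] by (simp add: real_shear_def)
    have "real_shear (1/2) t < (1 + (1/2) / 3) * t"
      using real_shear_affine[of "1/2" t] real_shear_potential_bounds(2)[of t] t by (simp add: algebra_simps)
    then show "t < T (1/2)" using T[of "1/2"] by (metis less_eq_real_def less_irrefl half_gt_zero_iff order_refl zero_less_one)
    \<comment> \<open>Both tips are compared under the shear with parameter c. There
      \<open>T d\<close> has moved by (c - d) k relative to parameter d, where k \<le> 1/3, and the
      slope is at least 1 - c.\<close>
    have le: "T c - T d \<le> 2 * t / 3 * \<bar>c - d\<bar>" if cd: "0 \<le> c" "c \<le> 1/2" "0 \<le> d" "d \<le> 1/2" for c d
    proof (cases "T d < T c")
      case True
      define k where "k = real_shear 1 (T d) - T d"
      have Td: "1 \<le> T d" using T[OF cd(3,4)] t by simp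
      have k: "0 \<le> k" "k \<le> 1/3" using real_shear_potential_bounds[OF Td] by (auto simp: k_def)
      have "(1 - c) * (T c - T d) \<le> real_shear c (T c) - real_shear c (T d)"
        by (rule real_shear_diff_ge[OF cd(1) Td True])
      also have "\<dots> = (1 + c / 3) * t - (T d + c * k)"
        using T[OF cd(1,2)] real_shear_affine[of c "T d"] by (simp add: k_def)
      also have "T d + c * k = (1 + d / 3) * t + (c - d) * k"
        using T[OF cd(3,4)] real_shear_affine[of d "T d"] by (simp add: k_def algebra_simps)
      also have "(1 + c / 3) * t - ((1 + d / 3) * t + (c - d) * k) = (c - d) * (t / 3 - k)"
        by (simp add: field_simps)
      also have "\<dots> \<le> \<bar>c - d\<bar> * (t / 3)" using k t by (intro mult_mono) auto
      finally have 1: "(1 - c) * (T c - T d) \<le> \<bar>c - d\<bar> * (t / 3)" .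
      have "1/2 * (T c - T d) \<le> (1 - c) * (T c - T d)" using cd True by (intro mult_right_mono) auto
      from order_trans[OF this 1] show ?thesis by (simp add: field_simps)
    next
      case False
      have "0 \<le> 2 * t / 3 * \<bar>c - d\<bar>" using t by simp
      then show ?thesis using False by linarith
    qed
    show "\<bar>T c - T d\<bar> \<le> 2 * t / 3 * \<bar>c - d\<bar>" if "c \<in> {0..1/2}" "d \<in> {0..1/2}" for c d
    proof (rule abs_leI)
      show "T c - T d \<le> 2 * t / 3 * \<bar>c - d\<bar>" using le[of c d] that by simp
      have "T d - T c \<le> 2 * t / 3 * \<bar>d - c\<bar>" using le[of d c] that by simp
      then show "- (T c - T d) \<le> 2 * t / 3 * \<bar>c - d\<bar>" by (simp add: abs_minus_commute)
    qed
  qed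
qed

section \<open>Monotonicity of the modulus and the family of slit domains\<close>

lemma nondegenerate_slit_domain_stretch:
  assumes nd: "nondegenerate (slit_domain b s t)" and st: "1 < s" "1 < t" "s \<le> s'" "t \<le> t'"
  shows "nondegenerate (slit_domain b s' t')"
proof -
  have ac: "-1 < stretch_coeff t t'" "-1 < stretch_coeff s s'"
    using stretch_coeff_nonneg[OF st(2,4)] stretch_coeff_nonneg[OF st(1,3)] by auto
  obtain G where "homeomorphism UNIV UNIV (stretch_map (stretch_coeff t t') (stretch_coeff s s')) G"
    using stretch_map_homeomorphism[OF ac] .
  from nondegenerate_image[OF this nd] show ?thesis
    using stretch_map_slit_domain[OF st(1,2) _ _ ac] st by simp
qed

text \<open>The outward stretch is a homeomorphism onto the larger domain, homotopic to the
  inclusion along horizontal segments; the old tip t lies only in the larger domain.\<close>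

lemma slit_domain_modulus_strict_mono:
  assumes nd: "nondegenerate (slit_domain b s t)" and st: "1 < s" "1 < t" "s \<le> s'" "t < t'"
  shows "real_modulus (slit_domain b s t) < real_modulus (slit_domain b s' t')"
proof -
  have ac0: "0 \<le> stretch_coeff t t'" "0 \<le> stretch_coeff s s'"
    using stretch_coeff_nonneg st by auto
  then have ac: "-1 < stretch_coeff t t'" "-1 < stretch_coeff s s'" by auto
  define \<Phi> where "\<Phi> = stretch_map (stretch_coeff t t') (stretch_coeff s s')"
  have im: "\<Phi> ` slit_domain b s t = slit_domain b s' t'"
    unfolding \<Phi>_def using st by (intro stretch_map_slit_domain ac) auto
  obtain G where G: "homeomorphism UNIV UNIV \<Phi> G"
    using stretch_map_homeomorphism[OF ac] unfolding \<Phi>_def by blast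
  show ?thesis
  proof (rule real_modulus_strict_mono[OF nd])
    show "nondegenerate (slit_domain b s' t')" using nondegenerate_slit_domain_stretch[OF nd st(1-3)] st(4) by simp
    show "homeomorphism (slit_domain b s t) (slit_domain b s' t') \<Phi> G"
      using homeomorphism_of_subsets[OF G _ _ im] by simp
    have "of_real t \<in> slit_domain b s' t'" "of_real t \<notin> slit_domain b s t"
      using st by (auto simp: mem_slit_domain)
    moreover have "slit_domain b s t \<subseteq> slit_domain b s' t'" using st by (auto simp: mem_slit_domain)
    ultimately show "slit_domain b s t \<subset> slit_domain b s' t'" by blast
    fix z assume z: "z \<in> slit_domain b s t"
    then have \<Phi>z: "\<Phi> z \<in> slit_domain b s' t'" using im by blast
    have Im\<Phi>: "Im (\<Phi> z) = Im z" by (simp add: \<Phi>_def stretch_map_def)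
    show "closed_segment z (\<Phi> z) \<subseteq> slit_domain b s' t'"
    proof
      fix w assume "w \<in> closed_segment z (\<Phi> z)"
      then obtain u where u: "0 \<le> u" "u \<le> 1" "w = (1 - u) *\<^sub>R z + u *\<^sub>R \<Phi> z" by (auto simp: in_segment)
      have Imw: "Im w = Im z" using Im\<Phi> by (simp add: u(3) algebra_simps)
      have Rew: "Re w = (1 - u) * Re z + u * Re (\<Phi> z)" by (simp add: u(3))
      show "w \<in> slit_domain b s' t'"
      proof (cases "Im z = 0")
        case False
        then show ?thesis using Imw by (simp add: mem_slit_domain)
      next
        case True
        let ?f = "stretch (stretch_coeff t t') (stretch_coeff s s')"
        have Re\<Phi>: "Re (\<Phi> z) = ?f (Re z)" by (simp add: \<Phi>_def stretch_map_def)
        have conv: "Re w \<in> X" if "convex X" "Re z \<in> X" "Re (\<Phi> z) \<in> X" for X :: "real set"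
          using convexD[OF that(1) that(2) that(3), of "1 - u" u] u by (simp add: Rew)
        have z1: "1 < \<bar>Re z\<bar>" "Re z < t" "b \<longrightarrow> - s < Re z" using z True by (auto simp: mem_slit_domain)
        have \<Phi>1: "Re (\<Phi> z) < t'" "b \<longrightarrow> - s' < Re (\<Phi> z)" using \<Phi>z True Im\<Phi> by (auto simp: mem_slit_domain)
        show ?thesis
        proof (cases "1 < Re z")
          case 1: True
          have "?f 1 < ?f (Re z)" using strict_mono_less[OF stretch_strict_mono[OF ac]] 1 by blast
          then have "1 < Re (\<Phi> z)" unfolding Re\<Phi> by (simp add: stretch_id)
          then have "Re w \<in> {1<..<t'}" using 1 z1 st \<Phi>1 by (intro conv) auto
          then show ?thesis using Imw True st by (auto simp: mem_slit_domain)
        next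
          case 2: False
          then have n: "Re z < -1" using z1 by linarith
          have "?f (Re z) < ?f (-1)" using strict_mono_less[OF stretch_strict_mono[OF ac]] n by blast
          then have "Re (\<Phi> z) < -1" unfolding Re\<Phi> by (simp add: stretch_id)
          then have "Re w \<in> {..< -1}" using n by (intro conv) auto
          moreover have "- s' < Re w" if b
          proof -
            have "Re w \<in> {- s'<..}" using that z1(3) \<Phi>1(2) st by (intro conv) auto
            then show ?thesis by simp
          qed
          moreover have "Re w < t'" using calculation(1) st by simp
          ultimately show ?thesis using Imw True by (auto simp: mem_slit_domain)
        qed
      qed
    qed
  qed
qed

lemma harmonic_homeomorphism_of_slit_domain:
  assumes nd: "nondegenerate \<Omega>'" and \<Omega>': "\<Omega>' = (\<lambda>z. \<alpha> * z + \<beta>) ` slit_domain b s t"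
    and \<alpha>: "\<alpha> \<noteq> 0" and st: "1 < s" "1 < t"
  shows "\<exists>\<epsilon>::real. 0 < \<epsilon> \<and>
           (\<forall>\<Omega> :: complex set.
              doubly_connected \<Omega> \<longrightarrow>
              conformal_modulus \<Omega>' < conformal_modulus \<Omega> \<longrightarrow>
              conformal_modulus \<Omega> < conformal_modulus \<Omega>' + ereal \<epsilon> \<longrightarrow>
              (\<exists>h. harmonic_homeomorphism \<Omega> \<Omega>' h))"
proof -
  have "(\<lambda>z. (1/\<alpha>) * z + (- \<beta> / \<alpha>)) ` \<Omega>' = (\<lambda>z. z) ` slit_domain b s t"
    unfolding \<Omega>' image_image by (rule image_cong) (use \<alpha> in \<open>auto simp: field_simps\<close>)
  then have nd0: "nondegenerate (slit_domain b s t)"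
    using nondegenerate_affine_image[of "1/\<alpha>" 0 \<Omega>' "- \<beta> / \<alpha>"] \<alpha> nd by simp
  have m0: "real_modulus \<Omega>' = real_modulus (slit_domain b s t)"
    unfolding \<Omega>' by (rule real_modulus_similarity[OF \<alpha> nd0])
  obtain T where T': "\<forall>c\<in>{0..1/2}. t \<le> T c \<and> real_shear c (T c) = (1 + c / 3) * t"
    "T 0 = t" "t < T (1/2)" "\<forall>c\<in>{0..1/2}. \<forall>d\<in>{0..1/2}. \<bar>T c - T d\<bar> \<le> 2 * t / 3 * \<bar>c - d\<bar>"
    using tip_preimage[OF st(2)] by blast
  have T: "\<And>c. 0 \<le> c \<Longrightarrow> c \<le> 1/2 \<Longrightarrow> t \<le> T c \<and> real_shear c (T c) = (1 + c / 3) * t"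
    "T 0 = t" "t < T (1/2)"
    "\<And>c d. 0 \<le> c \<Longrightarrow> c \<le> 1/2 \<Longrightarrow> 0 \<le> d \<Longrightarrow> d \<le> 1/2 \<Longrightarrow> \<bar>T c - T d\<bar> \<le> 2 * t / 3 * \<bar>c - d\<bar>"
    using T' by auto
  obtain S where S': "\<forall>c\<in>{0..1/2}. s \<le> S c \<and> real_shear c (S c) = (1 + c / 3) * s"
    "S 0 = s" "s < S (1/2)" "\<forall>c\<in>{0..1/2}. \<forall>d\<in>{0..1/2}. \<bar>S c - S d\<bar> \<le> 2 * s / 3 * \<bar>c - d\<bar>"
    using tip_preimage[OF st(1)] by blast
  have S: "\<And>c. 0 \<le> c \<Longrightarrow> c \<le> 1/2 \<Longrightarrow> s \<le> S c \<and> real_shear c (S c) = (1 + c / 3) * s"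
    "S 0 = s" "s < S (1/2)"
    "\<And>c d. 0 \<le> c \<Longrightarrow> c \<le> 1/2 \<Longrightarrow> 0 \<le> d \<Longrightarrow> d \<le> 1/2 \<Longrightarrow> \<bar>S c - S d\<bar> \<le> 2 * s / 3 * \<bar>c - d\<bar>"
    using S' by auto
  \<comment> \<open>The parameter is halved because the tips are controlled for c up to 1/2.\<close>
  define U where "U = (\<lambda>x. slit_domain b (S (x/2)) (T (x/2)))"
  \<comment> \<open>The Lipschitz constant 2 t / 3 of T, halved by the reparametrisation, times the
    bound on the stretch coefficient for tips beyond t.\<close>
  define Ct where "Ct = t / 3 * (t / (t - 1)\<^sup>2)"
  define Cs where "Cs = s / 3 * (s / (s - 1)\<^sup>2)"
  have C0: "0 \<le> Ct" "0 \<le> Cs" using st by (auto simp: Ct_def Cs_def)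
  show ?thesis
  proof (rule harmonic_homeomorphism_of_family[OF nd, of U "Ct + Cs"])
    show "0 \<le> Ct + Cs" using C0 by simp
    show "real_modulus (U 0) \<le> real_modulus \<Omega>'" by (simp add: m0 U_def T S)
    show "real_modulus \<Omega>' < real_modulus (U 1)"
      unfolding m0 U_def using slit_domain_modulus_strict_mono[OF nd0 st] S(3) T(3) by simp
  next
    fix x :: real assume x: "x \<in> {0..1}"
    define c where "c = x / 2"
    have c: "0 \<le> c" "c \<le> 1/2" using x by (auto simp: c_def)
    show "nondegenerate (U x)"
      unfolding U_def c_def[symmetric] using nondegenerate_slit_domain_stretch[OF nd0 st] S(1)[OF c] T(1)[OF c] by blast
    have st': "1 < S c" "1 < T c" using S(1)[OF c] T(1)[OF c] st by linarith+
    have sub: "U x \<subseteq> slit_plane" unfolding U_def c_def[symmetric] by (rule slit_domain_subset_slit_plane[OF st'])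
    have bij: "bij_betw (shear_map c) (U x) (slit_domain b s t)"
      unfolding U_def c_def[symmetric]
      using S(1)[OF c] T(1)[OF c] c by (intro bij_betw_shear_map st' st) auto
    have "bij_betw (\<lambda>z. \<alpha> * z + \<beta>) (slit_domain b s t) \<Omega>'"
      unfolding \<Omega>' using \<alpha> by (auto simp: bij_betw_def inj_on_def)
    from bij_betw_trans[OF bij this] have bij2: "bij_betw (\<lambda>z. \<alpha> * shear_map c z + \<beta>) (U x) \<Omega>'" by (simp add: o_def)
    define l where "l = complex_of_real (1 + c / 3)"
    \<comment> \<open>Since 2 Re k = k + cnj k, the shear splits into a holomorphic and an
      antiholomorphic part; \<alpha> is conjugated in \<open>Q\<close> because \<open>Q\<close>
      enters under \<open>cnj\<close>.\<close>
    define P where "P = (\<lambda>z. \<alpha> * (z + of_real (c / 2) * shear_potential z) / l + \<beta>)"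
    define Q where "Q = (\<lambda>z. cnj \<alpha> * (of_real (c / 2) * shear_potential z) / l)"
    have "1 + c / 3 \<noteq> 0" using c by simp
    then have l0: "l \<noteq> 0" unfolding l_def of_real_eq_0_iff .
    have hol: "shear_potential holomorphic_on U x" using holomorphic_on_subset[OF holomorphic_shear_potential sub] .
    have "\<alpha> * shear_map c z + \<beta> = P z + cnj (Q z)" for z
    proof -
      have "complex_of_real (c * Re w) = of_real (c / 2) * w + of_real (c / 2) * cnj w" for w
        by (simp add: complex_eq_iff)
      moreover have "cnj l = l" by (simp add: l_def)
      ultimately show ?thesis
        unfolding P_def Q_def shear_map_def l_def[symmetric] by (simp add: add_divide_distrib algebra_simps)
    qed
    then have "bij_betw (\<lambda>z. P z + cnj (Q z)) (U x) \<Omega>'" using bij2 by simp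
    moreover have "P holomorphic_on U x" "Q holomorphic_on U x"
      unfolding P_def Q_def using l0 by (auto intro!: holomorphic_intros hol)
    ultimately show "\<exists>P Q. P holomorphic_on U x \<and> Q holomorphic_on U x \<and> bij_betw (\<lambda>z. P z + cnj (Q z)) (U x) \<Omega>'"
      by blast
  next
    fix x y :: real assume xy: "x \<in> {0..1}" "y \<in> {0..1}" and lt: "(Ct + Cs) * \<bar>x - y\<bar> < 1"
    define c where "c = x / 2"
    define d where "d = y / 2"
    have c: "0 \<le> c" "c \<le> 1/2" and d: "0 \<le> d" "d \<le> 1/2" using xy by (auto simp: c_def d_def)
    have cd: "\<bar>d - c\<bar> = \<bar>x - y\<bar> / 2" by (simp add: c_def d_def field_simps abs_if)
    have st': "1 < S c" "1 < T c" "1 < S d" "1 < T d"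
      using S(1)[OF c] T(1)[OF c] S(1)[OF d] T(1)[OF d] st by linarith+
    define a where "a = stretch_coeff (T c) (T d)"
    define e where "e = stretch_coeff (S c) (S d)"
    have a: "\<bar>a\<bar> \<le> Ct * \<bar>x - y\<bar>"
    proof -
      have "\<bar>a\<bar> \<le> \<bar>T d - T c\<bar> * (t / (t - 1)\<^sup>2)" unfolding a_def using st T(1)[OF c] by (intro stretch_coeff_abs_le) auto
      also have "\<dots> \<le> (2 * t / 3 * \<bar>d - c\<bar>) * (t / (t - 1)\<^sup>2)" using T(4)[OF d c] st by (intro mult_right_mono) auto
      also have "\<dots> = Ct * \<bar>x - y\<bar>" unfolding cd Ct_def by simp
      finally show ?thesis .
    qed
    have e: "\<bar>e\<bar> \<le> Cs * \<bar>x - y\<bar>"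
    proof -
      have "\<bar>e\<bar> \<le> \<bar>S d - S c\<bar> * (s / (s - 1)\<^sup>2)" unfolding e_def using st S(1)[OF c] by (intro stretch_coeff_abs_le) auto
      also have "\<dots> \<le> (2 * s / 3 * \<bar>d - c\<bar>) * (s / (s - 1)\<^sup>2)" using S(4)[OF d c] st by (intro mult_right_mono) auto
      also have "\<dots> = Cs * \<bar>x - y\<bar>" unfolding cd Cs_def by simp
      finally show ?thesis .
    qed
    have "Ct * \<bar>x - y\<bar> \<le> (Ct + Cs) * \<bar>x - y\<bar>" "Cs * \<bar>x - y\<bar> \<le> (Ct + Cs) * \<bar>x - y\<bar>"
      using C0 by (auto intro!: mult_right_mono)
    then have ae: "\<bar>a\<bar> \<le> (Ct + Cs) * \<bar>x - y\<bar>" "\<bar>e\<bar> \<le> (Ct + Cs) * \<bar>x - y\<bar>" using a e by linarith+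
    then have ae1: "-1 < a" "-1 < e" using lt by linarith+
    obtain G where G: "homeomorphism UNIV UNIV (stretch_map a e) G" using stretch_map_homeomorphism[OF ae1] .
    have im: "stretch_map a e ` U x = U y"
      unfolding U_def c_def[symmetric] d_def[symmetric] a_def e_def
      using ae1 unfolding a_def e_def by (intro stretch_map_slit_domain st')
    have "homeomorphism (U x) (U y) (stretch_map a e) G" using homeomorphism_of_subsets[OF G _ _ im] by simp
    moreover have "quasiconformal_on (1 / (1 - (Ct + Cs) * \<bar>x - y\<bar>)) (U x) (stretch_map a e)
        (\<lambda>z v. Complex (stretch' a e (Re z) * Re v) (Im v))"
      by (rule stretch_map_quasiconformal[OF lt ae])
    ultimately show "\<exists>F D G. quasiconformal_on (1 / (1 - (Ct + Cs) * \<bar>x - y\<bar>)) (U x) F D \<and> homeomorphism (U x) (U y) F G"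
      by blast
  qed
qed

text \<open>z -> 2 z + 1 takes [-1, 0] to [-1, 1] and s to 2 s + 1. With the flag
  \<open>False\<close> any number above 1 can stand for the left tip; 2 is one choice.\<close>

lemma teichmueller_ring_eq:
  "teichmueller_ring s = (\<lambda>z. (1/2) * z + (- 1/2)) ` slit_domain False 2 (2 * s + 1)"
proof (intro equalityI subsetI)
  fix z assume z: "z \<in> teichmueller_ring s"
  have "2 * z + 1 \<in> slit_domain False 2 (2 * s + 1)"
  proof (cases "Im z = 0")
    case True
    then have "z = of_real (Re z)" by (simp add: complex_eq_iff)
    then have "Re z \<notin> {-1..0} \<union> {s..}" using z unfolding teichmueller_ring_def by (metis ComplD imageI)
    then show ?thesis by (auto simp: mem_slit_domain)
  qed (simp add: mem_slit_domain)
  moreover have "z = (1/2) * (2 * z + 1) + (- 1/2)" by (simp add: algebra_simps)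
  ultimately show "z \<in> (\<lambda>z. (1/2) * z + (- 1/2)) ` slit_domain False 2 (2 * s + 1)" by blast
next
  fix z assume "z \<in> (\<lambda>z. (1/2) * z + (- 1/2)) ` slit_domain False 2 (2 * s + 1)"
  then obtain w where w: "w \<in> slit_domain False 2 (2 * s + 1)" "z = (1/2) * w + (- 1/2)" by blast
  show "z \<in> teichmueller_ring s"
  proof (cases "Im z = 0")
    case True
    then have "1 < \<bar>2 * Re z + 1\<bar>" "2 * Re z + 1 < 2 * s + 1" using w by (auto simp: mem_slit_domain)
    then have "Re z \<notin> {-1..0} \<union> {s..}" by auto
    then show ?thesis by (auto simp: teichmueller_ring_def)
  qed (auto simp: teichmueller_ring_def)
qed

lemma double_teichmueller_ring_eq: "double_teichmueller_ring s t = slit_domain True s t"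
  by (simp add: double_teichmueller_ring_def slit_domain_def Un_commute)

theorem theorem3:
  fixes \<Omega>' :: "complex set"
  assumes "doubly_connected \<Omega>'" and "nondegenerate \<Omega>'"
    and "conformal_modulus \<Omega>' < affine_modulus \<Omega>' \<or>
         (\<exists>s>0. \<Omega>' = teichmueller_ring s) \<or>
         (\<exists>s>1. \<exists>t>1. \<Omega>' = double_teichmueller_ring s t)"
  shows "\<exists>\<epsilon>::real. 0 < \<epsilon> \<and>
           (\<forall>\<Omega> :: complex set.
              doubly_connected \<Omega> \<longrightarrow>
              conformal_modulus \<Omega>' < conformal_modulus \<Omega> \<longrightarrow>
              conformal_modulus \<Omega> < conformal_modulus \<Omega>' + ereal \<epsilon> \<longrightarrow>
              (\<exists>h. harmonic_homeomorphism \<Omega> \<Omega>' h))"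
  using assms(3)
proof (elim disjE exE conjE)
  assume "conformal_modulus \<Omega>' < affine_modulus \<Omega>'"
  then show ?thesis by (rule harmonic_homeomorphism_of_affine_modulus[OF assms(2)])
next
  fix s :: real assume "0 < s" "\<Omega>' = teichmueller_ring s"
  then show ?thesis
    by (intro harmonic_homeomorphism_of_slit_domain[OF assms(2), of "1/2" "- 1/2" False 2 "2 * s + 1"])
      (simp_all add: teichmueller_ring_eq)
next
  fix s t :: real assume "1 < s" "1 < t" "\<Omega>' = double_teichmueller_ring s t"
  then show ?thesis
    by (intro harmonic_homeomorphism_of_slit_domain[OF assms(2), of 1 0 True s t])
      (simp_all add: double_teichmueller_ring_eq)
qed

end
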